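(* Let $T>0$, and let $p_0^*$ and $h$ satisfy Assumptions A1 and A2 of the context. Let $\rho(x,t)$, $x\in\mathbb{R}^d$, $t\in[0,T]$, be the limit of the time-stepping procedure described in the context, given explicitly by $$\rho(x,t)=c_t\,\exp\Big(h(x)(Z_t-Z_0)-\tfrac12|h(x)|^2t\Big)\,p_0^*(x),$$ where $c_t$ is the normalizing constant for which $\int\rho(x,t)\,dx=1$. Then $\rho$ is a weak solution of the nonlinear filter with prior $\rho_0=p_0^*$. That is, for every test function $f\in C_c(\mathbb{R}^d)$ and every $t\in[0,T]$, $$\langle f,\rho_t\rangle=\langle f,\rho_0\rangle+\int_0^t\langle (h-\hat h_s)f,\rho_s\rangle\,(dZ_s-\hat h_s\,ds),$$ where the stochastic integral is an It\^o integral, $\langle f,\rho_t\rangle=\int f(x)\rho(x,t)\,dx$ and $\hat h_t=\int h(x)\rho(x,t)\,dx$.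
   Context: **Model.** $X_t\in\mathbb{R}^d$ is constant in time ($dX_t=0$), with $X_0$ distributed according to the density $p_0^*$. The real-valued observation process satisfies $dZ_t=h(X_t)\,dt+dW_t$, where $\{W_t\}$ is a standard Wiener process independent of $X_0$. Stochastic differential equations are in It\^o form. $\mathcal{P}$ denotes the set of probability densities on $\mathbb{R}^d$ with finite second moment. **Assumption A1.** $p_0^*\in\mathcal{P}$ has the form $p_0^*(x)=e^{-\mathcal{G}_0(x)}$, where $\mathcal{G}_0\in C^2$, $D^2\mathcal{G}_0\in L^\infty$, and $|\nabla\mathcal{G}_0|(x)\to\infty$ as $|x|\to\infty$. **Assumption A2.** $h\in C^2(\mathbb{R}^d)$ is real-valued, with $h,\nabla h,D^2h\in L^\infty$. **Time-stepping procedure.** For $0=t_0<t_1<\dots<t_N=T$ put $\Delta t_n=t_n-t_{n-1}$, $\Delta Z_n=Z_{t_n}-Z_{t_{n-1}}$, $Y_n=\Delta Z_n/\Delta t_n$. Set $\rho_0=p_0^*$ and let $\rho_n\in\mathcal{P}$ be the minimizer over $\rho\in\mathcal{P}$ of $$I_n(\rho)=D(\rho\mid\rho_{n-1})+\frac{\Delta t_n}{2}\int\rho(x)(Y_n-h(x))^2\,dx,\qquad D(\rho\mid\rho_{n-1})=\int\rho\ln(\rho/\rho_{n-1})\,dx.$$ Equivalently, $\rho_n\propto\rho_{n-1}\exp(-\tfrac{\Delta t_n}{2}(Y_n-h)^2)$. Define $\rho^{(N)}(x,t)$ by $\rho^{(N)}(x,t_n)=\rho_n(x)$, with $\rho^{(N)}$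 constant in $t$ on each interval $[t_{n-1},t_n)$. As $\max_{n\le N}\Delta t_n\to0$ with $N\to\infty$, $\rho^{(N)}(x,t)\to\rho(x,t)$ pointwise for each fixed sample path, with $\rho(x,t)$ given by the explicit formula in the claim. *)

theory Defs
  imports "HOL-Probability.Probability"
begin

section \<open>Densities and the standing assumptions\<close>

text \<open>\<open>densities2\<close> is the class \<open>P\<close> of probability densities with finite second moment.\<close>

definition densities2 :: "('a::euclidean_space \<Rightarrow> real) set" where
  "densities2 = {p. p \<in> borel_measurable borel \<and> (\<forall>x. 0 \<le> p x)
      \<and> (\<integral>\<^sup>+x. ennreal (p x) \<partial>lborel) = 1
      \<and> integrable lborel (\<lambda>x. (norm x)\<^sup>2 * p x)}"

definition is_C2 ::
  "('a::euclidean_space \<Rightarrow> real) \<Rightarrow> ('a \<Rightarrow> 'a) \<Rightarrow> ('a \<Rightarrow> 'a \<Rightarrow>\<^sub>L 'a) \<Rightarrow> bool"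
where \<comment> \<open>\<open>g\<close> is \<open>C\<^sup>2\<close> with gradient \<open>Dg\<close> and Hessian \<open>D2g\<close>\<close>
  "is_C2 g Dg D2g \<longleftrightarrow>
     (\<forall>x. GDERIV g x :> Dg x) \<and>
     (\<forall>x. (Dg has_derivative blinfun_apply (D2g x)) (at x)) \<and>
     continuous_on UNIV D2g"

text \<open>All functions required to be in \<open>L\<^sup>\<infinity>\<close> below are continuous, so membership in
  \<open>L\<^sup>\<infinity>\<close> is boundedness of the range.\<close>

definition assumption_A1 :: "('a::euclidean_space \<Rightarrow> real) \<Rightarrow> bool" where
  "assumption_A1 p0 \<longleftrightarrow> p0 \<in> densities2 \<and>
     (\<exists>G DG D2G. (\<forall>x. p0 x = exp (- G x)) \<and> is_C2 G DG D2G \<and> bounded (range D2G) \<and>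
        filterlim (\<lambda>x. norm (DG x)) at_top at_infinity)"

definition assumption_A2 :: "('a::euclidean_space \<Rightarrow> real) \<Rightarrow> bool" where
  "assumption_A2 h \<longleftrightarrow>
     (\<exists>Dh D2h. is_C2 h Dh D2h \<and> bounded (range h) \<and> bounded (range Dh) \<and> bounded (range D2h))"

definition test_function :: "('a::euclidean_space \<Rightarrow> real) \<Rightarrow> bool" where
  "test_function f \<longleftrightarrow> continuous_on UNIV f \<and> compact (closure {x. f x \<noteq> 0})"

definition pairing :: "('a::euclidean_space \<Rightarrow> real) \<Rightarrow> ('a \<Rightarrow> real) \<Rightarrow> real" where
  "pairing f r = (\<integral>x. f x * r x \<partial>lborel)"


section \<open>Wiener process and observation model\<close>

definition standard_wiener :: "'w measure \<Rightarrow> (real \<Rightarrow> 'w \<Rightarrow> real) \<Rightarrow> bool" where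
  "standard_wiener M W \<longleftrightarrow>
     (\<forall>t\<ge>0. W t \<in> borel_measurable M) \<and>
     (\<forall>\<omega>\<in>space M. W 0 \<omega> = 0 \<and> continuous_on {0..} (\<lambda>t. W t \<omega>)) \<and>
     (\<forall>s t. 0 \<le> s \<and> s < t \<longrightarrow>
        distributed M lborel (\<lambda>\<omega>. W t \<omega> - W s \<omega>) (normal_density 0 (sqrt (t - s)))) \<and>
     (\<forall>(n::nat) \<tau>. 0 \<le> \<tau> 0 \<and> (\<forall>i<n. \<tau> i < \<tau> (Suc i)) \<longrightarrow>
        prob_space.indep_vars M (\<lambda>_. borel) (\<lambda>i \<omega>. W (\<tau> (Suc i)) \<omega> - W (\<tau> i) \<omega>) {..<n})"

text \<open>The constant signal \<open>dX = 0\<close> with \<open>X\<^sub>0\<close> of density \<open>p0\<close>, and the observation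
  \<open>dZ = h(X) dt + dW\<close>. No condition is imposed on the initial value \<open>Z\<^sub>0\<close>.\<close>

definition observation_model ::
  "'w measure \<Rightarrow> ('a::euclidean_space \<Rightarrow> real) \<Rightarrow> ('a \<Rightarrow> real) \<Rightarrow>
   (real \<Rightarrow> 'w \<Rightarrow> 'a) \<Rightarrow> (real \<Rightarrow> 'w \<Rightarrow> real) \<Rightarrow> (real \<Rightarrow> 'w \<Rightarrow> real) \<Rightarrow> bool"
where
  "observation_model M p0 h X W Z \<longleftrightarrow>
     prob_space M \<and>
     distributed M lborel (X 0) (\<lambda>x. ennreal (p0 x)) \<and>
     (\<forall>t\<ge>0. \<forall>\<omega>\<in>space M. X t \<omega> = X 0 \<omega>) \<and>
     standard_wiener M W \<and>
     prob_space.indep_set M {X 0 -` A \<inter> space M | A. A \<in> sets borel}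
       (sigma_sets (space M) {W t -` A \<inter> space M | t A. 0 \<le> t \<and> A \<in> sets borel}) \<and>
     (\<forall>t\<ge>0. \<forall>\<omega>\<in>space M. Z t \<omega> = Z 0 \<omega> + (LBINT s:{0..t}. h (X s \<omega>)) + (W t \<omega> - W 0 \<omega>))"

text \<open>The filtration generated by signal and noise; \<open>W\<close> is a Wiener process relative to it and
  the increments of \<open>Z\<close> are adapted to it.\<close>

definition model_filtration ::
  "'w measure \<Rightarrow> (real \<Rightarrow> 'w \<Rightarrow> 'a::euclidean_space) \<Rightarrow> (real \<Rightarrow> 'w \<Rightarrow> real) \<Rightarrow> real \<Rightarrow> 'w measure"
where
  "model_filtration M X W t = sigma (space M)
     ({X 0 -` A \<inter> space M | A. A \<in> sets borel} \<union>
      {W s -` A \<inter> space M | s A. 0 \<le> s \<and> s \<le> t \<and> A \<in> sets borel})"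


section \<open>Ito integral\<close>

definition elementary_process ::
  "(real \<Rightarrow> 'w measure) \<Rightarrow> real \<Rightarrow> nat \<Rightarrow> (nat \<Rightarrow> real) \<Rightarrow> (nat \<Rightarrow> 'w \<Rightarrow> real) \<Rightarrow> bool"
where
  "elementary_process F t m \<tau> e \<longleftrightarrow>
     0 \<le> \<tau> 0 \<and> \<tau> m \<le> t \<and> (\<forall>i<m. \<tau> i \<le> \<tau> (Suc i)) \<and>
     (\<forall>i<m. e i \<in> borel_measurable (F (\<tau> i)) \<and> bounded (e i ` space (F (\<tau> i))))"

definition elementary_value ::
  "nat \<Rightarrow> (nat \<Rightarrow> real) \<Rightarrow> (nat \<Rightarrow> 'w \<Rightarrow> real) \<Rightarrow> real \<Rightarrow> 'w \<Rightarrow> real"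
where
  "elementary_value m \<tau> e s \<omega> = (\<Sum>i<m. e i \<omega> * indicator {\<tau> i<..\<tau> (Suc i)} s)"

definition elementary_integral ::
  "(real \<Rightarrow> 'w \<Rightarrow> real) \<Rightarrow> nat \<Rightarrow> (nat \<Rightarrow> real) \<Rightarrow> (nat \<Rightarrow> 'w \<Rightarrow> real) \<Rightarrow> 'w \<Rightarrow> real"
where
  "elementary_integral W m \<tau> e \<omega> = (\<Sum>i<m. e i \<omega> * (W (\<tau> (Suc i)) \<omega> - W (\<tau> i) \<omega>))"

definition adapted_process ::
  "'w measure \<Rightarrow> (real \<Rightarrow> 'w measure) \<Rightarrow> real \<Rightarrow> (real \<Rightarrow> 'w \<Rightarrow> real) \<Rightarrow> bool"
where \<comment> \<open>on the time interval \<open>[0,t]\<close>\<close>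
  "adapted_process M F t \<phi> \<longleftrightarrow>
     (\<lambda>(s, \<omega>). indicator {0..t} s * \<phi> s \<omega>) \<in> borel_measurable (borel \<Otimes>\<^sub>M M) \<and>
     (\<forall>s\<in>{0..t}. \<phi> s \<in> borel_measurable (F s))"

text \<open>\<open>has_ito_integral M F W \<phi> t J\<close>: \<open>J\<close> is (a version of) the integral of \<open>\<phi>\<close> over
  \<open>[0,t]\<close> against the \<open>F\<close>-Wiener process \<open>W\<close>, i.e. the \<open>L\<^sup>2\<close>-limit of the integrals of
  elementary adapted processes that approximate \<open>\<phi>\<close> in \<open>L\<^sup>2(ds \<times> M)\<close>. It is determined up to
  null sets.\<close>

definition has_ito_integral ::
  "'w measure \<Rightarrow> (real \<Rightarrow> 'w measure) \<Rightarrow> (real \<Rightarrow> 'w \<Rightarrow> real) \<Rightarrow>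
   (real \<Rightarrow> 'w \<Rightarrow> real) \<Rightarrow> real \<Rightarrow> ('w \<Rightarrow> real) \<Rightarrow> bool"
where
  "has_ito_integral M F W \<phi> t J \<longleftrightarrow>
     adapted_process M F t \<phi> \<and>
     (\<integral>\<^sup>+\<omega>. (\<integral>\<^sup>+s. ennreal (indicator {0..t} s * (\<phi> s \<omega>)\<^sup>2) \<partial>lborel) \<partial>M) < \<infinity> \<and>
     J \<in> borel_measurable M \<and>
     (\<exists>m \<tau> e.
        (\<forall>k::nat. elementary_process F t (m k) (\<tau> k) (e k)) \<and>
        (\<lambda>k. \<integral>\<^sup>+\<omega>. (\<integral>\<^sup>+s. ennreal (indicator {0..t} s *
            (\<phi> s \<omega> - elementary_value (m k) (\<tau> k) (e k) s \<omega>)\<^sup>2) \<partial>lborel) \<partial>M)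
          \<longlonglongrightarrow> 0 \<and>
        (\<lambda>k. \<integral>\<^sup>+\<omega>. ennreal ((J \<omega> - elementary_integral W (m k) (\<tau> k) (e k) \<omega>)\<^sup>2) \<partial>M)
          \<longlonglongrightarrow> 0)"

text \<open>\<open>V\<close> is an Ito process on \<open>[0,t]\<close> with \<open>dV = a ds + b dW\<close>.\<close>

definition ito_process ::
  "'w measure \<Rightarrow> (real \<Rightarrow> 'w measure) \<Rightarrow> (real \<Rightarrow> 'w \<Rightarrow> real) \<Rightarrow> real \<Rightarrow>
   (real \<Rightarrow> 'w \<Rightarrow> real) \<Rightarrow> (real \<Rightarrow> 'w \<Rightarrow> real) \<Rightarrow> (real \<Rightarrow> 'w \<Rightarrow> real) \<Rightarrow> bool"
where
  "ito_process M F W t a b V \<longleftrightarrow>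
     adapted_process M F t a \<and>
     (AE \<omega> in M. set_integrable lborel {0..t} (\<lambda>s. a s \<omega>)) \<and>
     (\<exists>K. \<forall>s\<in>{0..t}. has_ito_integral M F W b s (K s) \<and>
        (AE \<omega> in M. V s \<omega> = V 0 \<omega> + (LBINT u:{0..s}. a u \<omega>) + K s \<omega>))"

text \<open>Ito integral of \<open>\<phi>\<close> over \<open>[0,t]\<close> against an Ito process \<open>V\<close> with \<open>dV = a ds + b dW\<close>:
  the integral of \<open>\<phi> a ds + \<phi> b dW\<close>.\<close>

definition has_stochastic_integral ::
  "'w measure \<Rightarrow> (real \<Rightarrow> 'w measure) \<Rightarrow> (real \<Rightarrow> 'w \<Rightarrow> real) \<Rightarrow> (real \<Rightarrow> 'w \<Rightarrow> real) \<Rightarrow>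
   (real \<Rightarrow> 'w \<Rightarrow> real) \<Rightarrow> real \<Rightarrow> ('w \<Rightarrow> real) \<Rightarrow> bool"
where
  "has_stochastic_integral M F W V \<phi> t J \<longleftrightarrow>
     J \<in> borel_measurable M \<and> adapted_process M F t \<phi> \<and>
     (\<exists>a b K. ito_process M F W t a b V \<and>
        (AE \<omega> in M. set_integrable lborel {0..t} (\<lambda>s. \<phi> s \<omega> * a s \<omega>)) \<and>
        has_ito_integral M F W (\<lambda>s \<omega>. \<phi> s \<omega> * b s \<omega>) t K \<and>
        (AE \<omega> in M. J \<omega> = (LBINT s:{0..t}. \<phi> s \<omega> * a s \<omega>) + K \<omega>))"


section \<open>Weak solutions of the nonlinear filter\<close>

text \<open>\<open>\<rho> t \<omega> x\<close> is the density at time \<open>t\<close>; the integrator below is the innovation process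
  \<open>dZ - h_hat ds\<close>. The integral process \<open>J\<close> is taken in its continuous version, so that the
  identity holds almost surely for all \<open>t\<close> simultaneously.\<close>

definition h_hat :: "('a::euclidean_space \<Rightarrow> real) \<Rightarrow> (real \<Rightarrow> 'w \<Rightarrow> 'a \<Rightarrow> real) \<Rightarrow> real \<Rightarrow> 'w \<Rightarrow> real" where
  "h_hat h \<rho> t \<omega> = pairing h (\<rho> t \<omega>)"

definition weak_filter_solution ::
  "'w measure \<Rightarrow> (real \<Rightarrow> 'w measure) \<Rightarrow> (real \<Rightarrow> 'w \<Rightarrow> real) \<Rightarrow> (real \<Rightarrow> 'w \<Rightarrow> real) \<Rightarrow>
   ('a::euclidean_space \<Rightarrow> real) \<Rightarrow> ('a \<Rightarrow> real) \<Rightarrow> real \<Rightarrow> (real \<Rightarrow> 'w \<Rightarrow> 'a \<Rightarrow> real) \<Rightarrow> bool"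
where
  "weak_filter_solution M F W Z h p0 T \<rho> \<longleftrightarrow>
     (\<forall>\<omega>\<in>space M. \<rho> 0 \<omega> = p0) \<and>
     (\<forall>f. test_function f \<longrightarrow>
       (\<exists>J.
         (\<forall>t\<in>{0..T}. has_stochastic_integral M F W
            (\<lambda>s \<omega>. Z s \<omega> - (LBINT u:{0..s}. h_hat h \<rho> u \<omega>))
            (\<lambda>s \<omega>. pairing (\<lambda>x. (h x - h_hat h \<rho> s \<omega>) * f x) (\<rho> s \<omega>)) t (J t)) \<and>
         (AE \<omega> in M. continuous_on {0..T} (\<lambda>t. J t \<omega>)) \<and>
         (AE \<omega> in M. \<forall>t\<in>{0..T}. pairing f (\<rho> t \<omega>) = pairing f (\<rho> 0 \<omega>) + J t \<omega>)))"


section \<open>The variational time-stepping procedure\<close>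

text \<open>The relative entropy takes the value \<open>\<infinity>\<close> unless \<open>p << q\<close> and \<open>p ln (p / q)\<close> is integrable
  (for probability densities its negative part always is).\<close>

definition rel_entropy :: "('a::euclidean_space \<Rightarrow> real) \<Rightarrow> ('a \<Rightarrow> real) \<Rightarrow> ereal" where
  "rel_entropy p q =
     (if (AE x in lborel. q x = 0 \<longrightarrow> p x = 0) \<and> integrable lborel (\<lambda>x. p x * ln (p x / q x))
      then ereal (\<integral>x. p x * ln (p x / q x) \<partial>lborel) else \<infinity>)"

definition step_functional ::
  "('a::euclidean_space \<Rightarrow> real) \<Rightarrow> real \<Rightarrow> real \<Rightarrow> ('a \<Rightarrow> real) \<Rightarrow> ('a \<Rightarrow> real) \<Rightarrow> ereal"
where
  "step_functional h \<Delta>t y q p =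
     rel_entropy p q + ereal (\<Delta>t / 2 * (\<integral>x. p x * (y - h x)\<^sup>2 \<partial>lborel))"

text \<open>A minimizer is only determined up to null sets; its continuous version is selected, which
  makes pointwise values meaningful.\<close>

definition time_stepping ::
  "('a::euclidean_space \<Rightarrow> real) \<Rightarrow> ('a \<Rightarrow> real) \<Rightarrow> (real \<Rightarrow> real) \<Rightarrow> nat \<Rightarrow> (nat \<Rightarrow> real) \<Rightarrow>
   (nat \<Rightarrow> 'a \<Rightarrow> real) \<Rightarrow> bool"
where
  "time_stepping h p0 z N \<tau> R \<longleftrightarrow> R 0 = p0 \<and>
     (\<forall>n\<in>{1..N}. continuous_on UNIV (R n) \<and>
        is_arg_min
          (step_functional h (\<tau> n - \<tau> (n - 1)) ((z (\<tau> n) - z (\<tau> (n - 1))) / (\<tau> n - \<tau> (n - 1)))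
             (R (n - 1)))
          (\<lambda>p. p \<in> densities2) (R n))"

definition time_grid :: "real \<Rightarrow> nat \<Rightarrow> (nat \<Rightarrow> real) \<Rightarrow> bool" where
  "time_grid T N \<tau> \<longleftrightarrow> \<tau> 0 = 0 \<and> \<tau> N = T \<and> (\<forall>n<N. \<tau> n < \<tau> (Suc n))"

definition grid_mesh :: "nat \<Rightarrow> (nat \<Rightarrow> real) \<Rightarrow> real" where
  "grid_mesh N \<tau> = Max ((\<lambda>n. \<tau> n - \<tau> (n - 1)) ` {1..N})"

definition step_interpolant ::
  "nat \<Rightarrow> (nat \<Rightarrow> real) \<Rightarrow> (nat \<Rightarrow> 'a \<Rightarrow> real) \<Rightarrow> real \<Rightarrow> 'a \<Rightarrow> real"
where
  "step_interpolant N \<tau> R t = R (Max {n. n \<le> N \<and> \<tau> n \<le> t})"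

definition time_stepping_limit ::
  "('a::euclidean_space \<Rightarrow> real) \<Rightarrow> ('a \<Rightarrow> real) \<Rightarrow> real \<Rightarrow> (real \<Rightarrow> real) \<Rightarrow>
   (real \<Rightarrow> 'a \<Rightarrow> real) \<Rightarrow> bool"
where
  "time_stepping_limit h p0 T z r \<longleftrightarrow>
     (\<forall>N \<tau>. time_grid T N \<tau> \<longrightarrow> (\<exists>R. time_stepping h p0 z N \<tau> R)) \<and>
     (\<forall>N \<tau> R.
        (\<forall>k::nat. time_grid T (N k) (\<tau> k) \<and> time_stepping h p0 z (N k) (\<tau> k) (R k)) \<and>
        filterlim N at_top sequentially \<and> (\<lambda>k. grid_mesh (N k) (\<tau> k)) \<longlonglongrightarrow> 0 \<longrightarrow>
        (\<forall>t\<in>{0..T}. \<forall>x. (\<lambda>k. step_interpolant (N k) (\<tau> k) (R k) t x) \<longlonglongrightarrow> r t x))"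

end

theory Submission
  imports Defs
begin

text \<open>The density \<open>exp (h z - h\<^sup>2 s / 2) p0\<close>, normalized, depends on the observation path only through the
  elapsed time \<open>s\<close> and the increment \<open>z = Z\<^sub>s - Z\<^sub>0\<close>, and it is an exponential family in these two
  parameters. Both halves of the theorem are read off from this.

  Time stepping. Adding the quadratic cost to the relative entropy with respect to \<open>q\<close> gives the
  relative entropy with respect to the Bayes update of \<open>q\<close>, minus a constant
  (\<open>step_functional_decomposition\<close>), so by Gibbs' inequality the Bayes update is the only continuous
  minimizer. Multiplying by \<open>exp (- \<Delta>t / 2 (y - h)\<^sup>2)\<close> moves the parameters from \<open>(s, z)\<close> to
  \<open>(s + \<Delta>t, z + \<Delta>t y)\<close>, the factor in \<open>y\<^sup>2\<close> being absorbed by the normalization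
  (\<open>bayes_update_posterior_density\<close>). As \<open>\<Delta>t y\<close> is the increment of \<open>Z\<close>, the discrete scheme is exact at the
  grid points, and its convergence is continuity in the parameters.

  Filter equation. Let \<open>m f\<close> be the expectation of \<open>f\<close> under the density with parameters \<open>(s, z)\<close>. Then
  \<open>\<partial>\<^sub>z (m f) = cov (f, h)\<close> and \<open>\<partial>\<^sub>s (m f) = - cov (f, h\<^sup>2) / 2\<close>, while \<open>\<partial>\<^sub>z\<^sub>z (m f)\<close> is the third joint cumulant
  of \<open>f, h, h\<close>; these combine to \<open>\<partial>\<^sub>s (m f) + \<partial>\<^sub>z\<^sub>z (m f) / 2 = - m h cov (f, h)\<close>
  (\<open>posterior_backward_equation\<close>). In the model \<open>Z\<^sub>t - Z\<^sub>0 = \<eta> t + W\<^sub>t\<close> with \<open>\<eta> = h (X\<^sub>0)\<close>, so Ito's formula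
  gives \<open>d (m f) = cov (f, h) ((\<eta> - m h) dt + dW)\<close>, and the bracket is the innovation
  \<open>dZ - m h dt\<close>.

  Ito's formula (\<open>ito_formula\<close>) is only needed for functions with bounded Lipschitz derivatives, and every
  derivative here is a polynomial in expectations of bounded functions. For such functions the
  left-endpoint sums over uniform grids differ from the claimed integral by three terms that vanish
  in mean square: the fluctuations \<open>g\<^sub>y\<^sub>y / 2 ((\<Delta>W)\<^sup>2 - \<Delta>t)\<close>, pairwise orthogonal because a Wiener increment is
  independent of the past; the Taylor remainders, of order \<open>(\<Delta>t)\<^bsup>3/2\<^esup>\<close> each; and the error of a Riemann sum
  for the drift.\<close>

section \<open>Exponential integrals with respect to a finite measure\<close>

lemma abs_exp_remainder_le: "\<bar>exp u - 1 - u\<bar> \<le> exp \<bar>u\<bar> * u\<^sup>2" for u :: real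
proof -
  obtain t where t: "\<bar>t\<bar> \<le> \<bar>u\<bar>" "exp u = (\<Sum>m<2. u ^ m / fact m) + exp t / fact 2 * u\<^sup>2"
    using Maclaurin_exp_le[of u 2] by auto
  have "exp u - 1 - u = exp t / 2 * u\<^sup>2"
    using t(2) by (simp add: numeral_2_eq_2)
  moreover have "exp t \<le> exp \<bar>u\<bar>"
    using t(1) by simp
  then have "exp t / 2 \<le> exp \<bar>u\<bar>"
    using exp_gt_zero[of t] by linarith
  then have "exp t / 2 * u\<^sup>2 \<le> exp \<bar>u\<bar> * u\<^sup>2"
    by (rule mult_right_mono) simp
  moreover have "0 \<le> exp t / 2 * u\<^sup>2"
    by simp
  ultimately show ?thesis
    by linarith
qed

lemma (in finite_measure) integrable_bounded_real:
  fixes q :: "'a \<Rightarrow> real"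
  assumes "q \<in> borel_measurable M" "\<And>x. x \<in> space M \<Longrightarrow> \<bar>q x\<bar> \<le> C"
  shows "integrable M q"
  using assms by (intro integrable_const_bound[where B = C]) auto

lemma abs_integral_le_integral:
  fixes f g :: "'a \<Rightarrow> real"
  assumes "integrable M f" "integrable M g" "\<And>x. x \<in> space M \<Longrightarrow> \<bar>f x\<bar> \<le> g x"
  shows "\<bar>\<integral>x. f x \<partial>M\<bar> \<le> (\<integral>x. g x \<partial>M)"
proof -
  have "\<bar>\<integral>x. f x \<partial>M\<bar> \<le> (\<integral>x. \<bar>f x\<bar> \<partial>M)"
    by (rule integral_abs_bound)
  also have "\<dots> \<le> (\<integral>x. g x \<partial>M)"
    using assms by (intro integral_mono integrable_abs) auto
  finally show ?thesis .
qed

text \<open>For bounded \<open>a\<close> the quadratic bound on the remainder of \<open>exp\<close> is uniform in the integration variable, so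
  differentiation passes through the integral with an explicit error and no limit theorem. Both the
  derivative in time and the derivative in the observation of a posterior expectation are instances.\<close>

lemma (in finite_measure) has_derivative_exponential_integral:
  fixes w a :: "'a \<Rightarrow> real"
  assumes [measurable]: "w \<in> borel_measurable M" "a \<in> borel_measurable M"
    and w: "\<And>x. x \<in> space M \<Longrightarrow> \<bar>w x\<bar> \<le> C" and a: "\<And>x. x \<in> space M \<Longrightarrow> \<bar>a x\<bar> \<le> B"
  shows "((\<lambda>r. \<integral>x. w x * exp (r * a x) \<partial>M) has_real_derivative
           (\<integral>x. w x * a x * exp (r * a x) \<partial>M)) (at r)"
proof -
  \<comment> \<open>the bound \<open>B\<close> may be negative if the space is empty\<close>
  define A where "A = max 0 B"
  define K where "K = \<bar>C\<bar> * exp (\<bar>r\<bar> * A) * (exp A * A\<^sup>2)"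
  have aA: "\<bar>a x\<bar> \<le> A" if "x \<in> space M" for x
    using a[OF that] by (simp add: A_def)
  have A0: "0 \<le> A" by (simp add: A_def)
  have expb: "exp (t * a x) \<le> exp (\<bar>t\<bar> * A)" if "x \<in> space M" for t x
  proof -
    have "t * a x \<le> \<bar>t\<bar> * \<bar>a x\<bar>" by (metis abs_ge_self abs_mult)
    also have "\<dots> \<le> \<bar>t\<bar> * A" using aA[OF that] by (intro mult_left_mono) auto
    finally show ?thesis by simp
  qed
  have int: "integrable M (\<lambda>x. w x * exp (t * a x))" for t
  proof (rule integrable_bounded_real[where C = "\<bar>C\<bar> * exp (\<bar>t\<bar> * A)"])
    fix x assume x: "x \<in> space M"
    show "\<bar>w x * exp (t * a x)\<bar> \<le> \<bar>C\<bar> * exp (\<bar>t\<bar> * A)"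
      unfolding abs_mult using w[OF x] expb[OF x] by (intro mult_mono) auto
  qed simp
  have int': "integrable M (\<lambda>x. w x * a x * exp (t * a x))" for t
  proof (rule integrable_bounded_real[where C = "\<bar>C\<bar> * A * exp (\<bar>t\<bar> * A)"])
    fix x assume x: "x \<in> space M"
    show "\<bar>w x * a x * exp (t * a x)\<bar> \<le> \<bar>C\<bar> * A * exp (\<bar>t\<bar> * A)"
      unfolding abs_mult using w[OF x] expb[OF x] aA[OF x] A0 by (intro mult_mono) auto
  qed simp
  let ?I = "\<lambda>r. \<integral>x. w x * exp (r * a x) \<partial>M" and ?D = "\<integral>x. w x * a x * exp (r * a x) \<partial>M"
  have quot: "\<bar>(?I (r + d) - ?I r) / d - ?D\<bar> \<le> K * measure M (space M) * \<bar>d\<bar>"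
    if d: "d \<noteq> 0" "\<bar>d\<bar> < 1" for d
  proof -
    let ?f = "\<lambda>x. w x * exp ((r + d) * a x) - w x * exp (r * a x) - d * (w x * a x * exp (r * a x))"
    have f: "?f = (\<lambda>x. w x * exp (r * a x) * (exp (d * a x) - 1 - d * a x))"
      by (auto simp: algebra_simps exp_add fun_eq_iff)
    have int_f: "integrable M ?f"
      by (intro Bochner_Integration.integrable_diff int integrable_mult_right int')
    have "integral\<^sup>L M ?f = ?I (r + d) - ?I r - d * ?D"
      using int int' by simp
    then have eq: "?I (r + d) - ?I r - d * ?D
        = (\<integral>x. w x * exp (r * a x) * (exp (d * a x) - 1 - d * a x) \<partial>M)"
      unfolding f by simp
    have "\<bar>?I (r + d) - ?I r - d * ?D\<bar> \<le> (\<integral>x. K * d\<^sup>2 \<partial>M)"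
      unfolding eq
    proof (rule abs_integral_le_integral)
      fix x assume x: "x \<in> space M"
      have da: "\<bar>d * a x\<bar> \<le> A"
        unfolding abs_mult using d aA[OF x] A0 mult_mono[of "\<bar>d\<bar>" 1 "\<bar>a x\<bar>" A] by auto
      have "\<bar>exp (d * a x) - 1 - d * a x\<bar> \<le> exp \<bar>d * a x\<bar> * (d * a x)\<^sup>2"
        by (rule abs_exp_remainder_le)
      also have "\<dots> = exp \<bar>d * a x\<bar> * (d\<^sup>2 * \<bar>a x\<bar>\<^sup>2)"
        by (simp add: power_mult_distrib)
      also have "\<dots> \<le> exp A * (d\<^sup>2 * A\<^sup>2)"
        using da power_mono[OF aA[OF x], of 2] by (intro mult_mono mult_left_mono) auto
      finally have rem: "\<bar>exp (d * a x) - 1 - d * a x\<bar> \<le> exp A * A\<^sup>2 * d\<^sup>2"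
        by (simp add: ac_simps)
      have "\<bar>w x * exp (r * a x) * (exp (d * a x) - 1 - d * a x)\<bar>
          \<le> \<bar>C\<bar> * exp (\<bar>r\<bar> * A) * (exp A * A\<^sup>2 * d\<^sup>2)"
        unfolding abs_mult using w[OF x] expb[OF x, of r] rem
        by (intro mult_mono) auto
      then show "\<bar>w x * exp (r * a x) * (exp (d * a x) - 1 - d * a x)\<bar> \<le> K * d\<^sup>2"
        by (simp add: K_def ac_simps)
    next
      show "integrable M (\<lambda>x. w x * exp (r * a x) * (exp (d * a x) - 1 - d * a x))"
        using int_f unfolding f .
    qed simp
    then have "\<bar>?I (r + d) - ?I r - d * ?D\<bar> / \<bar>d\<bar> \<le> K * d\<^sup>2 * measure M (space M) / \<bar>d\<bar>"
      by (intro divide_right_mono) (auto simp: ac_simps)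
    also have "K * d\<^sup>2 * measure M (space M) / \<bar>d\<bar> = K * measure M (space M) * \<bar>d\<bar>"
      using d by (simp add: field_simps power2_eq_square)
    also have "\<bar>?I (r + d) - ?I r - d * ?D\<bar> / \<bar>d\<bar> = \<bar>(?I (r + d) - ?I r) / d - ?D\<bar>"
      using d by (simp flip: abs_divide) (simp add: diff_divide_distrib)
    finally show ?thesis .
  qed
  have "((\<lambda>d. (?I (r + d) - ?I r) / d - ?D) \<longlongrightarrow> 0) (at 0)"
  proof (rule Lim_null_comparison)
    show "\<forall>\<^sub>F d in at 0. norm ((?I (r + d) - ?I r) / d - ?D) \<le> K * measure M (space M) * \<bar>d\<bar>"
      unfolding eventually_at using quot by (intro exI[of _ 1]) auto
    show "((\<lambda>d. K * measure M (space M) * \<bar>d\<bar>) \<longlongrightarrow> 0) (at 0)"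
      by (auto intro!: tendsto_eq_intros)
  qed
  then show ?thesis
    unfolding DERIV_def by (simp add: LIM_zero_iff)
qed

section \<open>Bounded Lipschitz functions of time and state\<close>

text \<open>The regularity required in Ito's formula. It is preserved by sums and products, which makes it
  immediate for polynomial expressions in posterior expectations.\<close>

definition bounded_lipschitz :: "(real \<Rightarrow> real \<Rightarrow> real) \<Rightarrow> bool" where
  "bounded_lipschitz u \<longleftrightarrow> (\<exists>C\<ge>0. (\<forall>s z. \<bar>u s z\<bar> \<le> C) \<and>
     (\<forall>s z s' z'. \<bar>u s z - u s' z'\<bar> \<le> C * (\<bar>s - s'\<bar> + \<bar>z - z'\<bar>)))"

lemma bounded_lipschitzI:
  assumes "\<And>s z. \<bar>u s z\<bar> \<le> C" "\<And>s z s' z'. \<bar>u s z - u s' z'\<bar> \<le> C' * (\<bar>s - s'\<bar> + \<bar>z - z'\<bar>)"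
  shows "bounded_lipschitz u"
  unfolding bounded_lipschitz_def
proof (intro exI[of _ "max (max C C') 0"] conjI allI)
  fix s z s' z'
  show "\<bar>u s z - u s' z'\<bar> \<le> max (max C C') 0 * (\<bar>s - s'\<bar> + \<bar>z - z'\<bar>)"
    by (rule order_trans[OF assms(2) mult_right_mono]) auto
qed (auto intro: order_trans[OF assms(1)])

lemma bounded_lipschitzE:
  assumes "bounded_lipschitz u"
  obtains C where "C \<ge> 0" "\<And>s z. \<bar>u s z\<bar> \<le> C"
    "\<And>s z s' z'. \<bar>u s z - u s' z'\<bar> \<le> C * (\<bar>s - s'\<bar> + \<bar>z - z'\<bar>)"
  using assms unfolding bounded_lipschitz_def by blast

lemma bounded_lipschitz_const: "bounded_lipschitz (\<lambda>s z. c)"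
  by (rule bounded_lipschitzI[where C = "\<bar>c\<bar>" and C' = 0]) auto

lemma bounded_lipschitz_add:
  assumes "bounded_lipschitz u" "bounded_lipschitz v"
  shows "bounded_lipschitz (\<lambda>s z. u s z + v s z)"
proof -
  obtain C where C: "C \<ge> 0" "\<And>s z. \<bar>u s z\<bar> \<le> C"
    "\<And>s z s' z'. \<bar>u s z - u s' z'\<bar> \<le> C * (\<bar>s - s'\<bar> + \<bar>z - z'\<bar>)"
    using bounded_lipschitzE[OF assms(1)] by metis
  obtain D where D: "D \<ge> 0" "\<And>s z. \<bar>v s z\<bar> \<le> D"
    "\<And>s z s' z'. \<bar>v s z - v s' z'\<bar> \<le> D * (\<bar>s - s'\<bar> + \<bar>z - z'\<bar>)"
    using bounded_lipschitzE[OF assms(2)] by metis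
  show ?thesis
  proof (rule bounded_lipschitzI[where C = "C + D" and C' = "C + D"])
    show "\<bar>u s z + v s z\<bar> \<le> C + D" for s z
      using C(2)[of s z] D(2)[of s z] by linarith
    show "\<bar>u s z + v s z - (u s' z' + v s' z')\<bar> \<le> (C + D) * (\<bar>s - s'\<bar> + \<bar>z - z'\<bar>)" for s z s' z'
      unfolding distrib_right[of C D] using C(3)[of s z s' z'] D(3)[of s z s' z'] by linarith
  qed
qed

lemma bounded_lipschitz_mult:
  assumes "bounded_lipschitz u" "bounded_lipschitz v"
  shows "bounded_lipschitz (\<lambda>s z. u s z * v s z)"
proof -
  obtain C where C: "C \<ge> 0" "\<And>s z. \<bar>u s z\<bar> \<le> C"
    "\<And>s z s' z'. \<bar>u s z - u s' z'\<bar> \<le> C * (\<bar>s - s'\<bar> + \<bar>z - z'\<bar>)"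
    using bounded_lipschitzE[OF assms(1)] by metis
  obtain D where D: "D \<ge> 0" "\<And>s z. \<bar>v s z\<bar> \<le> D"
    "\<And>s z s' z'. \<bar>v s z - v s' z'\<bar> \<le> D * (\<bar>s - s'\<bar> + \<bar>z - z'\<bar>)"
    using bounded_lipschitzE[OF assms(2)] by metis
  show ?thesis
  proof (rule bounded_lipschitzI[where C = "C * D" and C' = "2 * C * D"])
    show "\<bar>u s z * v s z\<bar> \<le> C * D" for s z
      unfolding abs_mult using C D by (intro mult_mono) auto
    fix s z s' z' :: real
    let ?d = "\<bar>s - s'\<bar> + \<bar>z - z'\<bar>"
    have "u s z * v s z - u s' z' * v s' z' = (u s z - u s' z') * v s z + u s' z' * (v s z - v s' z')"
      by (simp add: algebra_simps)
    also have "\<bar>\<dots>\<bar> \<le> \<bar>u s z - u s' z'\<bar> * \<bar>v s z\<bar> + \<bar>u s' z'\<bar> * \<bar>v s z - v s' z'\<bar>"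
      unfolding abs_mult[symmetric] by (rule abs_triangle_ineq)
    also have "\<dots> \<le> (C * ?d) * D + C * (D * ?d)"
      using C D by (intro add_mono mult_mono) auto
    finally show "\<bar>u s z * v s z - u s' z' * v s' z'\<bar> \<le> 2 * C * D * ?d"
      by (simp add: algebra_simps)
  qed
qed

lemma bounded_lipschitz_diff:
  assumes "bounded_lipschitz u" "bounded_lipschitz v"
  shows "bounded_lipschitz (\<lambda>s z. u s z - v s z)"
  using bounded_lipschitz_add[OF assms(1) bounded_lipschitz_mult[OF bounded_lipschitz_const[of "-1"] assms(2)]]
  by simp

lemmas bounded_lipschitz_intros =
  bounded_lipschitz_const bounded_lipschitz_add bounded_lipschitz_mult bounded_lipschitz_diff

lemma bounded_lipschitz_continuous:
  assumes "bounded_lipschitz u"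
  shows "continuous_on UNIV (\<lambda>p. u (fst p) (snd p))"
proof -
  obtain C where C: "C \<ge> 0"
    "\<And>s z s' z'. \<bar>u s z - u s' z'\<bar> \<le> C * (\<bar>s - s'\<bar> + \<bar>z - z'\<bar>)"
    using bounded_lipschitzE[OF assms] by metis
  have "((\<lambda>p. u (fst p) (snd p)) \<longlongrightarrow> u (fst p) (snd p)) (at p)" for p
  proof (rule LIM_zero_cancel, rule Lim_null_comparison)
    show "\<forall>\<^sub>F q in at p. norm (u (fst q) (snd q) - u (fst p) (snd p))
        \<le> C * (\<bar>fst q - fst p\<bar> + \<bar>snd q - snd p\<bar>)"
      using C(2) by auto
    show "((\<lambda>q. C * (\<bar>fst q - fst p\<bar> + \<bar>snd q - snd p\<bar>)) \<longlongrightarrow> 0) (at p)"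
      by (auto intro!: tendsto_eq_intros)
  qed
  then show ?thesis
    by (simp add: continuous_on_def)
qed

lemma bounded_lipschitz_section_measurable:
  assumes "bounded_lipschitz u"
  shows "u s \<in> borel_measurable borel"
proof -
  have "continuous_on UNIV (\<lambda>y::real. (s, y))"
    by (intro continuous_intros)
  from continuous_on_compose2[OF bounded_lipschitz_continuous[OF assms] this]
  show ?thesis
    by (intro borel_measurable_continuous_onI) simp
qed

section \<open>Posterior expectations\<close>

text \<open>The parameters \<open>s\<close> and \<open>z\<close> below stand for the elapsed time and for the increment of the observation up to
  that time; \<open>likelihood s z x\<close> is the Girsanov density of the observation given the signal \<open>x\<close>.\<close>

locale bounded_observation = prob_space \<mu> for \<mu> :: "'a measure" +
  fixes h :: "'a \<Rightarrow> real" and B :: real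
  assumes h_measurable[measurable]: "h \<in> borel_measurable \<mu>"
    and h_bound: "\<And>x. x \<in> space \<mu> \<Longrightarrow> \<bar>h x\<bar> \<le> B"
begin

definition likelihood :: "real \<Rightarrow> real \<Rightarrow> 'a \<Rightarrow> real" where
  "likelihood s z x = exp (h x * z - (h x)\<^sup>2 / 2 * s)"

definition unnormalized :: "('a \<Rightarrow> real) \<Rightarrow> real \<Rightarrow> real \<Rightarrow> real" where
  "unnormalized q s z = (\<integral>x. q x * likelihood s z x \<partial>\<mu>)"

definition posterior :: "('a \<Rightarrow> real) \<Rightarrow> real \<Rightarrow> real \<Rightarrow> real" where
  "posterior q s z = unnormalized q s z / unnormalized (\<lambda>_. 1) s z"

definition observable :: "('a \<Rightarrow> real) \<Rightarrow> bool" where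
  "observable q \<longleftrightarrow> q \<in> borel_measurable \<mu> \<and> (\<exists>C. \<forall>x\<in>space \<mu>. \<bar>q x\<bar> \<le> C)"

lemma observable_measurable[measurable_dest]: "observable q \<Longrightarrow> q \<in> borel_measurable \<mu>"
  by (simp add: observable_def)

lemma likelihood_measurable[measurable]: "likelihood s z \<in> borel_measurable \<mu>"
  unfolding likelihood_def[abs_def] by measurable

lemma likelihood_pos: "0 < likelihood s z x"
  by (simp add: likelihood_def)

lemma likelihood_bound:
  assumes "x \<in> space \<mu>"
  shows "likelihood s z x \<le> exp (B * \<bar>z\<bar> + B\<^sup>2 / 2 * \<bar>s\<bar>)"
proof -
  have h: "\<bar>h x\<bar> \<le> B" and B: "0 \<le> B" using h_bound[OF assms] by auto
  have "h x * z \<le> \<bar>h x\<bar> * \<bar>z\<bar>" by (metis abs_ge_self abs_mult)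
  also have "\<dots> \<le> B * \<bar>z\<bar>" using h by (intro mult_right_mono) auto
  finally have 1: "h x * z \<le> B * \<bar>z\<bar>" .
  have "- ((h x)\<^sup>2 / 2 * s) \<le> (h x)\<^sup>2 / 2 * \<bar>s\<bar>"
    using abs_ge_minus_self[of "(h x)\<^sup>2 / 2 * s"] by (simp add: abs_mult)
  also have "\<dots> \<le> B\<^sup>2 / 2 * \<bar>s\<bar>"
    using power_mono[OF h, of 2] by (intro mult_right_mono divide_right_mono) auto
  finally show ?thesis using 1 by (simp add: likelihood_def)
qed

lemma observable_const: "observable (\<lambda>_. c)"
  by (auto simp: observable_def)

lemma observable_h: "observable h"
  using h_bound by (auto simp: observable_def)

lemma observable_mult:
  assumes "observable q" "observable r"
  shows "observable (\<lambda>x. q x * r x)"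
proof -
  obtain C D where "\<And>x. x \<in> space \<mu> \<Longrightarrow> \<bar>q x\<bar> \<le> C" "\<And>x. x \<in> space \<mu> \<Longrightarrow> \<bar>r x\<bar> \<le> D"
    using assms unfolding observable_def by blast
  then have "\<bar>q x * r x\<bar> \<le> \<bar>C\<bar> * \<bar>D\<bar>" if "x \<in> space \<mu>" for x
    unfolding abs_mult using that by (intro mult_mono) (auto intro: order_trans[OF _ abs_ge_self])
  then show ?thesis
    using assms unfolding observable_def by auto
qed

lemma integrable_observable_likelihood:
  assumes "observable q"
  shows "integrable \<mu> (\<lambda>x. q x * likelihood s z x)"
proof -
  obtain C where C: "\<And>x. x \<in> space \<mu> \<Longrightarrow> \<bar>q x\<bar> \<le> C"
    using assms unfolding observable_def by blast
  show ?thesis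
  proof (rule integrable_bounded_real[where C = "\<bar>C\<bar> * exp (B * \<bar>z\<bar> + B\<^sup>2 / 2 * \<bar>s\<bar>)"])
    fix x assume x: "x \<in> space \<mu>"
    show "\<bar>q x * likelihood s z x\<bar> \<le> \<bar>C\<bar> * exp (B * \<bar>z\<bar> + B\<^sup>2 / 2 * \<bar>s\<bar>)"
      unfolding abs_mult using C[OF x] likelihood_bound[OF x] likelihood_pos[of s z x]
      by (intro mult_mono) auto
  qed (use assms in measurable)
qed

text \<open>The integrand is strictly positive and \<open>\<mu>\<close> is not the null measure.\<close>

lemma normalizer_pos: "0 < unnormalized (\<lambda>_. 1) s z"
proof -
  have int: "integrable \<mu> (\<lambda>x. 1 * likelihood s z x)"
    by (rule integrable_observable_likelihood[OF observable_const])
  have "unnormalized (\<lambda>_. 1) s z \<noteq> 0"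
  proof
    assume "unnormalized (\<lambda>_. 1) s z = 0"
    moreover have "AE x in \<mu>. 0 \<le> 1 * likelihood s z x"
      by (simp add: likelihood_def)
    ultimately have "AE x in \<mu>. 1 * likelihood s z x = 0"
      using integral_nonneg_eq_0_iff_AE[OF int] unfolding unnormalized_def by blast
    then have "AE x in \<mu>. False"
    proof eventually_elim
      case (elim x)
      then show False using likelihood_pos[of s z x] by simp
    qed
    then show False by simp
  qed
  moreover have "0 \<le> unnormalized (\<lambda>_. 1) s z"
    unfolding unnormalized_def by (intro Bochner_Integration.integral_nonneg) (simp add: likelihood_def)
  ultimately show ?thesis by simp
qed

lemma posterior_bound:
  assumes q: "observable q" and C: "\<And>x. x \<in> space \<mu> \<Longrightarrow> \<bar>q x\<bar> \<le> C"
  shows "\<bar>posterior q s z\<bar> \<le> C"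
proof -
  have "\<bar>unnormalized q s z\<bar> \<le> (\<integral>x. C * (1 * likelihood s z x) \<partial>\<mu>)"
    unfolding unnormalized_def
  proof (rule abs_integral_le_integral)
    show "integrable \<mu> (\<lambda>x. q x * likelihood s z x)"
      by (rule integrable_observable_likelihood[OF q])
    show "integrable \<mu> (\<lambda>x. C * (1 * likelihood s z x))"
      by (intro integrable_mult_right integrable_observable_likelihood[OF observable_const])
    show "\<bar>q x * likelihood s z x\<bar> \<le> C * (1 * likelihood s z x)" if "x \<in> space \<mu>" for x
      using C[OF that] likelihood_pos[of s z x] by (simp add: abs_mult)
  qed
  also have "\<dots> = C * unnormalized (\<lambda>_. 1) s z"
    by (simp add: unnormalized_def)
  finally show ?thesis
    using normalizer_pos[of s z] by (simp add: posterior_def field_simps)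
qed

lemma unnormalized_deriv_z:
  assumes q: "observable q"
  shows "((\<lambda>z. unnormalized q s z) has_real_derivative unnormalized (\<lambda>x. q x * h x) s z) (at z)"
proof -
  obtain C where C: "\<And>x. x \<in> space \<mu> \<Longrightarrow> \<bar>q x * likelihood s 0 x\<bar> \<le> C"
  proof -
    obtain C where C: "\<And>x. x \<in> space \<mu> \<Longrightarrow> \<bar>q x\<bar> \<le> C"
      using assms unfolding observable_def by blast
    show ?thesis
    proof (rule that)
      fix x assume x: "x \<in> space \<mu>"
      show "\<bar>q x * likelihood s 0 x\<bar> \<le> \<bar>C\<bar> * exp (B * \<bar>0\<bar> + B\<^sup>2 / 2 * \<bar>s\<bar>)"
        unfolding abs_mult using C[OF x] likelihood_bound[OF x, of s 0] likelihood_pos[of s 0 x]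
        by (intro mult_mono) auto
    qed
  qed
  have "((\<lambda>z. \<integral>x. q x * likelihood s 0 x * exp (z * h x) \<partial>\<mu>) has_real_derivative
      (\<integral>x. q x * likelihood s 0 x * h x * exp (z * h x) \<partial>\<mu>)) (at z)"
    by (rule has_derivative_exponential_integral[OF _ _ C h_bound]) (use q in measurable)
  moreover have split: "likelihood s z x = likelihood s 0 x * exp (z * h x)" for z x
    by (simp add: likelihood_def mult_exp_exp algebra_simps)
  have "unnormalized r s z = (\<integral>x. r x * likelihood s 0 x * exp (z * h x) \<partial>\<mu>)" for r z
    unfolding unnormalized_def split[of z] by (simp only: mult.assoc)
  moreover have "q x * h x * likelihood s 0 x * exp (z * h x) = q x * likelihood s 0 x * h x * exp (z * h x)" for x
    by simp
  ultimately show ?thesis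
    by (simp only:)
qed

lemma unnormalized_deriv_s:
  assumes q: "observable q"
  shows "((\<lambda>s. unnormalized q s z) has_real_derivative
           - unnormalized (\<lambda>x. q x * (h x * h x)) s z / 2) (at s)"
proof -
  obtain C where C: "\<And>x. x \<in> space \<mu> \<Longrightarrow> \<bar>q x * likelihood 0 z x\<bar> \<le> C"
  proof -
    obtain C where C: "\<And>x. x \<in> space \<mu> \<Longrightarrow> \<bar>q x\<bar> \<le> C"
      using assms unfolding observable_def by blast
    show ?thesis
    proof (rule that)
      fix x assume x: "x \<in> space \<mu>"
      show "\<bar>q x * likelihood 0 z x\<bar> \<le> \<bar>C\<bar> * exp (B * \<bar>z\<bar> + B\<^sup>2 / 2 * \<bar>0\<bar>)"
        unfolding abs_mult using C[OF x] likelihood_bound[OF x, of 0 z] likelihood_pos[of 0 z x]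
        by (intro mult_mono) auto
    qed
  qed
  have B2: "\<bar>- (h x * h x) / 2\<bar> \<le> B * B" if "x \<in> space \<mu>" for x
  proof -
    have "\<bar>h x\<bar> * \<bar>h x\<bar> \<le> B * B"
      using h_bound[OF that] by (intro mult_mono) auto
    then have "h x * h x \<le> B * B"
      by (simp flip: abs_mult)
    moreover have "0 \<le> h x * h x" by simp
    moreover have "\<bar>- (h x * h x) / 2\<bar> = h x * h x / 2" by simp
    ultimately show ?thesis by linarith
  qed
  have deriv: "((\<lambda>s. \<integral>x. q x * likelihood 0 z x * exp (s * (- (h x * h x) / 2)) \<partial>\<mu>) has_real_derivative
      (\<integral>x. q x * likelihood 0 z x * (- (h x * h x) / 2) * exp (s * (- (h x * h x) / 2)) \<partial>\<mu>)) (at s)"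
    by (rule has_derivative_exponential_integral[OF _ _ C B2]) (use q in measurable)
  have split: "likelihood s z x = likelihood 0 z x * exp (s * (- (h x * h x) / 2))" for s x
    by (simp add: likelihood_def mult_exp_exp power2_eq_square)
  have *: "unnormalized r s z = (\<integral>x. r x * likelihood 0 z x * exp (s * (- (h x * h x) / 2)) \<partial>\<mu>)" for r s
    unfolding unnormalized_def split[of s] by (simp only: mult.assoc)
  have "- unnormalized (\<lambda>x. q x * (h x * h x)) s z / 2
      = (\<integral>x. q x * (h x * h x) * likelihood s z x * (- 1 / 2) \<partial>\<mu>)"
    by (simp add: unnormalized_def)
  also have "\<dots> = (\<integral>x. q x * likelihood 0 z x * (- (h x * h x) / 2) * exp (s * (- (h x * h x) / 2)) \<partial>\<mu>)"
    unfolding split[of s] by (intro Bochner_Integration.integral_cong) auto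
  finally show ?thesis
    using deriv unfolding * by (simp only:)
qed

lemma likelihood_tendsto:
  assumes "(s \<longlongrightarrow> s') F" "(z \<longlongrightarrow> z') F"
  shows "((\<lambda>k. likelihood (s k) (z k) x) \<longlongrightarrow> likelihood s' z' x) F"
  unfolding likelihood_def by (intro tendsto_intros assms)

lemma unnormalized_tendsto:
  assumes q: "observable q" and s: "s \<longlonglongrightarrow> s'" and z: "z \<longlonglongrightarrow> z'"
  shows "(\<lambda>k. unnormalized q (s k) (z k)) \<longlonglongrightarrow> unnormalized q s' z'"
proof -
  obtain S where S: "\<And>k. \<bar>s k\<bar> \<le> S"
    using convergent_imp_Bseq[OF convergentI[OF s]] by (metis BseqE real_norm_def)
  obtain Z where Z: "\<And>k. \<bar>z k\<bar> \<le> Z"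
    using convergent_imp_Bseq[OF convergentI[OF z]] by (metis BseqE real_norm_def)
  obtain C where C: "\<And>x. x \<in> space \<mu> \<Longrightarrow> \<bar>q x\<bar> \<le> C"
    using q unfolding observable_def by blast
  show ?thesis
    unfolding unnormalized_def
  proof (rule integral_dominated_convergence[where w = "\<lambda>_. \<bar>C\<bar> * exp (B * Z + B\<^sup>2 / 2 * S)"])
    show "AE x in \<mu>. (\<lambda>k. q x * likelihood (s k) (z k) x) \<longlonglongrightarrow> q x * likelihood s' z' x"
      by (intro AE_I2 tendsto_intros likelihood_tendsto s z)
    show "AE x in \<mu>. norm (q x * likelihood (s k) (z k) x) \<le> \<bar>C\<bar> * exp (B * Z + B\<^sup>2 / 2 * S)" for k
    proof (rule AE_I2)
      fix x assume x: "x \<in> space \<mu>"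
      have "likelihood (s k) (z k) x \<le> exp (B * \<bar>z k\<bar> + B\<^sup>2 / 2 * \<bar>s k\<bar>)"
        by (rule likelihood_bound[OF x])
      also have "\<dots> \<le> exp (B * Z + B\<^sup>2 / 2 * S)"
        using S[of k] Z[of k] h_bound[OF x] by (auto intro!: add_mono mult_left_mono)
      finally show "norm (q x * likelihood (s k) (z k) x) \<le> \<bar>C\<bar> * exp (B * Z + B\<^sup>2 / 2 * S)"
        unfolding real_norm_def abs_mult
        using C[OF x] likelihood_pos[of "s k" "z k" x] by (intro mult_mono) auto
    qed
  qed (use q in measurable)
qed

definition covariance :: "('a \<Rightarrow> real) \<Rightarrow> ('a \<Rightarrow> real) \<Rightarrow> real \<Rightarrow> real \<Rightarrow> real" where
  "covariance q r s z = posterior (\<lambda>x. q x * r x) s z - posterior q s z * posterior r s z"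

lemma posterior_deriv_z:
  assumes q: "observable q"
  shows "((\<lambda>z. posterior q s z) has_real_derivative covariance q h s z) (at z)"
proof -
  note d = unnormalized_deriv_z[OF q, of s z] unnormalized_deriv_z[OF observable_const[of 1], of s z]
  show ?thesis
    unfolding posterior_def covariance_def
    using normalizer_pos[of s z]
    by (auto intro!: derivative_eq_intros d simp: field_simps power2_eq_square)
qed

lemma posterior_deriv_s:
  assumes q: "observable q"
  shows "((\<lambda>s. posterior q s z) has_real_derivative - covariance q (\<lambda>x. h x * h x) s z / 2) (at s)"
proof -
  note d = unnormalized_deriv_s[OF q, of z s] unnormalized_deriv_s[OF observable_const[of 1], of z s]
  show ?thesis
    unfolding posterior_def covariance_def
    using normalizer_pos[of s z]
    by (auto intro!: derivative_eq_intros d simp: field_simps power2_eq_square)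
qed

text \<open>Both partial derivatives are posterior covariances of bounded functions, hence bounded uniformly in
  the parameters; the mean value theorem in one variable at a time gives the joint Lipschitz bound.\<close>

lemma bounded_lipschitz_posterior:
  assumes q: "observable q"
  shows "bounded_lipschitz (posterior q)"
proof -
  obtain C where C: "\<And>x. x \<in> space \<mu> \<Longrightarrow> \<bar>q x\<bar> \<le> C"
    using assms unfolding observable_def by blast
  have pb: "\<exists>D. \<forall>s z. \<bar>posterior r s z\<bar> \<le> D" if r: "observable r" for r
    using r posterior_bound[OF r] unfolding observable_def by blast
  have cb: "\<exists>D. \<forall>s z. \<bar>covariance q r s z\<bar> \<le> D" if r: "observable r" for r
  proof -
    obtain D1 D2 D3 where D: "\<And>s z. \<bar>posterior (\<lambda>x. q x * r x) s z\<bar> \<le> D1"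
      "\<And>s z. \<bar>posterior q s z\<bar> \<le> D2" "\<And>s z. \<bar>posterior r s z\<bar> \<le> D3"
      using pb[OF observable_mult[OF q r]] pb[OF q] pb[OF r] by blast
    have "\<bar>covariance q r s z\<bar> \<le> D1 + \<bar>D2\<bar> * \<bar>D3\<bar>" for s z
    proof -
      have "\<bar>posterior q s z * posterior r s z\<bar> \<le> \<bar>D2\<bar> * \<bar>D3\<bar>"
        unfolding abs_mult using D(2,3)[of s z] by (intro mult_mono) auto
      then show ?thesis unfolding covariance_def using D(1)[of s z] by linarith
    qed
    then show ?thesis by blast
  qed
  obtain D1 where D1: "\<And>s z. \<bar>covariance q h s z\<bar> \<le> D1"
    using cb[OF observable_h] by blast
  obtain D2 where D2: "\<And>s z. \<bar>covariance q (\<lambda>x. h x * h x) s z\<bar> \<le> D2"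
    using cb[OF observable_mult[OF observable_h observable_h]] by blast
  have lz: "\<bar>posterior q s z - posterior q s z'\<bar> \<le> D1 * \<bar>z - z'\<bar>" for s z z'
    using field_differentiable_bound[of UNIV "posterior q s" "covariance q h s" D1 z z']
      posterior_deriv_z[OF q] D1 by auto
  have D2': "\<bar>- covariance q (\<lambda>x. h x * h x) s z / 2\<bar> \<le> D2" for s z
    using D2[of s z] by auto
  have ls: "\<bar>posterior q s z - posterior q s' z\<bar> \<le> D2 * \<bar>s - s'\<bar>" for s s' z
    using field_differentiable_bound[of UNIV "\<lambda>s. posterior q s z"
        "\<lambda>s. - covariance q (\<lambda>x. h x * h x) s z / 2" D2 s s']
      posterior_deriv_s[OF q] D2' by auto
  show ?thesis
  proof (rule bounded_lipschitzI[where C = C and C' = "max D1 D2"])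
    show "\<bar>posterior q s z\<bar> \<le> C" for s z
      by (rule posterior_bound[OF q C])
    fix s z s' z'
    have "\<bar>posterior q s z - posterior q s' z'\<bar> \<le> D1 * \<bar>z - z'\<bar> + D2 * \<bar>s - s'\<bar>"
      using lz[of s z z'] ls[of s z' s'] by linarith
    also have "\<dots> \<le> max D1 D2 * \<bar>z - z'\<bar> + max D1 D2 * \<bar>s - s'\<bar>"
      by (intro add_mono mult_right_mono) auto
    finally show "\<bar>posterior q s z - posterior q s' z'\<bar> \<le> max D1 D2 * (\<bar>s - s'\<bar> + \<bar>z - z'\<bar>)"
      by (simp add: algebra_simps)
  qed
qed

lemma bounded_lipschitz_covariance:
  assumes "observable q" "observable r"
  shows "bounded_lipschitz (covariance q r)"
  unfolding covariance_def[abs_def]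
  by (intro bounded_lipschitz_intros bounded_lipschitz_posterior observable_mult assms)

text \<open>The third joint cumulant of \<open>q, h, h\<close> under the posterior, in the form in which the product rule
  delivers it from \<open>covariance q h\<close>.\<close>

definition third_cumulant :: "('a \<Rightarrow> real) \<Rightarrow> real \<Rightarrow> real \<Rightarrow> real" where
  "third_cumulant q s z = covariance (\<lambda>x. q x * h x) h s z
     - (covariance q h s z * posterior h s z + posterior q s z * covariance h h s z)"

lemma covariance_deriv_z:
  assumes q: "observable q"
  shows "((\<lambda>z. covariance q h s z) has_real_derivative third_cumulant q s z) (at z)"
proof -
  have "((\<lambda>z. posterior (\<lambda>x. q x * h x) s z - posterior q s z * posterior h s z)
      has_real_derivative third_cumulant q s z) (at z)"
    unfolding third_cumulant_def
    by (rule derivative_eq_intros posterior_deriv_z observable_mult q observable_h refl)+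
      (simp add: algebra_simps)
  then show ?thesis
    by (simp add: covariance_def)
qed

lemma bounded_lipschitz_third_cumulant:
  assumes "observable q"
  shows "bounded_lipschitz (third_cumulant q)"
  unfolding third_cumulant_def[abs_def]
  by (intro bounded_lipschitz_intros bounded_lipschitz_posterior bounded_lipschitz_covariance
      observable_mult assms observable_h)

text \<open>The cancellation behind the filter equation: the backward heat operator applied to a posterior expectation
  leaves only a multiple of its derivative in \<open>z\<close>, which turns the observation increment in Ito's formula
  into the innovation.\<close>

lemma posterior_backward_equation:
  "- covariance q (\<lambda>x. h x * h x) s z / 2 + third_cumulant q s z / 2
     = - posterior h s z * covariance q h s z"
  unfolding third_cumulant_def covariance_def by (simp add: field_simps)

end

section \<open>The variational step is a Bayes update\<close>

lemma densities2D:
  assumes "p \<in> densities2"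
  shows "p \<in> borel_measurable borel" "\<And>x. 0 \<le> p x" "integrable lborel p" "(\<integral>x. p x \<partial>lborel) = 1"
    "integrable lborel (\<lambda>x. (norm x)\<^sup>2 * p x)"
proof -
  show meas: "p \<in> borel_measurable borel" and nonneg: "\<And>x. 0 \<le> p x"
    and "integrable lborel (\<lambda>x. (norm x)\<^sup>2 * p x)"
    using assms by (auto simp: densities2_def)
  have one: "(\<integral>\<^sup>+x. ennreal (p x) \<partial>lborel) = 1"
    using assms by (simp add: densities2_def)
  show "integrable lborel p"
    using meas nonneg one by (intro integrableI_nonneg) auto
  show "(\<integral>x. p x \<partial>lborel) = 1"
    using meas nonneg one by (subst integral_eq_nn_integral) auto
qed

lemma densities2I:
  assumes "p \<in> borel_measurable borel" "\<And>x. 0 \<le> p x" "integrable lborel p" "(\<integral>x. p x \<partial>lborel) = 1"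
    "integrable lborel (\<lambda>x. (norm x)\<^sup>2 * p x)"
  shows "p \<in> densities2"
  using assms unfolding densities2_def by (auto simp: nn_integral_eq_integral)

text \<open>This is \<open>ln u \<le> u - 1\<close> at \<open>u = r / p\<close>, together with its equality case.\<close>

lemma diff_le_mult_ln_div:
  fixes p r :: real
  assumes "0 \<le> p" "0 < r"
  shows "p - r \<le> p * ln (p / r)" and "p * ln (p / r) = p - r \<Longrightarrow> p = r"
proof -
  have "p - r \<le> p * ln (p / r) \<and> (p * ln (p / r) = p - r \<longrightarrow> p = r)"
  proof (cases "p = 0")
    case False
    then have p: "0 < p" using assms by simp
    have "ln (r / p) \<le> r / p - 1"
      using p assms by (intro ln_le_minus_one) simp
    then have "p * ln (r / p) \<le> p * (r / p - 1)"
      using p by (intro mult_left_mono) auto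
    moreover have "ln (p / r) = - ln (r / p)"
      using p assms by (simp add: ln_div)
    ultimately have "p - r \<le> p * ln (p / r)"
      using p by (simp add: algebra_simps)
    moreover have "p = r" if "p * ln (p / r) = p - r"
    proof -
      have "p * ln (r / p) = p * (r / p - 1)"
        using that p \<open>ln (p / r) = - ln (r / p)\<close> by (simp add: algebra_simps)
      then have "ln (r / p) = r / p - 1"
        using p by simp
      then have "r / p = 1"
        using p assms by (intro ln_eq_minus_one) auto
      then show ?thesis using p by simp
    qed
    ultimately show ?thesis by blast
  qed (use assms in auto)
  then show "p - r \<le> p * ln (p / r)" and "p * ln (p / r) = p - r \<Longrightarrow> p = r" by auto
qed

text \<open>The integrand \<open>p ln (p / r) - (p - r)\<close> is pointwise nonnegative and vanishes only where \<open>p = r\<close>.\<close>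

lemma gibbs_inequality:
  fixes p r :: "'a \<Rightarrow> real"
  assumes p: "integrable M p" "\<And>x. 0 \<le> p x" and r: "integrable M r" "\<And>x. 0 < r x"
    and eq: "(\<integral>x. p x \<partial>M) = (\<integral>x. r x \<partial>M)"
    and int: "integrable M (\<lambda>x. p x * ln (p x / r x))"
  shows "0 \<le> (\<integral>x. p x * ln (p x / r x) \<partial>M)"
    and "(\<integral>x. p x * ln (p x / r x) \<partial>M) = 0 \<Longrightarrow> AE x in M. p x = r x"
proof -
  let ?e = "\<lambda>x. p x * ln (p x / r x) - (p x - r x)"
  have int_e: "integrable M ?e"
    by (intro Bochner_Integration.integrable_diff p r int)
  have nonneg: "0 \<le> ?e x" for x
    using diff_le_mult_ln_div(1)[OF p(2) r(2), of x x] by simp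
  have val: "integral\<^sup>L M ?e = (\<integral>x. p x * ln (p x / r x) \<partial>M)"
    using p r int eq by simp
  show "0 \<le> (\<integral>x. p x * ln (p x / r x) \<partial>M)"
    unfolding val[symmetric] using nonneg by (intro Bochner_Integration.integral_nonneg) auto
  assume "(\<integral>x. p x * ln (p x / r x) \<partial>M) = 0"
  then have "AE x in M. ?e x = 0"
    using integral_nonneg_eq_0_iff_AE[OF int_e] nonneg unfolding val by auto
  then show "AE x in M. p x = r x"
  proof eventually_elim
    case (elim x)
    then show ?case
      using diff_le_mult_ln_div(2)[OF p(2) r(2), of x x] by simp
  qed
qed

text \<open>The set where two continuous functions differ is open, and a nonempty open set is not negligible.\<close>

lemma continuous_AE_eq_imp_eq:
  fixes f g :: "'a::euclidean_space \<Rightarrow> real"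
  assumes "continuous_on UNIV f" "continuous_on UNIV g" "AE x in lborel. f x = g x"
  shows "f = g"
proof (rule ccontr)
  assume "f \<noteq> g"
  then have ne: "{x. f x \<noteq> g x} \<noteq> {}" by auto
  have op: "open {x. f x \<noteq> g x}"
    by (rule open_Collect_neq[OF assms(1,2)])
  have "{x \<in> space lborel. f x \<noteq> g x} \<in> null_sets lborel"
    by (rule AE_iff_null[THEN iffD1, OF _ assms(3)]) (use op in auto)
  then have "{x. f x \<noteq> g x} \<in> null_sets lebesgue"
    by (intro null_sets_completionI) simp
  then show False
    using op ne open_not_negligible by (auto simp: negligible_iff_null_sets)
qed

definition bayes_update :: "('a::euclidean_space \<Rightarrow> real) \<Rightarrow> real \<Rightarrow> real \<Rightarrow> ('a \<Rightarrow> real) \<Rightarrow> 'a \<Rightarrow> real" where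
  "bayes_update h d y q x =
     q x * exp (- (d / 2) * (y - h x)\<^sup>2) / (\<integral>x. q x * exp (- (d / 2) * (y - h x)\<^sup>2) \<partial>lborel)"

locale variational_step =
  fixes h q :: "'a::euclidean_space \<Rightarrow> real" and B d y :: real
  assumes h: "continuous_on UNIV h" "\<And>x. \<bar>h x\<bar> \<le> B"
    and q: "q \<in> densities2" "continuous_on UNIV q" "\<And>x. 0 < q x"
    and d: "0 < d"
begin

definition cost :: "'a \<Rightarrow> real" where "cost x = d / 2 * (y - h x)\<^sup>2"

definition mass :: real where "mass = (\<integral>x. q x * exp (- cost x) \<partial>lborel)"

lemma bayes_update_eq: "bayes_update h d y q x = q x * exp (- cost x) / mass"
  by (simp add: bayes_update_def mass_def cost_def)

lemma cost_nonneg: "0 \<le> cost x"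
  using d by (simp add: cost_def)

lemma cost_continuous: "continuous_on UNIV cost"
  unfolding cost_def[abs_def] by (intro continuous_intros h)

lemma cost_measurable[measurable]: "cost \<in> borel_measurable borel"
  by (rule borel_measurable_continuous_onI[OF cost_continuous])

lemma q_measurable[measurable]: "q \<in> borel_measurable borel"
  using densities2D(1)[OF q(1)] .

lemma cost_bound: "cost x \<le> d / 2 * (\<bar>y\<bar> + B)\<^sup>2"
proof -
  have "\<bar>y - h x\<bar> \<le> \<bar>y\<bar> + B"
    using h(2)[of x] by linarith
  then have "(y - h x)\<^sup>2 \<le> (\<bar>y\<bar> + B)\<^sup>2"
    by (metis abs_ge_zero power2_abs power_mono)
  then show ?thesis
    using d by (simp add: cost_def)
qed

lemma integrable_weighted:
  assumes "integrable lborel f"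
  shows "integrable lborel (\<lambda>x. f x * exp (- cost x))"
proof (rule Bochner_Integration.integrable_bound[OF assms])
  show "AE x in lborel. norm (f x * exp (- cost x)) \<le> norm (f x)"
    using cost_nonneg by (intro AE_I2) (auto simp: abs_mult intro!: mult_left_le)
qed (use assms in measurable)

lemma mass_pos: "0 < mass"
proof -
  have int: "integrable lborel (\<lambda>x. q x * exp (- cost x))"
    by (rule integrable_weighted[OF densities2D(3)[OF q(1)]])
  have "(\<integral>x. q x * exp (- (d / 2 * (\<bar>y\<bar> + B)\<^sup>2)) \<partial>lborel) \<le> mass"
    unfolding mass_def
    using q(3) cost_bound densities2D(3)[OF q(1)]
    by (intro integral_mono int integrable_mult_left mult_left_mono) (auto intro: less_imp_le)
  moreover have "(\<integral>x. q x * exp (- (d / 2 * (\<bar>y\<bar> + B)\<^sup>2)) \<partial>lborel) = exp (- (d / 2 * (\<bar>y\<bar> + B)\<^sup>2))"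
    using densities2D(4)[OF q(1)] by simp
  ultimately show ?thesis
    using exp_gt_zero[of "- (d / 2 * (\<bar>y\<bar> + B)\<^sup>2)"] by linarith
qed

lemma bayes_update_pos: "0 < bayes_update h d y q x"
  unfolding bayes_update_eq using q(3) mass_pos by simp

lemma bayes_update_continuous: "continuous_on UNIV (bayes_update h d y q)"
  unfolding bayes_update_eq[abs_def] using mass_pos
  by (intro continuous_intros q cost_continuous) auto

lemma bayes_update_density: "bayes_update h d y q \<in> densities2"
proof (rule densities2I)
  show "bayes_update h d y q \<in> borel_measurable borel"
    by (rule borel_measurable_continuous_onI[OF bayes_update_continuous])
  show "0 \<le> bayes_update h d y q x" for x
    using bayes_update_pos by (simp add: less_imp_le)
  have int: "integrable lborel (\<lambda>x. q x * exp (- cost x))"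
    by (rule integrable_weighted[OF densities2D(3)[OF q(1)]])
  then show "integrable lborel (bayes_update h d y q)"
    unfolding bayes_update_eq[abs_def] by simp
  have "(\<integral>x. bayes_update h d y q x \<partial>lborel) = mass / mass"
    by (simp add: bayes_update_eq mass_def)
  then show "(\<integral>x. bayes_update h d y q x \<partial>lborel) = 1"
    using mass_pos by simp
  have "integrable lborel (\<lambda>x. (norm x)\<^sup>2 * q x * exp (- cost x) / mass)"
    using integrable_weighted[OF densities2D(5)[OF q(1)]] by simp
  then show "integrable lborel (\<lambda>x. (norm x)\<^sup>2 * bayes_update h d y q x)"
    by (simp add: bayes_update_eq mult.assoc)
qed

lemma cost_integrable:
  assumes "integrable lborel p"
  shows "integrable lborel (\<lambda>x. p x * cost x)"
proof (rule Bochner_Integration.integrable_bound[OF integrable_mult_left[OF assms, of "d / 2 * (\<bar>y\<bar> + B)\<^sup>2"]])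
  show "AE x in lborel. norm (p x * cost x) \<le> norm (p x * (d / 2 * (\<bar>y\<bar> + B)\<^sup>2))"
  proof (rule AE_I2)
    fix x
    have "\<bar>p x\<bar> * \<bar>cost x\<bar> \<le> \<bar>p x\<bar> * \<bar>d / 2 * (\<bar>y\<bar> + B)\<^sup>2\<bar>"
      using cost_bound[of x] cost_nonneg[of x] by (intro mult_left_mono) auto
    then show "norm (p x * cost x) \<le> norm (p x * (d / 2 * (\<bar>y\<bar> + B)\<^sup>2))"
      by (simp only: real_norm_def abs_mult)
  qed
qed (use assms in measurable)

text \<open>Taking the logarithm of \<open>r = q exp (- cost) / mass\<close> absorbs the cost into the relative entropy: minimizing the
  functional is minimizing the relative entropy with respect to \<open>r\<close>.\<close>

lemma step_functional_decomposition:
  assumes p: "p \<in> densities2"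
    and fin: "integrable lborel (\<lambda>x. p x * ln (p x / q x))"
  defines "r \<equiv> bayes_update h d y q"
  shows "integrable lborel (\<lambda>x. p x * ln (p x / r x))"
    and "step_functional h d y q p = ereal ((\<integral>x. p x * ln (p x / r x) \<partial>lborel) - ln mass)"
proof -
  note pD = densities2D[OF p]
  have eq: "p x * ln (p x / q x) + p x * cost x = p x * ln (p x / r x) - p x * ln mass" for x
  proof (cases "p x = 0")
    case False
    then have px: "0 < p x" using pD(2)[of x] by simp
    have "ln (p x / r x) = ln (p x) - (ln (q x) - cost x - ln mass)"
      using px q(3)[of x] mass_pos bayes_update_pos[of x]
      by (simp add: r_def ln_div ln_mult bayes_update_eq)
    moreover have "ln (p x / q x) = ln (p x) - ln (q x)"
      using px q(3)[of x] by (simp add: ln_div)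
    ultimately have "ln (p x / q x) = ln (p x / r x) - cost x - ln mass"
      by simp
    then show ?thesis by (simp only:) (simp add: algebra_simps)
  qed simp
  have int: "integrable lborel (\<lambda>x. p x * ln (p x / q x) + p x * cost x)"
    by (intro Bochner_Integration.integrable_add fin cost_integrable pD)
  have "integrable lborel (\<lambda>x. p x * ln (p x / q x) + p x * cost x + p x * ln mass)"
    by (intro Bochner_Integration.integrable_add int integrable_mult_left pD)
  then show int': "integrable lborel (\<lambda>x. p x * ln (p x / r x))"
    unfolding eq by simp
  have "(\<integral>x. p x * ln (p x / q x) \<partial>lborel) + (\<integral>x. p x * cost x \<partial>lborel)
      = (\<integral>x. p x * ln (p x / q x) + p x * cost x \<partial>lborel)"
    using fin cost_integrable[OF pD(3)] by simp
  also have "\<dots> = (\<integral>x. p x * ln (p x / r x) \<partial>lborel) - ln mass"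
    unfolding eq using int' pD(3,4) by simp
  finally have val: "(\<integral>x. p x * ln (p x / q x) \<partial>lborel) + (\<integral>x. p x * cost x \<partial>lborel)
      = (\<integral>x. p x * ln (p x / r x) \<partial>lborel) - ln mass" .
  have "(\<integral>x. p x * cost x \<partial>lborel) = d / 2 * (\<integral>x. p x * (y - h x)\<^sup>2 \<partial>lborel)"
    unfolding cost_def by (subst integral_mult_right_zero[symmetric]) (simp add: ac_simps)
  moreover have "AE x in lborel. q x = 0 \<longrightarrow> p x = 0"
    using q(3) by (auto simp: less_le)
  ultimately show "step_functional h d y q p = ereal ((\<integral>x. p x * ln (p x / r x) \<partial>lborel) - ln mass)"
    using fin val unfolding step_functional_def rel_entropy_def by simp
qed

lemma step_functional_infinite:
  assumes "\<not> integrable lborel (\<lambda>x. p x * ln (p x / q x))"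
  shows "step_functional h d y q p = \<infinity>"
  using assms by (simp add: step_functional_def rel_entropy_def)

lemma step_functional_bayes_update:
  "step_functional h d y q (bayes_update h d y q) = ereal (- ln mass)"
proof -
  let ?r = "bayes_update h d y q"
  have "?r x * ln (?r x / q x) = - (?r x * cost x) - ?r x * ln mass" for x
  proof -
    have "?r x / q x = exp (- cost x) / mass"
      using q(3)[of x] by (simp add: bayes_update_eq)
    then have "ln (?r x / q x) = - cost x - ln mass"
      using mass_pos by (simp add: ln_div)
    then show ?thesis by (simp only:) (simp add: algebra_simps)
  qed
  then have "integrable lborel (\<lambda>x. ?r x * ln (?r x / q x))"
    using cost_integrable densities2D(3)[OF bayes_update_density] by simp
  from step_functional_decomposition(2)[OF bayes_update_density this]
  show ?thesis
    using bayes_update_pos by (simp add: less_imp_neq[symmetric])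
qed

lemma step_functional_lower_bound:
  assumes "p \<in> densities2"
  shows "ereal (- ln mass) \<le> step_functional h d y q p"
proof (cases "integrable lborel (\<lambda>x. p x * ln (p x / q x))")
  case True
  have "0 \<le> (\<integral>x. p x * ln (p x / bayes_update h d y q x) \<partial>lborel)"
    using densities2D[OF assms] densities2D[OF bayes_update_density] bayes_update_pos
      step_functional_decomposition(1)[OF assms True]
    by (intro gibbs_inequality(1)) auto
  then show ?thesis
    unfolding step_functional_decomposition(2)[OF assms True] by simp
qed (simp add: step_functional_infinite)

lemma bayes_update_is_arg_min:
  "is_arg_min (step_functional h d y q) (\<lambda>p. p \<in> densities2) (bayes_update h d y q)"
  unfolding is_arg_min_def step_functional_bayes_update
  using bayes_update_density step_functional_lower_bound by (auto simp: not_less)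

text \<open>A minimizer attains the value \<open>- ln mass\<close>, so its relative entropy with respect to the Bayes update is
  zero; continuity then removes the exceptional null set.\<close>

lemma continuous_arg_min_unique:
  assumes r: "is_arg_min (step_functional h d y q) (\<lambda>p. p \<in> densities2) r"
    and cont: "continuous_on UNIV r"
  shows "r = bayes_update h d y q"
proof -
  have rd: "r \<in> densities2" and le: "step_functional h d y q r \<le> ereal (- ln mass)"
    using r bayes_update_density
    unfolding is_arg_min_def step_functional_bayes_update[symmetric] by (auto simp: not_less)
  have fin: "integrable lborel (\<lambda>x. r x * ln (r x / q x))"
  proof (rule ccontr)
    assume "\<not> ?thesis"
    then show False using le step_functional_infinite by simp
  qed
  let ?I = "\<integral>x. r x * ln (r x / bayes_update h d y q x) \<partial>lborel"
  have "?I \<le> 0"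
    using le unfolding step_functional_decomposition(2)[OF rd fin] by simp
  moreover note gibbs = gibbs_inequality[OF densities2D(3,2)[OF rd] densities2D(3)[OF bayes_update_density]
     bayes_update_pos _ step_functional_decomposition(1)[OF rd fin]]
  have "0 \<le> ?I"
    using gibbs(1) densities2D(4)[OF rd] densities2D(4)[OF bayes_update_density] by simp
  ultimately have "AE x in lborel. r x = bayes_update h d y q x"
    using gibbs(2) densities2D(4)[OF rd] densities2D(4)[OF bayes_update_density] by simp
  then show ?thesis
    by (rule continuous_AE_eq_imp_eq[OF cont bayes_update_continuous])
qed

end

section \<open>The time-stepping procedure and its limit\<close>

lemma time_grid_pos:
  assumes "time_grid T N \<tau>" "k \<le> N" "0 < k"
  shows "0 < \<tau> k"
  using assms(2,3)
proof (induction k)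
  case (Suc k)
  have "\<tau> k < \<tau> (Suc k)" "\<tau> 0 = 0"
    using assms(1) Suc.prems by (auto simp: time_grid_def)
  then show ?case
    using Suc by (cases "k = 0") auto
qed simp

locale filtering_problem =
  fixes h p0 :: "'a::euclidean_space \<Rightarrow> real" and B :: real
  assumes h_continuous: "continuous_on UNIV h" and h_bounded: "\<And>x. \<bar>h x\<bar> \<le> B"
    and p0_density: "p0 \<in> densities2" and p0_continuous: "continuous_on UNIV p0"
    and p0_pos: "\<And>x. 0 < p0 x"
begin

lemma p0_measurable[measurable]: "p0 \<in> borel_measurable borel"
  using densities2D(1)[OF p0_density] .

lemma prob_space_prior: "prob_space (density lborel p0)"
  by (rule prob_spaceI) (use p0_density in \<open>simp add: densities2_def emeasure_density\<close>)

sublocale prior: bounded_observation "density lborel p0" h B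
proof -
  interpret prob_space "density lborel p0" by (rule prob_space_prior)
  show "bounded_observation (density lborel p0) h B"
    by unfold_locales (auto intro!: borel_measurable_continuous_onI h_continuous h_bounded)
qed

lemma unnormalized_eq_lborel:
  assumes [measurable]: "q \<in> borel_measurable borel"
  shows "prior.unnormalized q s z = (\<integral>x. q x * (prior.likelihood s z x * p0 x) \<partial>lborel)"
proof -
  have [measurable]: "h \<in> borel_measurable borel"
    by (rule borel_measurable_continuous_onI[OF h_continuous])
  have "prior.unnormalized q s z = (\<integral>x. p0 x *\<^sub>R (q x * prior.likelihood s z x) \<partial>lborel)"
    unfolding prior.unnormalized_def prior.likelihood_def using p0_pos
    by (intro integral_density) (auto intro: less_imp_le)
  then show ?thesis by (simp add: ac_simps)
qed

definition posterior_density :: "real \<Rightarrow> real \<Rightarrow> 'a \<Rightarrow> real" where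
  "posterior_density s z x = prior.likelihood s z x * p0 x / prior.unnormalized (\<lambda>_. 1) s z"

lemma pairing_posterior_density:
  assumes "q \<in> borel_measurable borel"
  shows "pairing q (posterior_density s z) = prior.posterior q s z"
  by (simp add: pairing_def posterior_density_def prior.posterior_def unnormalized_eq_lborel[OF assms])

lemma posterior_density_0: "posterior_density 0 0 = p0"
proof -
  have "prior.likelihood 0 0 x = 1" for x
    by (simp add: prior.likelihood_def)
  moreover have "prior.unnormalized (\<lambda>_. 1) 0 0 = 1"
    using densities2D(4)[OF p0_density] calculation by (simp add: unnormalized_eq_lborel)
  ultimately show ?thesis
    by (simp add: posterior_density_def fun_eq_iff)
qed

lemma posterior_density_pos: "0 < posterior_density s z x"
  using p0_pos prior.likelihood_pos prior.normalizer_pos by (simp add: posterior_density_def)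

lemma posterior_density_continuous: "continuous_on UNIV (posterior_density s z)"
  unfolding posterior_density_def[abs_def] prior.likelihood_def
  using prior.normalizer_pos[of s z]
  by (intro continuous_intros h_continuous p0_continuous) auto

text \<open>Expanding \<open>(y - h)\<^sup>2\<close> gives a term in \<open>h\<^sup>2\<close> that advances the time, a term in \<open>h\<close> that advances the
  observation, and a term in \<open>y\<^sup>2\<close> that does not depend on \<open>x\<close> and cancels against the normalization.\<close>

lemma bayes_update_posterior_density:
  "bayes_update h d y (posterior_density s z) = posterior_density (s + d) (z + d * y)"
proof
  fix x
  let ?c = "exp (- (d / 2 * y\<^sup>2)) / prior.unnormalized (\<lambda>_. 1) s z"
  have step: "posterior_density s z x * exp (- (d / 2) * (y - h x)\<^sup>2)
      = ?c * (1 * (prior.likelihood (s + d) (z + d * y) x * p0 x))" for x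
  proof -
    have "h x * z - (h x)\<^sup>2 / 2 * s + (- (d / 2) * (y - h x)\<^sup>2)
        = - (d / 2 * y\<^sup>2) + (h x * (z + d * y) - (h x)\<^sup>2 / 2 * (s + d))"
      by (simp add: algebra_simps power2_eq_square)
    then have "prior.likelihood s z x * exp (- (d / 2) * (y - h x)\<^sup>2)
        = exp (- (d / 2 * y\<^sup>2)) * prior.likelihood (s + d) (z + d * y) x"
      unfolding prior.likelihood_def by (simp only: exp_add[symmetric])
    then show ?thesis
      by (simp add: posterior_density_def)
  qed
  have "?c \<noteq> 0"
    using prior.normalizer_pos[of s z] by simp
  then show "bayes_update h d y (posterior_density s z) x = posterior_density (s + d) (z + d * y) x"
    unfolding bayes_update_def step integral_mult_right_zero
    using unnormalized_eq_lborel[of "\<lambda>_. 1" "s + d" "z + d * y"]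
    by (simp add: posterior_density_def)
qed

lemma variational_stepI:
  assumes "posterior_density s z \<in> densities2" "0 < d"
  shows "variational_step h (posterior_density s z) B d"
  using assms
  by unfold_locales (auto intro: h_continuous h_bounded posterior_density_continuous posterior_density_pos)

text \<open>The second moment is inherited from the prior, because a single Bayes update over the whole of \<open>[0, s]\<close> leads
  from the prior to the posterior.\<close>

lemma posterior_density_in_densities2:
  assumes "0 < s"
  shows "posterior_density s z \<in> densities2"
proof -
  interpret variational_step h p0 B s "z / s"
    using variational_stepI[of 0 0 s] p0_density assms by (simp add: posterior_density_0)
  show ?thesis
    using bayes_update_density bayes_update_posterior_density[of s "z / s" 0 0] assms
    by (simp add: posterior_density_0)
qed

text \<open>Each step is a Bayes update, and the parameters of successive updates telescope, so the scheme has no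
  discretization error at the grid points.\<close>

lemma time_stepping_posterior:
  assumes grid: "time_grid T N \<tau>" and R: "time_stepping h p0 z N \<tau> R" and n: "n \<le> N"
  shows "R n = posterior_density (\<tau> n) (z (\<tau> n) - z 0) \<and> R n \<in> densities2"
  using n
proof (induction n)
  case 0
  then show ?case
    using grid R p0_density by (simp add: time_grid_def time_stepping_def posterior_density_0)
next
  case (Suc n)
  let ?d = "\<tau> (Suc n) - \<tau> n" and ?y = "(z (\<tau> (Suc n)) - z (\<tau> n)) / (\<tau> (Suc n) - \<tau> n)"
  have d: "0 < ?d"
    using grid Suc.prems by (simp add: time_grid_def)
  have IH: "R n = posterior_density (\<tau> n) (z (\<tau> n) - z 0)" "R n \<in> densities2"
    using Suc by auto
  interpret variational_step h "R n" B ?d ?y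
    unfolding IH(1) using IH d by (intro variational_stepI) auto
  have "R (Suc n) = bayes_update h ?d ?y (R n)"
  proof (rule continuous_arg_min_unique)
    have "Suc n \<in> {1..N}" using Suc.prems by simp
    then show "is_arg_min (step_functional h ?d ?y (R n)) (\<lambda>p. p \<in> densities2) (R (Suc n))"
      and "continuous_on UNIV (R (Suc n))"
      using R unfolding time_stepping_def by (metis diff_Suc_1)+
  qed
  also have "\<dots> = posterior_density (\<tau> (Suc n)) (z (\<tau> (Suc n)) - z 0)"
    unfolding IH(1) bayes_update_posterior_density using d by simp
  finally show ?case
    using bayes_update_density \<open>R (Suc n) = bayes_update h ?d ?y (R n)\<close> by simp
qed

lemma time_stepping_exists:
  assumes grid: "time_grid T N \<tau>"
  shows "time_stepping h p0 z N \<tau> (\<lambda>n. posterior_density (\<tau> n) (z (\<tau> n) - z 0))"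
  unfolding time_stepping_def
proof (intro conjI ballI)
  show "posterior_density (\<tau> 0) (z (\<tau> 0) - z 0) = p0"
    using grid by (simp add: time_grid_def posterior_density_0)
next
  fix n assume n: "n \<in> {1..N}"
  let ?R = "\<lambda>n. posterior_density (\<tau> n) (z (\<tau> n) - z 0)"
  let ?d = "\<tau> n - \<tau> (n - 1)" and ?y = "(z (\<tau> n) - z (\<tau> (n - 1))) / (\<tau> n - \<tau> (n - 1))"
  show "continuous_on UNIV (?R n)" by (rule posterior_density_continuous)
  have "?R (n - 1) \<in> densities2"
  proof (cases "n - 1 = 0")
    case True
    have "\<tau> 0 = 0" using grid by (simp add: time_grid_def)
    then show ?thesis unfolding True by (simp add: p0_density posterior_density_0)
  next
    case False
    then show ?thesis
      using time_grid_pos[OF grid, of "n - 1"] n by (intro posterior_density_in_densities2) auto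
  qed
  moreover have d: "0 < ?d"
    using grid n unfolding time_grid_def by (cases n) auto
  ultimately interpret variational_step h "?R (n - 1)" B ?d ?y
    by (rule variational_stepI)
  have "bayes_update h ?d ?y (?R (n - 1)) = ?R n"
    unfolding bayes_update_posterior_density using d by simp
  then show "is_arg_min (step_functional h ?d ?y (?R (n - 1))) (\<lambda>p. p \<in> densities2) (?R n)"
    using bayes_update_is_arg_min by simp
qed

lemma posterior_density_tendsto:
  assumes "(s \<longlongrightarrow> s') sequentially" "(z \<longlongrightarrow> z') sequentially"
  shows "(\<lambda>k. posterior_density (s k) (z k) x) \<longlonglongrightarrow> posterior_density s' z' x"
  unfolding posterior_density_def using prior.normalizer_pos[of s' z']
  by (intro tendsto_intros prior.likelihood_tendsto prior.unnormalized_tendsto prior.observable_const assms) auto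

text \<open>Either the next grid point lies beyond \<open>t\<close>, and the cell between the two contains \<open>t\<close>, or the last grid point
  is \<open>T\<close> and coincides with \<open>t\<close>.\<close>

lemma last_grid_point:
  assumes T: "0 < T" and grid: "time_grid T N \<tau>" and t: "t \<in> {0..T}"
  defines "m \<equiv> Max {n. n \<le> N \<and> \<tau> n \<le> t}"
  shows "m \<le> N" "\<bar>\<tau> m - t\<bar> \<le> grid_mesh N \<tau>" "\<tau> m \<in> {0..T}"
proof -
  let ?S = "{n. n \<le> N \<and> \<tau> n \<le> t}"
  have \<tau>: "\<tau> 0 = 0" "\<tau> N = T" "\<And>n. n < N \<Longrightarrow> \<tau> n < \<tau> (Suc n)"
    using grid by (auto simp: time_grid_def)
  have fin: "finite ?S" by simp
  moreover have "0 \<in> ?S" using \<tau> t by simp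
  ultimately have mS: "m \<in> ?S"
    unfolding m_def using Max_in[of ?S] by blast
  then show mN: "m \<le> N" by simp
  have "0 \<le> \<tau> m"
    using time_grid_pos[OF grid mN] \<tau>(1) by (cases "m = 0") auto
  then show "\<tau> m \<in> {0..T}" using mS t by auto
  have mesh: "\<tau> (Suc n) - \<tau> n \<le> grid_mesh N \<tau>" if "n < N" for n
    unfolding grid_mesh_def using that
    by (intro Max_ge) (auto intro!: image_eqI[of _ _ "Suc n"])
  show "\<bar>\<tau> m - t\<bar> \<le> grid_mesh N \<tau>"
  proof (cases "m = N")
    case True
    have "0 < N" using T \<tau> by (cases N) auto
    then have "0 \<le> grid_mesh N \<tau>" using mesh[of 0] \<tau>(3)[of 0] by simp
    then show ?thesis using True \<tau> mS t by auto
  next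
    case False
    then have "m < N" using mN by simp
    moreover have "Suc m \<notin> ?S"
      using Max_ge[OF fin, of "Suc m"] unfolding m_def[symmetric] by auto
    ultimately show ?thesis using mesh[of m] mS by auto
  qed
qed

theorem time_stepping_limit_posterior:
  assumes T: "0 < T" and z: "continuous_on {0..T} z"
    and r: "\<And>t. t \<in> {0..T} \<Longrightarrow> r t = posterior_density t (z t - z 0)"
  shows "time_stepping_limit h p0 T z r"
  unfolding time_stepping_limit_def
proof (intro conjI allI impI ballI)
  show "\<exists>R. time_stepping h p0 z N \<tau> R" if "time_grid T N \<tau>" for N \<tau>
    using time_stepping_exists[OF that] by blast
next
  fix N :: "nat \<Rightarrow> nat" and \<tau> R t x
  assume *: "(\<forall>k. time_grid T (N k) (\<tau> k) \<and> time_stepping h p0 z (N k) (\<tau> k) (R k)) \<and>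
      filterlim N at_top sequentially \<and> (\<lambda>k. grid_mesh (N k) (\<tau> k)) \<longlonglongrightarrow> 0"
    and t: "t \<in> {0..T}"
  define m where "m k = Max {n. n \<le> N k \<and> \<tau> k n \<le> t}" for k
  note m = last_grid_point[OF T _ t, of "N k" "\<tau> k" for k, folded m_def]
  have grid: "time_grid T (N k) (\<tau> k)" for k using * by blast
  have lim: "(\<lambda>k. \<tau> k (m k)) \<longlonglongrightarrow> t"
  proof (rule LIM_zero_cancel, rule Lim_null_comparison)
    show "\<forall>\<^sub>F k in sequentially. norm (\<tau> k (m k) - t) \<le> grid_mesh (N k) (\<tau> k)"
      using m(2)[OF grid] by simp
  qed (use * in blast)
  have "(\<lambda>k. z (\<tau> k (m k))) \<longlonglongrightarrow> z t"
    using continuous_on_tendsto_compose[OF z lim t] m(3)[OF grid] by simp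
  then have "(\<lambda>k. posterior_density (\<tau> k (m k)) (z (\<tau> k (m k)) - z 0) x) \<longlonglongrightarrow> r t x"
    unfolding r[OF t] by (intro posterior_density_tendsto tendsto_intros lim)
  moreover have "step_interpolant (N k) (\<tau> k) (R k) t
      = posterior_density (\<tau> k (m k)) (z (\<tau> k (m k)) - z 0)" for k
    unfolding step_interpolant_def m_def[symmetric]
    using time_stepping_posterior[OF grid, of z k "R k" "m k"] * m(1)[OF grid] by blast
  ultimately show "(\<lambda>k. step_interpolant (N k) (\<tau> k) (R k) t x) \<longlonglongrightarrow> r t x"
    by simp
qed

end

section \<open>Elementary processes on uniform grids\<close>

lemma half_open_cell:
  fixes \<tau> :: "nat \<Rightarrow> real"
  assumes "\<tau> 0 < s" "s \<le> \<tau> n"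
  obtains i where "i < n" "\<tau> i < s" "s \<le> \<tau> (Suc i)"
  using assms(2)
proof (induction n arbitrary: thesis)
  case (Suc n)
  show ?case
  proof (cases "s \<le> \<tau> n")
    case True
    then show ?thesis using Suc.IH Suc.prems(1) less_SucI by metis
  qed (use Suc.prems in \<open>auto intro!: Suc.prems(1)[of n]\<close>)
qed (use assms(1) in auto)

lemma elementary_value_cell:
  assumes mono: "mono \<tau>" and i: "i < n" "\<tau> i < s" "s \<le> \<tau> (Suc i)"
  shows "elementary_value n \<tau> e s \<omega> = e i \<omega>"
proof -
  have "indicator {\<tau> j<..\<tau> (Suc j)} s = (0::real)" if "j \<noteq> i" for j
  proof (cases "j < i")
    case True
    then have "\<tau> (Suc j) \<le> \<tau> i" by (intro monoD[OF mono]) simp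
    then show ?thesis using i by simp
  next
    case False
    then have "\<tau> (Suc i) \<le> \<tau> j" using that by (intro monoD[OF mono]) simp
    then show ?thesis using i by simp
  qed
  then have "elementary_value n \<tau> e s \<omega> = (\<Sum>j<n. if j = i then e i \<omega> else 0)"
    unfolding elementary_value_def using i by (intro sum.cong) auto
  then show ?thesis using i by simp
qed

lemma elementary_value_outside:
  assumes mono: "mono \<tau>" and s: "s \<notin> {\<tau> 0<..\<tau> n}"
  shows "elementary_value n \<tau> e s \<omega> = 0"
  unfolding elementary_value_def
proof (rule sum.neutral, rule ballI)
  fix j assume "j \<in> {..<n}"
  then have "\<tau> 0 \<le> \<tau> j" "\<tau> (Suc j) \<le> \<tau> n" by (auto intro!: monoD[OF mono])
  then show "e j \<omega> * indicator {\<tau> j<..\<tau> (Suc j)} s = 0"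
    using s by (auto simp: indicator_def)
qed

definition uniform_grid :: "real \<Rightarrow> nat \<Rightarrow> nat \<Rightarrow> real" where
  "uniform_grid t k i = t * real i / real (Suc k)"

lemma uniform_grid_0[simp]: "uniform_grid t k 0 = 0"
  by (simp add: uniform_grid_def)

lemma uniform_grid_end[simp]: "uniform_grid t k (Suc k) = t"
  by (simp add: uniform_grid_def)

lemma uniform_grid_step: "uniform_grid t k (Suc i) - uniform_grid t k i = t / real (Suc k)"
  unfolding uniform_grid_def of_nat_Suc[of i]
  by (simp add: distrib_left add_divide_distrib del: of_nat_Suc)

lemma uniform_grid_mono: "0 \<le> t \<Longrightarrow> mono (uniform_grid t k)"
  unfolding uniform_grid_def mono_def by (auto intro!: divide_right_mono mult_left_mono)

lemma uniform_grid_strict: "0 < t \<Longrightarrow> uniform_grid t k i < uniform_grid t k (Suc i)"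
  using uniform_grid_step[of t k i] divide_pos_pos[of t "real (Suc k)"] by linarith

lemma uniform_grid_nonneg: "0 \<le> t \<Longrightarrow> 0 \<le> uniform_grid t k i"
  by (simp add: uniform_grid_def)

text \<open>The time \<open>0\<close> is excluded because the cells are open on the left: every elementary process vanishes there.\<close>

lemma uniform_grid_elementary_value_tendsto:
  assumes t: "0 < t" and cont: "continuous_on UNIV (\<lambda>s. U s \<omega>)" and s: "0 < s" "s \<le> t"
  shows "(\<lambda>k. elementary_value (Suc k) (uniform_grid t k) (\<lambda>i. U (uniform_grid t k i)) s \<omega>) \<longlonglongrightarrow> U s \<omega>"
proof -
  have "\<exists>i<Suc k. uniform_grid t k i < s \<and> s \<le> uniform_grid t k (Suc i)" for k
    using half_open_cell[of "uniform_grid t k" s "Suc k"] s by auto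
  then obtain i where i: "\<And>k. i k < Suc k" "\<And>k. uniform_grid t k (i k) < s"
    "\<And>k. s \<le> uniform_grid t k (Suc (i k))"
    by metis
  have "(\<lambda>k. uniform_grid t k (i k)) \<longlonglongrightarrow> s"
  proof (rule LIM_zero_cancel, rule Lim_null_comparison)
    show "\<forall>\<^sub>F k in sequentially. norm (uniform_grid t k (i k) - s) \<le> t / real (Suc k)"
    proof (rule always_eventually, rule allI)
      fix k
      show "norm (uniform_grid t k (i k) - s) \<le> t / real (Suc k)"
        using i(2,3)[of k] uniform_grid_step[of t k "i k"] unfolding real_norm_def by linarith
    qed
    show "(\<lambda>k. t / real (Suc k)) \<longlonglongrightarrow> 0"
      by (rule LIMSEQ_Suc[OF lim_const_over_n])
  qed
  then have "(\<lambda>k. U (uniform_grid t k (i k)) \<omega>) \<longlonglongrightarrow> U s \<omega>"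
    by (rule continuous_on_tendsto_compose[OF cont]) auto
  moreover have "elementary_value (Suc k) (uniform_grid t k) (\<lambda>i. U (uniform_grid t k i)) s \<omega>
      = U (uniform_grid t k (i k)) \<omega>" for k
    using elementary_value_cell[OF uniform_grid_mono i] t by simp
  ultimately show ?thesis by simp
qed

lemma uniform_grid_elementary_value_bound:
  assumes t: "0 < t" and C: "\<And>s. \<bar>U s \<omega>\<bar> \<le> C"
  shows "\<bar>elementary_value (Suc k) (uniform_grid t k) (\<lambda>i. U (uniform_grid t k i)) s \<omega>\<bar> \<le> C"
proof (cases "s \<in> {uniform_grid t k 0<..uniform_grid t k (Suc k)}")
  case True
  then have "uniform_grid t k 0 < s" "s \<le> uniform_grid t k (Suc k)"
    by auto
  then obtain i where i: "i < Suc k" "uniform_grid t k i < s" "s \<le> uniform_grid t k (Suc i)"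
    by (rule half_open_cell)
  show ?thesis
    using t C by (subst elementary_value_cell[OF uniform_grid_mono i]) auto
next
  case False
  have "0 \<le> C" using C[of 0] by linarith
  then show ?thesis
    using t by (subst elementary_value_outside[OF uniform_grid_mono False]) auto
qed

lemma elementary_value_measurable:
  assumes [measurable]: "\<And>i. i < n \<Longrightarrow> e i \<in> borel_measurable M"
  shows "(\<lambda>(s, \<omega>). elementary_value n \<tau> e s \<omega>) \<in> borel_measurable (borel \<Otimes>\<^sub>M M)"
  unfolding elementary_value_def split_beta'
  by (intro borel_measurable_sum borel_measurable_times) (auto intro: measurable_compose[OF measurable_snd])

lemma swap_measurable_lborel:
  assumes "(\<lambda>(s, \<omega>). U s \<omega>) \<in> borel_measurable (borel \<Otimes>\<^sub>M M)"
  shows "(\<lambda>(\<omega>, s). U s \<omega>) \<in> borel_measurable (M \<Otimes>\<^sub>M lborel)"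
proof -
  have "sets (M \<Otimes>\<^sub>M lborel) = sets (M \<Otimes>\<^sub>M (borel :: real measure))"
    by (intro sets_pair_measure_cong) auto
  from measurable_cong_sets[OF this refl] show ?thesis
    using measurable_pair_swap[OF assms] by (simp add: split_beta')
qed

text \<open>The continuity and the bound are required for all real times, not just for nonnegative ones, so that no time
  horizon has to be carried along. Under them, all approximations along uniform grids follow by
  dominated convergence.\<close>

definition regular_process :: "'w measure \<Rightarrow> (real \<Rightarrow> 'w \<Rightarrow> real) \<Rightarrow> bool" where
  "regular_process M U \<longleftrightarrow> (\<lambda>(s, \<omega>). U s \<omega>) \<in> borel_measurable (borel \<Otimes>\<^sub>M M) \<and>
     (\<forall>\<omega>\<in>space M. continuous_on UNIV (\<lambda>s. U s \<omega>)) \<and> (\<exists>C. \<forall>s. \<forall>\<omega>\<in>space M. \<bar>U s \<omega>\<bar> \<le> C)"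

lemma regular_processD:
  assumes "regular_process M U"
  shows "(\<lambda>(s, \<omega>). U s \<omega>) \<in> borel_measurable (borel \<Otimes>\<^sub>M M)"
    and "\<And>s. U s \<in> borel_measurable M"
    and "\<And>\<omega>. \<omega> \<in> space M \<Longrightarrow> continuous_on UNIV (\<lambda>s. U s \<omega>)"
    and "\<And>\<omega>. \<omega> \<in> space M \<Longrightarrow> (\<lambda>s. U s \<omega>) \<in> borel_measurable borel"
proof -
  show meas: "(\<lambda>(s, \<omega>). U s \<omega>) \<in> borel_measurable (borel \<Otimes>\<^sub>M M)"
    and cont: "\<And>\<omega>. \<omega> \<in> space M \<Longrightarrow> continuous_on UNIV (\<lambda>s. U s \<omega>)"
    using assms by (auto simp: regular_process_def)
  show "U s \<in> borel_measurable M" for s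
    using measurable_compose[OF measurable_Pair1'[of s borel M] meas] by simp
  show "(\<lambda>s. U s \<omega>) \<in> borel_measurable borel" if "\<omega> \<in> space M" for \<omega>
    by (rule borel_measurable_continuous_onI[OF cont[OF that]])
qed

lemma regular_process_bound:
  assumes "regular_process M U"
  obtains C where "0 \<le> C" "\<And>s \<omega>. \<omega> \<in> space M \<Longrightarrow> \<bar>U s \<omega>\<bar> \<le> C"
proof -
  obtain C where C: "\<And>s \<omega>. \<omega> \<in> space M \<Longrightarrow> \<bar>U s \<omega>\<bar> \<le> C"
    using assms unfolding regular_process_def by blast
  show ?thesis
    by (rule that[of "\<bar>C\<bar>"]) (use C in \<open>auto intro: order_trans[OF _ abs_ge_self]\<close>)
qed

lemma regular_process_add:
  assumes "regular_process M U" "regular_process M V"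
  shows "regular_process M (\<lambda>s \<omega>. U s \<omega> + V s \<omega>)"
proof -
  obtain C where C: "\<And>s \<omega>. \<omega> \<in> space M \<Longrightarrow> \<bar>U s \<omega>\<bar> \<le> C"
    using regular_process_bound[OF assms(1)] by metis
  obtain D where D: "\<And>s \<omega>. \<omega> \<in> space M \<Longrightarrow> \<bar>V s \<omega>\<bar> \<le> D"
    using regular_process_bound[OF assms(2)] by metis
  have "\<bar>U s \<omega> + V s \<omega>\<bar> \<le> C + D" if "\<omega> \<in> space M" for s \<omega>
    using C[OF that, of s] D[OF that, of s] by linarith
  then show ?thesis
    using assms unfolding regular_process_def split_beta'
    by (auto intro!: continuous_intros borel_measurable_add)
qed

lemma regular_process_mult:
  assumes "regular_process M U" "regular_process M V"
  shows "regular_process M (\<lambda>s \<omega>. U s \<omega> * V s \<omega>)"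
proof -
  obtain C where C: "0 \<le> C" "\<And>s \<omega>. \<omega> \<in> space M \<Longrightarrow> \<bar>U s \<omega>\<bar> \<le> C"
    using regular_process_bound[OF assms(1)] by metis
  obtain D where D: "0 \<le> D" "\<And>s \<omega>. \<omega> \<in> space M \<Longrightarrow> \<bar>V s \<omega>\<bar> \<le> D"
    using regular_process_bound[OF assms(2)] by metis
  have "\<bar>U s \<omega> * V s \<omega>\<bar> \<le> C * D" if "\<omega> \<in> space M" for s \<omega>
    unfolding abs_mult using C D that by (intro mult_mono) auto
  then show ?thesis
    using assms unfolding regular_process_def split_beta'
    by (auto intro!: continuous_intros borel_measurable_times)
qed

lemma regular_process_random_variable:
  assumes "X \<in> borel_measurable M" "\<And>\<omega>. \<omega> \<in> space M \<Longrightarrow> \<bar>X \<omega>\<bar> \<le> C"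
  shows "regular_process M (\<lambda>s. X)"
  using assms unfolding regular_process_def split_beta'
  by (auto intro: measurable_compose[OF measurable_snd])

context prob_space
begin

text \<open>Left-endpoint sampling converges pointwise for \<open>s > 0\<close> by continuity of the path, and the bound on the process
  dominates it, first in \<open>s\<close> and then in \<open>\<omega>\<close>.\<close>

lemma regular_process_elementary_approximation:
  assumes U: "regular_process M U" and t: "0 < t"
  shows "(\<lambda>k. \<integral>\<^sup>+\<omega>. (\<integral>\<^sup>+s. ennreal (indicator {0..t} s *
            (U s \<omega> - elementary_value (Suc k) (uniform_grid t k) (\<lambda>i. U (uniform_grid t k i)) s \<omega>)\<^sup>2) \<partial>lborel) \<partial>M)
          \<longlonglongrightarrow> 0"
proof -
  let ?E = "\<lambda>k s \<omega>. elementary_value (Suc k) (uniform_grid t k) (\<lambda>i. U (uniform_grid t k i)) s \<omega>"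
  let ?f = "\<lambda>k s \<omega>. ennreal (indicator {0..t} s * (U s \<omega> - ?E k s \<omega>)\<^sup>2)"
  obtain C where C: "0 \<le> C" "\<And>s \<omega>. \<omega> \<in> space M \<Longrightarrow> \<bar>U s \<omega>\<bar> \<le> C"
    using regular_process_bound[OF U] by metis
  note [measurable] = regular_processD(2)[OF U]
  have E: "(\<lambda>(s, \<omega>). ?E k s \<omega>) \<in> borel_measurable (borel \<Otimes>\<^sub>M M)" for k
    by (rule elementary_value_measurable) simp
  have meas: "(\<lambda>(\<omega>, s). ?f k s \<omega>) \<in> borel_measurable (M \<Otimes>\<^sub>M lborel)" for k
    unfolding split_beta'
    by (intro measurable_compose[OF _ measurable_ennreal] borel_measurable_times borel_measurable_power
          borel_measurable_diff swap_measurable_lborel[OF regular_processD(1)[OF U], unfolded split_beta']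
          swap_measurable_lborel[OF E[of k], unfolded split_beta']) measurable
  have bound: "?f k s \<omega> \<le> ennreal (indicator {0..t} s * (2 * C)\<^sup>2)" if "\<omega> \<in> space M" for k s \<omega>
  proof -
    have "\<bar>U s \<omega> - ?E k s \<omega>\<bar> \<le> 2 * C"
      using uniform_grid_elementary_value_bound[where U = U and \<omega> = \<omega>, OF t C(2)[OF that], of k s] C(2)[OF that, of s] by linarith
    then have "(U s \<omega> - ?E k s \<omega>)\<^sup>2 \<le> (2 * C)\<^sup>2"
      by (metis abs_ge_zero power2_abs power_mono)
    then show ?thesis
      by (intro ennreal_leI mult_left_mono) auto
  qed
  have w: "(\<integral>\<^sup>+s. ennreal (indicator {0..t} s * (2 * C)\<^sup>2) \<partial>lborel) = ennreal ((2 * C)\<^sup>2 * t)"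
  proof -
    have "(\<integral>\<^sup>+s. ennreal (indicator {0..t} s * (2 * C)\<^sup>2) \<partial>lborel)
        = (\<integral>\<^sup>+s. ennreal ((2 * C)\<^sup>2) * indicator {0..t} s \<partial>lborel)"
      by (intro nn_integral_cong) (auto simp: indicator_def)
    then show ?thesis
      using t by (simp add: nn_integral_cmult_indicator ennreal_mult')
  qed
  have inner: "(\<lambda>k. \<integral>\<^sup>+s. ?f k s \<omega> \<partial>lborel) \<longlonglongrightarrow> (\<integral>\<^sup>+(s::real). 0 \<partial>lborel)" if \<omega>: "\<omega> \<in> space M" for \<omega>
  proof (rule nn_integral_dominated_convergence[where w = "\<lambda>s. ennreal (indicator {0..t} s * (2 * C)\<^sup>2)"])
    show "(\<lambda>s. ?f k s \<omega>) \<in> borel_measurable lborel" for k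
      using measurable_compose[OF measurable_Pair1'[OF \<omega>, of lborel] meas[of k]] by simp
    show "AE s in lborel. (\<lambda>k. ?f k s \<omega>) \<longlonglongrightarrow> 0"
      using AE_lborel_singleton[of 0]
    proof eventually_elim
      case (elim s)
      show ?case
      proof (cases "s \<in> {0..t}")
        case True
        then have "(\<lambda>k. ?E k s \<omega>) \<longlonglongrightarrow> U s \<omega>"
          using elim by (intro uniform_grid_elementary_value_tendsto t regular_processD(3)[OF U \<omega>]) auto
        then have "(\<lambda>k. indicator {0..t} s * (U s \<omega> - ?E k s \<omega>)\<^sup>2)
            \<longlonglongrightarrow> indicator {0..t} s * (U s \<omega> - U s \<omega>)\<^sup>2"
          by (intro tendsto_intros)
        then have "(\<lambda>k. ?f k s \<omega>) \<longlonglongrightarrow> ennreal (indicator {0..t} s * (U s \<omega> - U s \<omega>)\<^sup>2)"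
          by (rule tendsto_ennrealI)
        then show ?thesis by simp
      qed simp
    qed
    show "AE s in lborel. ?f k s \<omega> \<le> ennreal (indicator {0..t} s * (2 * C)\<^sup>2)" for k
      using bound[OF \<omega>] by simp
    show "(\<integral>\<^sup>+s. ennreal (indicator {0..t} s * (2 * C)\<^sup>2) \<partial>lborel) < \<infinity>"
      unfolding w by simp
  qed simp_all
  have "(\<lambda>k. \<integral>\<^sup>+\<omega>. (\<integral>\<^sup>+s. ?f k s \<omega> \<partial>lborel) \<partial>M) \<longlonglongrightarrow> (\<integral>\<^sup>+\<omega>. 0 \<partial>M)"
  proof (rule nn_integral_dominated_convergence[where w = "\<lambda>_. ennreal ((2 * C)\<^sup>2 * t)"])
    show "(\<lambda>\<omega>. \<integral>\<^sup>+s. ?f k s \<omega> \<partial>lborel) \<in> borel_measurable M" for k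
      using lborel.borel_measurable_nn_integral[OF meas[of k]] by simp
    show "AE \<omega> in M. (\<lambda>k. \<integral>\<^sup>+s. ?f k s \<omega> \<partial>lborel) \<longlonglongrightarrow> 0"
      using inner by (intro AE_I2) simp
    show "AE \<omega> in M. (\<integral>\<^sup>+s. ?f k s \<omega> \<partial>lborel) \<le> ennreal ((2 * C)\<^sup>2 * t)" for k
      unfolding w[symmetric] using bound by (intro AE_I2 nn_integral_mono) auto
  qed (simp_all add: emeasure_space_1)
  then show ?thesis by simp
qed

lemma regular_process_riemann_sum:
  assumes U: "regular_process M U" and t: "0 < t"
  shows "integrable M (\<lambda>\<omega>. ((\<Sum>i<Suc k. U (uniform_grid t k i) \<omega> * (t / real (Suc k))) - (LBINT s:{0..t}. U s \<omega>))\<^sup>2)"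
    and "(\<lambda>k. \<integral>\<omega>. ((\<Sum>i<Suc k. U (uniform_grid t k i) \<omega> * (t / real (Suc k))) - (LBINT s:{0..t}. U s \<omega>))\<^sup>2 \<partial>M) \<longlonglongrightarrow> 0"
    and "(\<lambda>\<omega>. LBINT s:{0..t}. U s \<omega>) \<in> borel_measurable M"
proof -
  let ?E = "\<lambda>k s \<omega>. elementary_value (Suc k) (uniform_grid t k) (\<lambda>i. U (uniform_grid t k i)) s \<omega>"
  let ?S = "\<lambda>k \<omega>. \<Sum>i<Suc k. U (uniform_grid t k i) \<omega> * (t / real (Suc k))"
  let ?I = "\<lambda>\<omega>. LBINT s:{0..t}. U s \<omega>"
  obtain C where C: "0 \<le> C" "\<And>s \<omega>. \<omega> \<in> space M \<Longrightarrow> \<bar>U s \<omega>\<bar> \<le> C"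
    using regular_process_bound[OF U] by metis
  note [measurable] = regular_processD(2)[OF U]
  have E: "(\<lambda>(s, \<omega>). ?E k s \<omega>) \<in> borel_measurable (borel \<Otimes>\<^sub>M M)" for k
    by (rule elementary_value_measurable) simp
  have dom: "integrable lborel (\<lambda>s. indicator {0..t} s * C)"
    using t by (intro integrable_mult_left integrable_real_indicator) auto
  have meas: "(\<lambda>(\<omega>, s). indicator {0..t} s *\<^sub>R U s \<omega>) \<in> borel_measurable (M \<Otimes>\<^sub>M lborel)"
    unfolding split_beta'
    by (intro borel_measurable_scaleR swap_measurable_lborel[OF regular_processD(1)[OF U], unfolded split_beta'])
      measurable
  show I: "?I \<in> borel_measurable M"
    unfolding set_lebesgue_integral_def
    using lborel.borel_measurable_lebesgue_integral[OF meas] by simp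
  have sum: "?S k \<omega> = (\<integral>s. indicator {0..t} s *\<^sub>R ?E k s \<omega> \<partial>lborel)" for k \<omega>
  proof -
    have cell: "{uniform_grid t k i<..uniform_grid t k (Suc i)} \<subseteq> {0..t}" if "i < Suc k" for i
    proof -
      have "uniform_grid t k (Suc i) \<le> uniform_grid t k (Suc k)"
        using that t by (intro monoD[OF uniform_grid_mono]) auto
      then show ?thesis
        using uniform_grid_nonneg[of t k i] t by auto
    qed
    have "(\<integral>s. indicator {0..t} s *\<^sub>R ?E k s \<omega> \<partial>lborel)
      = (\<integral>s. (\<Sum>i<Suc k. U (uniform_grid t k i) \<omega> * indicator {uniform_grid t k i<..uniform_grid t k (Suc i)} s) \<partial>lborel)"
      unfolding elementary_value_def sum_distrib_left real_scaleR_def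
    proof (intro Bochner_Integration.integral_cong refl sum.cong)
      fix s i assume "i \<in> {..<Suc k}"
      then show "indicator {0..t} s * (U (uniform_grid t k i) \<omega> * indicator {uniform_grid t k i<..uniform_grid t k (Suc i)} s)
         = U (uniform_grid t k i) \<omega> * indicator {uniform_grid t k i<..uniform_grid t k (Suc i)} s"
        using cell[of i] by (auto simp: indicator_def)
    qed
    also have "\<dots> = (\<Sum>i<Suc k. \<integral>s. U (uniform_grid t k i) \<omega> * indicator {uniform_grid t k i<..uniform_grid t k (Suc i)} s \<partial>lborel)"
      by (intro Bochner_Integration.integral_sum integrable_mult_right integrable_real_indicator
           emeasure_bounded_finite) (auto intro: bounded_subset[OF bounded_closed_interval])
    also have "\<dots> = ?S k \<omega>"
    proof (intro sum.cong refl)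
      fix i
      have "uniform_grid t k i \<le> uniform_grid t k (Suc i)"
        using uniform_grid_strict[OF t, of k i] by simp
      then show "(\<integral>s. U (uniform_grid t k i) \<omega> * indicator {uniform_grid t k i<..uniform_grid t k (Suc i)} s \<partial>lborel)
          = U (uniform_grid t k i) \<omega> * (t / real (Suc k))"
        by (simp add: uniform_grid_step[of t k i] del: of_nat_Suc)
    qed
    finally show ?thesis by simp
  qed
  have pointwise: "(\<lambda>k. ?S k \<omega>) \<longlonglongrightarrow> ?I \<omega>" if \<omega>: "\<omega> \<in> space M" for \<omega>
    unfolding sum set_lebesgue_integral_def
  proof (rule integral_dominated_convergence[where w = "\<lambda>s. indicator {0..t} s * C"])
    have "(\<lambda>s. ?E k s \<omega>) \<in> borel_measurable borel" for k
      using measurable_compose[OF measurable_Pair2'[OF \<omega>, of borel] E[of k]] by simp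
    then show "(\<lambda>s. indicator {0..t} s *\<^sub>R ?E k s \<omega>) \<in> borel_measurable lborel" for k
      by simp
    show "(\<lambda>s. indicator {0..t} s *\<^sub>R U s \<omega>) \<in> borel_measurable lborel"
      using regular_processD(4)[OF U \<omega>] by simp
    show "AE s in lborel. (\<lambda>k. indicator {0..t} s *\<^sub>R ?E k s \<omega>) \<longlonglongrightarrow> indicator {0..t} s *\<^sub>R U s \<omega>"
      using AE_lborel_singleton[of 0]
    proof eventually_elim
      case (elim s)
      show ?case
      proof (cases "s \<in> {0..t}")
        case True
        then have "(\<lambda>k. ?E k s \<omega>) \<longlonglongrightarrow> U s \<omega>"
          using elim by (intro uniform_grid_elementary_value_tendsto t regular_processD(3)[OF U \<omega>]) auto
        then show ?thesis by (intro tendsto_intros)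
      qed simp
    qed
    show "AE s in lborel. norm (indicator {0..t} s *\<^sub>R ?E k s \<omega>) \<le> indicator {0..t} s * C" for k
      using uniform_grid_elementary_value_bound[OF t, of U \<omega> C k] C(2)[OF \<omega>]
      by (intro AE_I2) (auto simp: indicator_def)
  qed (rule dom)
  have Ib: "\<bar>?I \<omega>\<bar> \<le> C * t" if \<omega>: "\<omega> \<in> space M" for \<omega>
  proof -
    have "\<bar>?I \<omega>\<bar> \<le> (\<integral>s. indicator {0..t} s * C \<partial>lborel)"
      unfolding set_lebesgue_integral_def
    proof (rule abs_integral_le_integral)
      show "integrable lborel (\<lambda>s. indicator {0..t} s *\<^sub>R U s \<omega>)"
        by (rule Bochner_Integration.integrable_bound[OF dom])
          (use C(1) C(2)[OF \<omega>] regular_processD(4)[OF U \<omega>] in \<open>auto simp: indicator_def\<close>)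
    qed (use dom C(2)[OF \<omega>] in \<open>auto simp: indicator_def\<close>)
    then show ?thesis using t by (simp add: ac_simps)
  qed
  have Sb: "\<bar>?S k \<omega>\<bar> \<le> C * t" if \<omega>: "\<omega> \<in> space M" for k \<omega>
  proof -
    have "\<bar>?S k \<omega>\<bar> \<le> (\<Sum>i<Suc k. C * (t / real (Suc k)))"
    proof (rule order_trans[OF sum_abs sum_mono])
      fix i
      show "\<bar>U (uniform_grid t k i) \<omega> * (t / real (Suc k))\<bar> \<le> C * (t / real (Suc k))"
        unfolding abs_mult using C(1) C(2)[OF \<omega>] t by (intro mult_mono) auto
    qed
    then show ?thesis by simp
  qed
  have bound: "(?S k \<omega> - ?I \<omega>)\<^sup>2 \<le> (2 * C * t)\<^sup>2" if \<omega>: "\<omega> \<in> space M" for k \<omega>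
  proof -
    have "\<bar>?S k \<omega> - ?I \<omega>\<bar> \<le> 2 * C * t"
      using Ib[OF \<omega>] Sb[OF \<omega>, of k] by linarith
    then show ?thesis
      by (metis abs_ge_zero power2_abs power_mono)
  qed
  note [measurable] = I
  show "integrable M (\<lambda>\<omega>. (?S k \<omega> - ?I \<omega>)\<^sup>2)"
    by (rule integrable_bounded_real[where C = "(2 * C * t)\<^sup>2"]) (use bound in auto)
  have "(\<lambda>k. \<integral>\<omega>. (?S k \<omega> - ?I \<omega>)\<^sup>2 \<partial>M) \<longlonglongrightarrow> (\<integral>\<omega>. 0 \<partial>M)"
  proof (rule integral_dominated_convergence[where w = "\<lambda>_. (2 * C * t)\<^sup>2"])
    show "AE \<omega> in M. (\<lambda>k. (?S k \<omega> - ?I \<omega>)\<^sup>2) \<longlonglongrightarrow> 0"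
    proof (rule AE_I2)
      fix \<omega> assume "\<omega> \<in> space M"
      then have "(\<lambda>k. (?S k \<omega> - ?I \<omega>)\<^sup>2) \<longlonglongrightarrow> (?I \<omega> - ?I \<omega>)\<^sup>2"
        by (intro tendsto_intros pointwise)
      then show "(\<lambda>k. (?S k \<omega> - ?I \<omega>)\<^sup>2) \<longlonglongrightarrow> 0" by simp
    qed
  qed (use bound in auto)
  then show "(\<lambda>k. \<integral>\<omega>. (?S k \<omega> - ?I \<omega>)\<^sup>2 \<partial>M) \<longlonglongrightarrow> 0" by simp
qed

text \<open>Pythagoras' theorem in \<open>L\<^sup>2\<close>: without orthogonality the second moment of a sum of \<open>n\<close> terms could exceed the
  sum of the second moments by a factor \<open>n\<close>, which would cancel the gain from refining the grid.\<close>

lemma orthogonal_sum_second_moment: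
  fixes a :: "nat \<Rightarrow> 'a \<Rightarrow> real"
  assumes meas[measurable]: "\<And>i. i < n \<Longrightarrow> a i \<in> borel_measurable M"
    and sq: "\<And>i. i < n \<Longrightarrow> integrable M (\<lambda>\<omega>. (a i \<omega>)\<^sup>2)"
    and orth: "\<And>i j. i < j \<Longrightarrow> j < n \<Longrightarrow> (\<integral>\<omega>. a i \<omega> * a j \<omega> \<partial>M) = 0"
  shows "integrable M (\<lambda>\<omega>. (\<Sum>i<n. a i \<omega>)\<^sup>2)"
    and "(\<integral>\<omega>. (\<Sum>i<n. a i \<omega>)\<^sup>2 \<partial>M) = (\<Sum>i<n. \<integral>\<omega>. (a i \<omega>)\<^sup>2 \<partial>M)"
proof -
  have prod: "integrable M (\<lambda>\<omega>. a i \<omega> * a j \<omega>)" if "i < n" "j < n" for i j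
  proof (rule Bochner_Integration.integrable_bound[OF Bochner_Integration.integrable_add[OF sq[OF that(1)] sq[OF that(2)]]])
    have "\<bar>x * y\<bar> \<le> x\<^sup>2 + y\<^sup>2" for x y :: real
    proof -
      have "0 \<le> \<bar>x\<bar> * \<bar>y\<bar>" by simp
      moreover have "2 * (\<bar>x\<bar> * \<bar>y\<bar>) \<le> x\<^sup>2 + y\<^sup>2"
        using sum_squares_bound[of "\<bar>x\<bar>" "\<bar>y\<bar>"] by (simp only: mult.assoc power2_abs)
      ultimately show ?thesis unfolding abs_mult by linarith
    qed
    then show "AE \<omega> in M. norm (a i \<omega> * a j \<omega>) \<le> norm ((a i \<omega>)\<^sup>2 + (a j \<omega>)\<^sup>2)"
      by (intro AE_I2) simp
  qed (use that in measurable)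
  have square: "(\<Sum>i<n. a i \<omega>)\<^sup>2 = (\<Sum>i<n. \<Sum>j<n. a i \<omega> * a j \<omega>)" for \<omega>
    by (simp add: power2_eq_square sum_product)
  show "integrable M (\<lambda>\<omega>. (\<Sum>i<n. a i \<omega>)\<^sup>2)"
    unfolding square by (intro Bochner_Integration.integrable_sum prod) auto
  have "(\<integral>\<omega>. (\<Sum>i<n. a i \<omega>)\<^sup>2 \<partial>M) = (\<Sum>i<n. \<Sum>j<n. \<integral>\<omega>. a i \<omega> * a j \<omega> \<partial>M)"
  proof -
    have "(\<integral>\<omega>. (\<Sum>i<n. a i \<omega>)\<^sup>2 \<partial>M) = (\<Sum>i<n. \<integral>\<omega>. (\<Sum>j<n. a i \<omega> * a j \<omega>) \<partial>M)"
      unfolding square by (intro Bochner_Integration.integral_sum Bochner_Integration.integrable_sum prod) auto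
    also have "\<dots> = (\<Sum>i<n. \<Sum>j<n. \<integral>\<omega>. a i \<omega> * a j \<omega> \<partial>M)"
      by (intro sum.cong refl Bochner_Integration.integral_sum prod) auto
    finally show ?thesis .
  qed
  also have "\<dots> = (\<Sum>i<n. \<Sum>j<n. if i = j then \<integral>\<omega>. (a i \<omega>)\<^sup>2 \<partial>M else 0)"
  proof (intro sum.cong refl)
    fix i j assume "i \<in> {..<n}" "j \<in> {..<n}"
    then show "(\<integral>\<omega>. a i \<omega> * a j \<omega> \<partial>M) = (if i = j then \<integral>\<omega>. (a i \<omega>)\<^sup>2 \<partial>M else 0)"
      using orth[of i j] orth[of j i] by (cases i j rule: linorder_cases) (auto simp: power2_eq_square mult.commute)
  qed
  finally show "(\<integral>\<omega>. (\<Sum>i<n. a i \<omega>)\<^sup>2 \<partial>M) = (\<Sum>i<n. \<integral>\<omega>. (a i \<omega>)\<^sup>2 \<partial>M)"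
    by simp
qed

end

section \<open>Taylor increments and sums of squares\<close>

text \<open>First order in time and second order in space, with the Lipschitz constants of \<open>g0\<close> and \<open>g2\<close> in place of higher
  derivatives. The intermediate point is \<open>g s y'\<close>: time is moved at the new state, then the state at the old
  time.\<close>

lemma taylor_increment_bound:
  fixes g g0 g1 g2 :: "real \<Rightarrow> real \<Rightarrow> real"
  assumes ds: "\<And>s y. ((\<lambda>s. g s y) has_real_derivative g0 s y) (at s)"
    and dy: "\<And>s y. ((\<lambda>y. g s y) has_real_derivative g1 s y) (at y)"
    and dyy: "\<And>s y. ((\<lambda>y. g1 s y) has_real_derivative g2 s y) (at y)"
    and C0: "\<And>s z s' z'. \<bar>g0 s z - g0 s' z'\<bar> \<le> C * (\<bar>s - s'\<bar> + \<bar>z - z'\<bar>)"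
    and C2: "\<And>s z s' z'. \<bar>g2 s z - g2 s' z'\<bar> \<le> C * (\<bar>s - s'\<bar> + \<bar>z - z'\<bar>)"
    and C: "0 \<le> C"
  shows "\<bar>g s' y' - g s y - g0 s y * (s' - s) - g1 s y * (y' - y) - g2 s y / 2 * (y' - y)\<^sup>2\<bar>
    \<le> C * (\<bar>s' - s\<bar>\<^sup>2 + \<bar>s' - s\<bar> * \<bar>y' - y\<bar> + \<bar>y' - y\<bar> ^ 3)"
proof -
  have time: "\<bar>g s' y' - g s y' - g0 s y * (s' - s)\<bar> \<le> C * (\<bar>s' - s\<bar>\<^sup>2 + \<bar>s' - s\<bar> * \<bar>y' - y\<bar>)"
  proof -
    obtain \<sigma> where \<sigma>: "\<bar>\<sigma> - s\<bar> \<le> \<bar>s' - s\<bar>" "g s' y' - g s y' = g0 \<sigma> y' * (s' - s)"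
    proof (cases s s' rule: linorder_cases)
      case less
      then obtain \<sigma> where "s < \<sigma>" "\<sigma> < s'" "g s' y' - g s y' = (s' - s) * g0 \<sigma> y'"
        using MVT2[of s s' "\<lambda>s. g s y'" "\<lambda>s. g0 s y'"] ds by blast
      then show ?thesis by (intro that[of \<sigma>]) auto
    next
      case greater
      then obtain \<sigma> where "s' < \<sigma>" "\<sigma> < s" "g s y' - g s' y' = (s - s') * g0 \<sigma> y'"
        using MVT2[of s' s "\<lambda>s. g s y'" "\<lambda>s. g0 s y'"] ds by blast
      then show ?thesis by (intro that[of \<sigma>]) (auto simp: algebra_simps)
    qed (auto intro: that[of s])
    have "g s' y' - g s y' - g0 s y * (s' - s) = (g0 \<sigma> y' - g0 s y) * (s' - s)"
      by (simp add: \<sigma>(2) algebra_simps)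
    also have "\<bar>\<dots>\<bar> \<le> (C * (\<bar>s' - s\<bar> + \<bar>y' - y\<bar>)) * \<bar>s' - s\<bar>"
    proof -
      have "\<bar>g0 \<sigma> y' - g0 s y\<bar> \<le> C * (\<bar>\<sigma> - s\<bar> + \<bar>y' - y\<bar>)" by (rule C0)
      also have "\<dots> \<le> C * (\<bar>s' - s\<bar> + \<bar>y' - y\<bar>)"
        using \<sigma>(1) C by (intro mult_left_mono) auto
      finally show ?thesis unfolding abs_mult by (rule mult_right_mono) simp
    qed
    finally show ?thesis by (simp add: algebra_simps power2_eq_square)
  qed
  have space: "\<bar>g s y' - g s y - g1 s y * (y' - y) - g2 s y / 2 * (y' - y)\<^sup>2\<bar> \<le> C * \<bar>y' - y\<bar> ^ 3"
  proof (cases "y' = y")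
    case False
    define diff where "diff = (\<lambda>m::nat. if m = 0 then g s else if m = 1 then g1 s else g2 s)"
    have "\<exists>\<theta>. (if y' < y then y' < \<theta> \<and> \<theta> < y else y < \<theta> \<and> \<theta> < y') \<and>
        g s y' = (\<Sum>m<2. diff m y / fact m * (y' - y) ^ m) + diff 2 \<theta> / fact 2 * (y' - y) ^ 2"
      using False dy dyy
      by (intro Taylor[where a = "min y y'" and b = "max y y'" and diff = diff])
        (auto simp: diff_def less_2_cases_iff)
    then obtain \<theta> where between: "if y' < y then y' < \<theta> \<and> \<theta> < y else y < \<theta> \<and> \<theta> < y'"
      and expansion: "g s y' = (\<Sum>m<2. diff m y / fact m * (y' - y) ^ m) + diff 2 \<theta> / fact 2 * (y' - y) ^ 2"
      by blast
    have \<theta>: "\<bar>\<theta> - y\<bar> \<le> \<bar>y' - y\<bar>"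
      "g s y' = g s y + g1 s y * (y' - y) + g2 s \<theta> / 2 * (y' - y)\<^sup>2"
      using between expansion by (auto simp: diff_def numeral_2_eq_2 split: if_splits)
    have "g s y' - g s y - g1 s y * (y' - y) - g2 s y / 2 * (y' - y)\<^sup>2
        = (g2 s \<theta> - g2 s y) / 2 * (y' - y)\<^sup>2"
      by (simp add: \<theta>(2) algebra_simps diff_divide_distrib)
    also have "\<bar>\<dots>\<bar> \<le> (C * \<bar>y' - y\<bar>) * \<bar>y' - y\<bar>\<^sup>2"
    proof -
      have "\<bar>g2 s \<theta> - g2 s y\<bar> \<le> C * (\<bar>s - s\<bar> + \<bar>\<theta> - y\<bar>)" by (rule C2)
      also have "\<dots> \<le> C * \<bar>y' - y\<bar>"
        using \<theta>(1) C by (simp add: mult_left_mono)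
      finally have "\<bar>(g2 s \<theta> - g2 s y) / 2\<bar> \<le> C * \<bar>y' - y\<bar>" by simp
      then show ?thesis unfolding abs_mult power_abs by (rule mult_right_mono) simp
    qed
    finally show ?thesis by (simp add: power3_eq_cube power2_eq_square)
  qed simp
  have "g s' y' - g s y - g0 s y * (s' - s) - g1 s y * (y' - y) - g2 s y / 2 * (y' - y)\<^sup>2
    = (g s' y' - g s y' - g0 s y * (s' - s)) + (g s y' - g s y - g1 s y * (y' - y) - g2 s y / 2 * (y' - y)\<^sup>2)"
    by simp
  also have "\<bar>\<dots>\<bar> \<le> C * (\<bar>s' - s\<bar>\<^sup>2 + \<bar>s' - s\<bar> * \<bar>y' - y\<bar>) + C * \<bar>y' - y\<bar> ^ 3"
    by (rule order_trans[OF abs_triangle_ineq add_mono[OF time space]])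
  finally show ?thesis by (simp add: algebra_simps)
qed

lemma cube_sum_le: "(a + b) ^ 3 \<le> 4 * (a ^ 3 + b ^ 3)" if "0 \<le> a" "0 \<le> b" for a b :: real
proof -
  have "4 * (a ^ 3 + b ^ 3) - (a + b) ^ 3 = 3 * (a + b) * (a - b)\<^sup>2"
    by (simp add: power3_eq_cube power2_eq_square algebra_simps)
  moreover have "0 \<le> 3 * (a + b) * (a - b)\<^sup>2" using that by simp
  ultimately show ?thesis by linarith
qed

lemma sum_squared_le: "(\<Sum>i<n. a i)\<^sup>2 \<le> real n * (\<Sum>i<n. (a i)\<^sup>2)" for a :: "nat \<Rightarrow> real"
  using Cauchy_Schwarz_ineq_sum[of "\<lambda>_. 1" a "{..<n}"] by simp

lemma sum3_squared_le: "(a + b + c)\<^sup>2 \<le> 3 * (a\<^sup>2 + b\<^sup>2 + c\<^sup>2)" for a b c :: real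
proof -
  have "3 * (a\<^sup>2 + b\<^sup>2 + c\<^sup>2) - (a + b + c)\<^sup>2 = (a - b)\<^sup>2 + (b - c)\<^sup>2 + (a - c)\<^sup>2"
    by (simp add: power2_eq_square algebra_simps)
  moreover have "0 \<le> (a - b)\<^sup>2 + (b - c)\<^sup>2 + (a - c)\<^sup>2" by simp
  ultimately show ?thesis by linarith
qed

section \<open>A Wiener process with an independent random drift\<close>

text \<open>The observation increment \<open>\<eta> t + W\<^sub>t\<close>, abstracted from the signal: only the real random variable \<open>\<eta>\<close>, which is
  known at time \<open>0\<close>, enters.\<close>

locale drifted_wiener = prob_space M for M :: "'w measure" +
  fixes W :: "real \<Rightarrow> 'w \<Rightarrow> real" and \<eta> :: "'w \<Rightarrow> real" and K :: real
    and F :: "real \<Rightarrow> 'w measure"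
  assumes wiener: "standard_wiener M W"
    and \<eta>_measurable[measurable]: "\<eta> \<in> borel_measurable M"
    and \<eta>_bound: "\<And>\<omega>. \<omega> \<in> space M \<Longrightarrow> \<bar>\<eta> \<omega>\<bar> \<le> K"
    and \<eta>_indep: "indep_set {\<eta> -` A \<inter> space M | A. A \<in> sets borel}
       (sigma_sets (space M) {W t -` A \<inter> space M | t A. 0 \<le> t \<and> A \<in> sets borel})"
    and space_F: "\<And>t. space (F t) = space M"
    and \<eta>_adapted: "\<And>t. 0 \<le> t \<Longrightarrow> \<eta> \<in> borel_measurable (F t)"
    and W_adapted: "\<And>s t. 0 \<le> s \<Longrightarrow> s \<le> t \<Longrightarrow> W s \<in> borel_measurable (F t)"
begin

lemma W_measurable: "0 \<le> t \<Longrightarrow> W t \<in> borel_measurable M"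
  using wiener by (simp add: standard_wiener_def)

lemma W_0: "\<omega> \<in> space M \<Longrightarrow> W 0 \<omega> = 0"
  using wiener by (simp add: standard_wiener_def)

lemma W_continuous:
  assumes "\<omega> \<in> space M"
  shows "continuous_on UNIV (\<lambda>t. W (max 0 t) \<omega>)"
proof (rule continuous_on_compose2[of "{0..}" "\<lambda>t. W t \<omega>" UNIV "\<lambda>t. max 0 t"])
  show "continuous_on {0..} (\<lambda>t. W t \<omega>)"
    using wiener assms by (simp add: standard_wiener_def)
  show "continuous_on UNIV (\<lambda>t::real. max 0 t)"
    by (intro continuous_intros)
qed auto

text \<open>The path at time \<open>s\<close> is the limit of its values at the times \<open>\<lfloor>s k\<rfloor> / k\<close>, of which there are countably many; the
  truncation by \<open>nat\<close> produces the extension by \<open>W\<^sub>0\<close> to negative times.\<close>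

lemma W_jointly_measurable: "(\<lambda>(s, \<omega>). W (max 0 s) \<omega>) \<in> borel_measurable (borel \<Otimes>\<^sub>M M)"
proof (rule borel_measurable_LIMSEQ_real)
  let ?a = "\<lambda>k s. real (nat \<lfloor>s * real (Suc k)\<rfloor>) / real (Suc k)"
  show "(\<lambda>p. W (?a k (fst p)) (snd p)) \<in> borel_measurable (borel \<Otimes>\<^sub>M M)" for k
  proof (rule measurable_compose_countable[where f = "\<lambda>n p. W (real n / real (Suc k)) (snd p)"])
    show "(\<lambda>p. W (real n / real (Suc k)) (snd p)) \<in> borel_measurable (borel \<Otimes>\<^sub>M M)" for n
      by (intro measurable_compose[OF measurable_snd] W_measurable) auto
  qed measurable
  fix p assume "p \<in> space (borel \<Otimes>\<^sub>M M :: (real \<times> 'w) measure)"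
  then have \<omega>: "snd p \<in> space M" by (auto simp: space_pair_measure)
  have "(\<lambda>k. ?a k (fst p)) \<longlonglongrightarrow> max 0 (fst p)"
  proof (rule LIM_zero_cancel, rule Lim_null_comparison)
    show "\<forall>\<^sub>F k in sequentially. norm (?a k (fst p) - max 0 (fst p)) \<le> 1 / real (Suc k)"
    proof (rule always_eventually, rule allI)
      fix k
      let ?x = "fst p * real (Suc k)"
      have "\<bar>real (nat \<lfloor>?x\<rfloor>) - max 0 ?x\<bar> \<le> 1"
        by linarith
      moreover have "max 0 ?x = max 0 (fst p) * real (Suc k)"
        by (simp add: max_def mult_less_0_iff not_le zero_le_mult_iff)
      ultimately have "\<bar>real (nat \<lfloor>?x\<rfloor>) - max 0 (fst p) * real (Suc k)\<bar> / real (Suc k) \<le> 1 / real (Suc k)"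
        by (intro divide_right_mono) auto
      moreover have "?a k (fst p) - max 0 (fst p)
          = (real (nat \<lfloor>?x\<rfloor>) - max 0 (fst p) * real (Suc k)) / real (Suc k)"
        by (simp add: diff_divide_distrib del: of_nat_Suc)
      ultimately show "norm (?a k (fst p) - max 0 (fst p)) \<le> 1 / real (Suc k)"
        by (simp add: abs_divide del: of_nat_Suc)
    qed
    show "(\<lambda>k. 1 / real (Suc k)) \<longlonglongrightarrow> 0"
      by (rule LIMSEQ_Suc[OF lim_const_over_n])
  qed
  then have "(\<lambda>k. W (max 0 (?a k (fst p))) (snd p)) \<longlonglongrightarrow> W (max 0 (max 0 (fst p))) (snd p)"
    by (rule continuous_on_tendsto_compose[OF W_continuous[OF \<omega>]]) auto
  then show "(\<lambda>k. W (?a k (fst p)) (snd p)) \<longlonglongrightarrow> (case p of (s, \<omega>) \<Rightarrow> W (max 0 s) \<omega>)"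
    by (simp add: split_beta' max_absorb2)
qed

text \<open>Freezing \<open>W\<close> before time \<open>0\<close> makes the paths continuous on the whole line.\<close>

definition Y :: "real \<Rightarrow> 'w \<Rightarrow> real" where
  "Y s \<omega> = \<eta> \<omega> * s + W (max 0 s) \<omega>"

lemma Y_0: "\<omega> \<in> space M \<Longrightarrow> Y 0 \<omega> = 0"
  by (simp add: Y_def W_0)

lemma Y_measurable: "Y s \<in> borel_measurable M"
  unfolding Y_def[abs_def] using W_measurable[of "max 0 s"] by simp

lemma regular_process_along_Y:
  assumes "bounded_lipschitz u"
  shows "regular_process M (\<lambda>s \<omega>. u s (Y s \<omega>))"
  unfolding regular_process_def
proof (intro conjI ballI)
  have u: "(\<lambda>p. u (fst p) (snd p)) \<in> borel_measurable (borel \<Otimes>\<^sub>M borel)"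
    unfolding borel_prod by (rule borel_measurable_continuous_onI[OF bounded_lipschitz_continuous[OF assms]])
  have "(\<lambda>p. (fst p, \<eta> (snd p) * fst p + W (max 0 (fst p)) (snd p))) \<in> borel \<Otimes>\<^sub>M M \<rightarrow>\<^sub>M borel \<Otimes>\<^sub>M borel"
    using W_jointly_measurable unfolding split_beta'
    by (intro measurable_Pair borel_measurable_add borel_measurable_times
        measurable_compose[OF measurable_snd \<eta>_measurable] measurable_fst)
  from measurable_compose[OF this u]
  show "(\<lambda>(s, \<omega>). u s (Y s \<omega>)) \<in> borel_measurable (borel \<Otimes>\<^sub>M M)"
    by (simp add: split_beta' Y_def)
  show "continuous_on UNIV (\<lambda>s. u s (Y s \<omega>))" if "\<omega> \<in> space M" for \<omega>
    unfolding Y_def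
  proof -
    have "continuous_on UNIV (\<lambda>s. (s, \<eta> \<omega> * s + W (max 0 s) \<omega>))"
      by (intro continuous_intros W_continuous[OF that])
    from continuous_on_compose2[OF bounded_lipschitz_continuous[OF assms] this]
    show "continuous_on UNIV (\<lambda>s. u s (\<eta> \<omega> * s + W (max 0 s) \<omega>))"
      by simp
  qed
  show "\<exists>C. \<forall>s. \<forall>\<omega>\<in>space M. \<bar>u s (Y s \<omega>)\<bar> \<le> C"
    using assms unfolding bounded_lipschitz_def by blast
qed

lemma Y_adapted:
  assumes "bounded_lipschitz u" "0 \<le> s" "s \<le> t"
  shows "(\<lambda>\<omega>. u s (Y s \<omega>)) \<in> borel_measurable (F t)"
proof -
  have "u s \<in> borel_measurable borel"
    by (rule bounded_lipschitz_section_measurable[OF assms(1)])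
  moreover have "(\<lambda>\<omega>. \<eta> \<omega> * s + W (max 0 s) \<omega>) \<in> borel_measurable (F t)"
    using \<eta>_adapted[of t] W_adapted[of "max 0 s" t] assms
    by (intro borel_measurable_add borel_measurable_times) auto
  ultimately show ?thesis
    unfolding Y_def by (rule measurable_compose[rotated])
qed

lemma increment_moments:
  assumes st: "0 \<le> s" "s < t"
  shows "integrable M (\<lambda>\<omega>. (W t \<omega> - W s \<omega>) ^ (2 * k))"
    and "(\<integral>\<omega>. (W t \<omega> - W s \<omega>) ^ (2 * k) \<partial>M) = fact (2 * k) / (2 ^ k * fact k) * (t - s) ^ k"
proof -
  have \<sigma>: "0 < sqrt (t - s)" using st by simp
  have D: "distributed M lborel (\<lambda>\<omega>. W t \<omega> - W s \<omega>) (normal_density 0 (sqrt (t - s)))"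
    using wiener st by (simp add: standard_wiener_def)
  have "integrable lborel (\<lambda>x. normal_density 0 (sqrt (t - s)) x * x ^ (2 * k))"
    using integrable_normal_moment[OF \<sigma>, of 0 "2 * k"] by simp
  then show "integrable M (\<lambda>\<omega>. (W t \<omega> - W s \<omega>) ^ (2 * k))"
    using distributed_integrable[OF D, of "\<lambda>x. x ^ (2 * k)"] by simp
  have "(\<integral>\<omega>. (W t \<omega> - W s \<omega>) ^ (2 * k) \<partial>M)
      = (\<integral>x. normal_density 0 (sqrt (t - s)) x * x ^ (2 * k) \<partial>lborel)"
    using distributed_integral[OF D, of "\<lambda>x. x ^ (2 * k)"] by simp
  also have "\<dots> = fact (2 * k) / ((2 / (sqrt (t - s))\<^sup>2) ^ k * fact k)"
    using integral_normal_moment_even[OF \<sigma>, of 0 k] by simp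
  also have "(sqrt (t - s))\<^sup>2 = t - s" using st by simp
  also have "fact (2 * k) / ((2 / (t - s)) ^ k * fact k) = fact (2 * k) / (2 ^ k * fact k) * (t - s) ^ k"
    by (simp add: power_divide)
  finally show "(\<integral>\<omega>. (W t \<omega> - W s \<omega>) ^ (2 * k) \<partial>M) = fact (2 * k) / (2 ^ k * fact k) * (t - s) ^ k" .
qed

lemma increment_second_fourth_sixth_moment:
  assumes "0 \<le> s" "s < t"
  shows "(\<integral>\<omega>. (W t \<omega> - W s \<omega>) ^ 2 \<partial>M) = t - s"
    and "(\<integral>\<omega>. (W t \<omega> - W s \<omega>) ^ 4 \<partial>M) = 3 * (t - s)\<^sup>2"
    and "(\<integral>\<omega>. (W t \<omega> - W s \<omega>) ^ 6 \<partial>M) = 15 * (t - s) ^ 3"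
    and "integrable M (\<lambda>\<omega>. (W t \<omega> - W s \<omega>) ^ 2)"
    and "integrable M (\<lambda>\<omega>. (W t \<omega> - W s \<omega>) ^ 4)"
    and "integrable M (\<lambda>\<omega>. (W t \<omega> - W s \<omega>) ^ 6)"
  using increment_moments[OF assms, of 1] increment_moments[OF assms, of 2] increment_moments[OF assms, of 3]
  by (simp_all add: fact_numeral)

text \<open>The drift and the Wiener increments as one sequence: everything observed up to \<open>\<tau> j\<close> is a function of the
  first \<open>j + 1\<close> members.\<close>

definition noise :: "(nat \<Rightarrow> real) \<Rightarrow> nat \<Rightarrow> 'w \<Rightarrow> real" where
  "noise \<tau> i = (case i of 0 \<Rightarrow> \<eta> | Suc j \<Rightarrow> (\<lambda>\<omega>. W (\<tau> (Suc j)) \<omega> - W (\<tau> j) \<omega>))"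

lemma noise_simps[simp]:
  "noise \<tau> 0 = \<eta>" "noise \<tau> (Suc j) = (\<lambda>\<omega>. W (\<tau> (Suc j)) \<omega> - W (\<tau> j) \<omega>)"
  by (simp_all add: noise_def)

text \<open>The increments are independent among themselves, and the drift is independent of the \<open>\<sigma>\<close>-algebra that they
  generate, so its probability splits off as one factor.\<close>

lemma indep_noise:
  assumes \<tau>: "0 \<le> \<tau> 0" "\<And>i. i < n \<Longrightarrow> \<tau> i < \<tau> (Suc i)"
  shows "indep_vars (\<lambda>_. borel) (noise \<tau>) {..n}"
proof -
  have \<tau>_nonneg: "0 \<le> \<tau> i" if "i \<le> n" for i
    using that
  proof (induction i)
    case (Suc i)
    then show ?case using \<tau>(2)[of i] by auto
  qed (rule \<tau>(1))
  let ?D = "\<lambda>i \<omega>. W (\<tau> (Suc i)) \<omega> - W (\<tau> i) \<omega>"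
  let ?G = "sigma (space M) {W t -` A \<inter> space M | t A. 0 \<le> t \<and> A \<in> sets borel}"
  have G_pow: "{W t -` A \<inter> space M | t A. 0 \<le> t \<and> A \<in> sets borel} \<subseteq> Pow (space M)" by auto
  have D_G: "?D i -` A \<inter> space M \<in> sets ?G" if i: "i < n" and A: "A \<in> sets borel" for i A
  proof -
    have W_G: "W t \<in> borel_measurable ?G" if "0 \<le> t" for t
      using that G_pow by (intro measurableI) (auto simp: space_measure_of_conv sets_measure_of)
    have "?D i \<in> borel_measurable ?G"
      using i by (intro borel_measurable_diff W_G \<tau>_nonneg) auto
    from measurable_sets[OF this A] show ?thesis by (simp add: space_measure_of_conv)
  qed
  have indD: "indep_vars (\<lambda>_. borel) ?D {..<n}"
    using wiener \<tau> unfolding standard_wiener_def by blast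
  have rv: "random_variable borel (noise \<tau> i)" if "i \<le> n" for i
    using that by (cases i) (auto intro!: borel_measurable_diff W_measurable \<tau>_nonneg)
  have sets: "indep_sets (\<lambda>i. {noise \<tau> i -` A \<inter> space M |A. A \<in> sets borel}) {..n}"
  proof (rule indep_setsI)
    show "{noise \<tau> i -` A \<inter> space M |A. A \<in> sets borel} \<subseteq> events" if "i \<in> {..n}" for i
      using measurable_sets[OF rv] that by auto
    fix A J assume J: "J \<noteq> {}" "J \<subseteq> {..n}" "finite J"
      and A: "\<forall>j\<in>J. A j \<in> {noise \<tau> j -` A \<inter> space M |A. A \<in> sets borel}"
    define I where "I = {j. Suc j \<in> J}"
    have "I = Suc -` J" by (auto simp: I_def)
    then have fin: "finite I"
      using finite_vimageI[OF J(3) inj_Suc] by simp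
    have sub: "I \<subseteq> {..<n}" using J(2) unfolding I_def by auto
    have image: "Suc ` I = J - {0}"
    proof (intro equalityI subsetI)
      fix j assume "j \<in> J - {0}"
      then show "j \<in> Suc ` I" by (cases j) (auto simp: I_def)
    qed (auto simp: I_def)
    note I = sub fin image
    have pos: "prob (\<Inter>j\<in>I. A (Suc j)) = (\<Prod>j\<in>I. prob (A (Suc j)))" if "I \<noteq> {}"
    proof (rule indep_setsD[of "\<lambda>i. {?D i -` A \<inter> space M |A. A \<in> sets borel}" "{..<n}"])
      show "indep_sets (\<lambda>i. {?D i -` A \<inter> space M |A. A \<in> sets borel}) {..<n}"
        using indD unfolding indep_vars_def2 by simp
      show "\<forall>j\<in>I. A (Suc j) \<in> {?D j -` A \<inter> space M |A. A \<in> sets borel}"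
        using A unfolding I_def by fastforce
    qed (use I that in auto)
    have pos': "prob (\<Inter>j\<in>J - {0}. A j) = (\<Prod>j\<in>J - {0}. prob (A j))" if "J - {0} \<noteq> {}"
      using pos that unfolding I(3)[symmetric] by (simp add: prod.reindex)
    show "prob (\<Inter>j\<in>J. A j) = (\<Prod>j\<in>J. prob (A j))"
    proof (cases "0 \<in> J")
      case False
      then show ?thesis using pos' J(1) by simp
    next
      case True
      show ?thesis
      proof (cases "J = {0}")
        case False
        then have ne: "J - {0} \<noteq> {}" using True by auto
        have "(\<Inter>j\<in>J - {0}. A j) \<in> sets ?G"
        proof (rule sets.finite_INT[OF _ ne])
          fix j assume j: "j \<in> J - {0}"
          then obtain i where i: "j = Suc i" by (cases j) auto
          obtain B where "A j = noise \<tau> j -` B \<inter> space M" "B \<in> sets borel"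
            using A j by blast
          moreover have "i < n" using J(2) j i by auto
          ultimately show "A j \<in> sets ?G"
            using D_G[of i B] by (simp add: i)
        qed (use J in auto)
        then have "prob (A 0 \<inter> (\<Inter>j\<in>J - {0}. A j)) = prob (A 0) * prob (\<Inter>j\<in>J - {0}. A j)"
          using bspec[OF A True] G_pow by (intro indep_setD[OF \<eta>_indep]) (simp_all add: sets_measure_of)
        moreover have "(\<Inter>j\<in>J. A j) = A 0 \<inter> (\<Inter>j\<in>J - {0}. A j)"
          using True by auto
        moreover have "(\<Prod>j\<in>J. prob (A j)) = prob (A 0) * (\<Prod>j\<in>J - {0}. prob (A j))"
          using J True by (simp add: prod.remove)
        ultimately show ?thesis using pos'[OF ne] by simp
      qed simp
    qed
  qed
  show ?thesis
    unfolding indep_vars_def2 using rv sets by auto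
qed

lemma W_eq_sum_noise:
  assumes "\<tau> 0 = 0" "\<omega> \<in> space M"
  shows "W (\<tau> i) \<omega> = (\<Sum>l<i. noise \<tau> (Suc l) \<omega>)"
  using sum_lessThan_telescope[of "\<lambda>l. W (\<tau> l) \<omega>" i] W_0[OF assms(2)] assms(1) by simp

text \<open>One summand of the difference between the weighted quadratic variation of \<open>W\<close> along a grid and the
  corresponding Riemann sum.\<close>

definition quadratic_fluctuation ::
  "(real \<Rightarrow> real \<Rightarrow> real) \<Rightarrow> (nat \<Rightarrow> real) \<Rightarrow> nat \<Rightarrow> 'w \<Rightarrow> real" where
  "quadratic_fluctuation u \<tau> i \<omega> =
     u (\<tau> i) (Y (\<tau> i) \<omega>) * ((W (\<tau> (Suc i)) \<omega> - W (\<tau> i) \<omega>)\<^sup>2 - (\<tau> (Suc i) - \<tau> i))"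

lemma quadratic_fluctuation_measurable:
  assumes u: "bounded_lipschitz u" and \<tau>: "0 \<le> \<tau> i" "\<tau> i < \<tau> (Suc i)"
  shows "quadratic_fluctuation u \<tau> i \<in> borel_measurable M"
proof -
  have [measurable]: "(\<lambda>\<omega>. u (\<tau> i) (Y (\<tau> i) \<omega>)) \<in> borel_measurable M"
    by (rule measurable_compose[OF Y_measurable bounded_lipschitz_section_measurable[OF u]])
  have [measurable]: "W (\<tau> i) \<in> borel_measurable M" "W (\<tau> (Suc i)) \<in> borel_measurable M"
    using \<tau> by (auto intro: W_measurable)
  show ?thesis
    unfolding quadratic_fluctuation_def[abs_def] by measurable
qed

lemma quadratic_fluctuation_second_moment:
  assumes u: "bounded_lipschitz u" and C: "\<And>s z. \<bar>u s z\<bar> \<le> C"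
    and \<tau>: "0 \<le> \<tau> i" "\<tau> i < \<tau> (Suc i)"
  shows "integrable M (\<lambda>\<omega>. (quadratic_fluctuation u \<tau> i \<omega>)\<^sup>2)"
    and "(\<integral>\<omega>. (quadratic_fluctuation u \<tau> i \<omega>)\<^sup>2 \<partial>M) \<le> 4 * C\<^sup>2 * (\<tau> (Suc i) - \<tau> i)\<^sup>2"
proof -
  let ?D = "\<lambda>\<omega>. W (\<tau> (Suc i)) \<omega> - W (\<tau> i) \<omega>" and ?d = "\<tau> (Suc i) - \<tau> i"
  note mom = increment_second_fourth_sixth_moment[OF \<tau>]
  have dom: "integrable M (\<lambda>\<omega>. C\<^sup>2 * (?D \<omega> ^ 4 + ?d\<^sup>2))"
    using mom(5) by (intro integrable_mult_right Bochner_Integration.integrable_add) auto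
  have bound: "(quadratic_fluctuation u \<tau> i \<omega>)\<^sup>2 \<le> C\<^sup>2 * (?D \<omega> ^ 4 + ?d\<^sup>2)" for \<omega>
  proof -
    have "(u (\<tau> i) (Y (\<tau> i) \<omega>))\<^sup>2 \<le> C\<^sup>2"
      using C by (metis abs_ge_zero power2_abs power_mono)
    moreover have "((?D \<omega>)\<^sup>2 - ?d)\<^sup>2 \<le> ?D \<omega> ^ 4 + ?d\<^sup>2"
    proof -
      have "((?D \<omega>)\<^sup>2 - ?d)\<^sup>2 = ?D \<omega> ^ 4 + ?d\<^sup>2 - 2 * ((?D \<omega>)\<^sup>2 * ?d)"
        unfolding power2_diff[of "(?D \<omega>)\<^sup>2" ?d] by (simp add: power_mult[symmetric] mult.assoc)
      moreover have "0 \<le> (?D \<omega>)\<^sup>2 * ?d" using \<tau> by simp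
      ultimately show ?thesis by linarith
    qed
    ultimately show ?thesis
      unfolding quadratic_fluctuation_def power_mult_distrib by (intro mult_mono) auto
  qed
  show int: "integrable M (\<lambda>\<omega>. (quadratic_fluctuation u \<tau> i \<omega>)\<^sup>2)"
    by (rule Bochner_Integration.integrable_bound[OF dom])
      (use bound quadratic_fluctuation_measurable[of u \<tau> i, OF u \<tau>] in \<open>auto intro: order_trans[OF _ abs_ge_self]\<close>)
  have "(\<integral>\<omega>. (quadratic_fluctuation u \<tau> i \<omega>)\<^sup>2 \<partial>M) \<le> (\<integral>\<omega>. C\<^sup>2 * (?D \<omega> ^ 4 + ?d\<^sup>2) \<partial>M)"
    by (intro integral_mono int dom bound)
  also have "\<dots> = C\<^sup>2 * (3 * ?d\<^sup>2 + ?d\<^sup>2)"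
    using mom(2,5) by (simp add: prob_space)
  finally show "(\<integral>\<omega>. (quadratic_fluctuation u \<tau> i \<omega>)\<^sup>2 \<partial>M) \<le> 4 * C\<^sup>2 * (\<tau> (Suc i) - \<tau> i)\<^sup>2"
    by simp
qed

text \<open>For \<open>i < j\<close> the product is a function of \<open>noise \<tau> 0, \<dots>, noise \<tau> j\<close> times the factor
  \<open>(noise \<tau> (j + 1))\<^sup>2 - (\<tau> (j + 1) - \<tau> j)\<close>, which is independent of the former and has mean zero.\<close>

lemma quadratic_fluctuation_orthogonal:
  assumes u: "bounded_lipschitz u" and \<tau>: "\<tau> 0 = 0" "\<And>i. \<tau> i < \<tau> (Suc i)" and ij: "i < j"
  shows "(\<integral>\<omega>. quadratic_fluctuation u \<tau> i \<omega> * quadratic_fluctuation u \<tau> j \<omega> \<partial>M) = 0"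
proof -
  define P where "P i v = u (\<tau> i) (v 0 * \<tau> i + (\<Sum>l<i. v (Suc l)))" for i and v :: "nat \<Rightarrow> real"
  define Q where "Q i v = (v (Suc i))\<^sup>2 - (\<tau> (Suc i) - \<tau> i)" for i and v :: "nat \<Rightarrow> real"
  \<comment> \<open>all factors except the \<open>j\<close>-th centered square, which alone involves the last increment\<close>
  define past where "past v = P i v * P j v * Q i v" for v
  let ?N = "\<lambda>\<omega> l. noise \<tau> l \<omega>"
  have nonneg: "0 \<le> \<tau> l" for l
  proof (induction l)
    case (Suc l)
    then show ?case using \<tau>(2)[of l] by simp
  qed (simp add: \<tau>)
  have fluct: "quadratic_fluctuation u \<tau> l \<omega> = P l (?N \<omega>) * Q l (?N \<omega>)" if "\<omega> \<in> space M" for l \<omega>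
    using W_eq_sum_noise[of \<tau>, OF \<tau>(1) that, of l] nonneg[of l]
    by (simp add: quadratic_fluctuation_def P_def Q_def Y_def max_absorb2)
  have comp: "(\<lambda>v. v l) \<in> borel_measurable (PiM A (\<lambda>_. borel :: real measure))" if "l \<in> A" for l A
    using that by (rule measurable_component_singleton)
  have P_meas: "P l \<in> borel_measurable (PiM {..j} (\<lambda>_. borel))" if "l \<le> j" for l
    unfolding P_def using that
    by (intro measurable_compose[OF _ bounded_lipschitz_section_measurable[OF u]] borel_measurable_add
        borel_measurable_times borel_measurable_sum comp) auto
  have Q_meas: "Q l \<in> borel_measurable (PiM A (\<lambda>_. borel))" if "Suc l \<in> A" for l A
    unfolding Q_def using that by (intro borel_measurable_diff borel_measurable_power comp) auto
  have past_meas: "past \<in> borel_measurable (PiM {..j} (\<lambda>_. borel))"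
    unfolding past_def using ij by (intro borel_measurable_times P_meas Q_meas) auto
  have "indep_vars (\<lambda>_. borel) (noise \<tau>) {..Suc j}"
    by (rule indep_noise) (use \<tau> in auto)
  then have "indep_var (PiM {..j} (\<lambda>_. borel)) (\<lambda>\<omega>. restrict (?N \<omega>) {..j})
      (PiM {Suc j} (\<lambda>_. borel)) (\<lambda>\<omega>. restrict (?N \<omega>) {Suc j})"
    by (rule indep_var_restrict) auto
  from indep_var_compose[OF this past_meas Q_meas[of j]]
  have "indep_var borel (\<lambda>\<omega>. past (restrict (?N \<omega>) {..j})) borel (\<lambda>\<omega>. Q j (restrict (?N \<omega>) {Suc j}))"
    by (simp add: comp_def)
  moreover have "past (restrict (?N \<omega>) {..j}) = past (?N \<omega>)" for \<omega>
    using ij by (simp add: past_def P_def Q_def)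
  moreover have "Q j (restrict (?N \<omega>) {Suc j}) = Q j (?N \<omega>)" for \<omega>
    by (simp add: Q_def)
  ultimately have indep: "indep_var borel (\<lambda>\<omega>. past (?N \<omega>)) borel (\<lambda>\<omega>. Q j (?N \<omega>))"
    by simp
  have Q_int: "integrable M (\<lambda>\<omega>. Q l (?N \<omega>))" for l
    unfolding Q_def
    using increment_second_fourth_sixth_moment(4)[OF nonneg \<tau>(2), of l] by simp
  obtain C where C: "\<And>s z. \<bar>u s z\<bar> \<le> C"
    using bounded_lipschitzE[OF u] by metis
  have past_int: "integrable M (\<lambda>\<omega>. past (?N \<omega>))"
  proof (rule Bochner_Integration.integrable_bound[OF integrable_mult_right[OF Q_int, of "C * C" i]])
    have "random_variable borel (\<lambda>\<omega>. past (?N \<omega>))"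
      using indep unfolding indep_var_eq by simp
    then show "(\<lambda>\<omega>. past (?N \<omega>)) \<in> borel_measurable M" .
    have "0 \<le> C" using C[of 0 0] by linarith
    then have "\<bar>P i v * P j v\<bar> \<le> C * C" for v
      unfolding abs_mult P_def by (intro mult_mono C) auto
    then have "\<bar>past v\<bar> \<le> \<bar>C * C * Q i v\<bar>" for v
      unfolding past_def abs_mult[of _ "Q i v"] by (intro mult_right_mono) (auto intro: order_trans[OF _ abs_ge_self])
    then show "AE \<omega> in M. norm (past (?N \<omega>)) \<le> norm (C * C * Q i (?N \<omega>))"
      by simp
  qed
  have Q_zero: "(\<integral>\<omega>. Q j (?N \<omega>) \<partial>M) = 0"
    unfolding Q_def
    using increment_second_fourth_sixth_moment(1,4)[OF nonneg \<tau>(2), of j] by (simp add: prob_space)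
  have "(\<integral>\<omega>. quadratic_fluctuation u \<tau> i \<omega> * quadratic_fluctuation u \<tau> j \<omega> \<partial>M)
      = (\<integral>\<omega>. past (?N \<omega>) * Q j (?N \<omega>) \<partial>M)"
    by (intro Bochner_Integration.integral_cong) (auto simp: fluct past_def)
  also have "\<dots> = (\<integral>\<omega>. past (?N \<omega>) \<partial>M) * (\<integral>\<omega>. Q j (?N \<omega>) \<partial>M)"
    by (rule indep_var_lebesgue_integral[OF indep past_int Q_int])
  finally show ?thesis by (simp add: Q_zero)
qed

text \<open>There are \<open>n\<close> orthogonal terms, each with a second moment of order \<open>n\<^sup>-\<^sup>2\<close>.\<close>

lemma quadratic_variation_converges:
  assumes u: "bounded_lipschitz u" and t: "0 < t"
  shows "integrable M (\<lambda>\<omega>. (\<Sum>i<Suc k. quadratic_fluctuation u (uniform_grid t k) i \<omega>)\<^sup>2)"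
    and "(\<lambda>k. \<integral>\<omega>. (\<Sum>i<Suc k. quadratic_fluctuation u (uniform_grid t k) i \<omega>)\<^sup>2 \<partial>M) \<longlonglongrightarrow> 0"
proof -
  let ?q = "\<lambda>k. quadratic_fluctuation u (uniform_grid t k)"
  obtain C where C: "\<And>s z. \<bar>u s z\<bar> \<le> C"
    using bounded_lipschitzE[OF u] by metis
  have grid: "0 \<le> uniform_grid t k i" "uniform_grid t k i < uniform_grid t k (Suc i)" for k i
    using uniform_grid_nonneg[of t k i] uniform_grid_strict[OF t, of k i] t by auto
  note mom = quadratic_fluctuation_second_moment[of u C "uniform_grid t k" i for k i, OF u C grid]
  have meas: "?q k i \<in> borel_measurable M" for k i
    by (rule quadratic_fluctuation_measurable[of u "uniform_grid t k" i, OF u grid])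
  have orth: "(\<integral>\<omega>. ?q k i \<omega> * ?q k j \<omega> \<partial>M) = 0" if "i < j" for k i j
    by (rule quadratic_fluctuation_orthogonal[OF u _ _ that]) (use grid in auto)
  note sum = orthogonal_sum_second_moment[of "Suc k" "?q k" for k, OF meas mom(1) orth]
  show "integrable M (\<lambda>\<omega>. (\<Sum>i<Suc k. ?q k i \<omega>)\<^sup>2)"
    by (rule sum(1)) 
  have bound: "(\<integral>\<omega>. (\<Sum>i<Suc k. ?q k i \<omega>)\<^sup>2 \<partial>M) \<le> 4 * C\<^sup>2 * t\<^sup>2 / real (Suc k)" for k
  proof -
    have "(\<integral>\<omega>. (\<Sum>i<Suc k. ?q k i \<omega>)\<^sup>2 \<partial>M) = (\<Sum>i<Suc k. \<integral>\<omega>. (?q k i \<omega>)\<^sup>2 \<partial>M)"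
      by (rule sum(2))
    also have "\<dots> \<le> (\<Sum>i<Suc k. 4 * C\<^sup>2 * (t / real (Suc k))\<^sup>2)"
      using mom(2) unfolding uniform_grid_step by (intro sum_mono) auto
    also have "\<dots> = real (Suc k) * (4 * C\<^sup>2 * (t / real (Suc k))\<^sup>2)"
      by simp
    also have "\<dots> = 4 * C\<^sup>2 * t\<^sup>2 / real (Suc k)"
      by (simp add: power2_eq_square del: of_nat_Suc)
    finally show ?thesis .
  qed
  show "(\<lambda>k. \<integral>\<omega>. (\<Sum>i<Suc k. ?q k i \<omega>)\<^sup>2 \<partial>M) \<longlonglongrightarrow> 0"
  proof (rule Lim_null_comparison)
    show "\<forall>\<^sub>F k in sequentially. norm (\<integral>\<omega>. (\<Sum>i<Suc k. ?q k i \<omega>)\<^sup>2 \<partial>M) \<le> 4 * C\<^sup>2 * t\<^sup>2 / real (Suc k)"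
      using bound by (auto simp del: of_nat_Suc sum.lessThan_Suc)
    show "(\<lambda>k. 4 * C\<^sup>2 * t\<^sup>2 / real (Suc k)) \<longlonglongrightarrow> 0"
      by (rule LIMSEQ_Suc[OF lim_const_over_n])
  qed
qed

text \<open>A Wiener increment over a cell of length \<open>d\<close> is of size \<open>d\<^bsup>1/2\<^esup>\<close> in every moment, so each summand is of size
  \<open>d\<^bsup>3/2\<^esup>\<close> in \<open>L\<^sup>2\<close>. With \<open>n = t / d\<close> summands even the triangle inequality, here in the form
  \<open>sum_squared_le\<close>, leaves a bound of order \<open>1 / n\<close> for the second moment.\<close>

lemma small_increments_vanish:
  fixes r :: "nat \<Rightarrow> nat \<Rightarrow> 'w \<Rightarrow> real"
  assumes t: "0 < t" and C: "0 \<le> C"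
    and meas[measurable]: "\<And>k i. r k i \<in> borel_measurable M"
    and bound: "\<And>k i \<omega>. \<omega> \<in> space M \<Longrightarrow> \<bar>r k i \<omega>\<bar> \<le> C * ((t / real (Suc k))\<^sup>2
      + t / real (Suc k) * \<bar>W (uniform_grid t k (Suc i)) \<omega> - W (uniform_grid t k i) \<omega>\<bar>
      + \<bar>W (uniform_grid t k (Suc i)) \<omega> - W (uniform_grid t k i) \<omega>\<bar> ^ 3)"
  shows "integrable M (\<lambda>\<omega>. (\<Sum>i<Suc k. r k i \<omega>)\<^sup>2)"
    and "(\<lambda>k. \<integral>\<omega>. (\<Sum>i<Suc k. r k i \<omega>)\<^sup>2 \<partial>M) \<longlonglongrightarrow> 0"
proof -
  let ?D = "\<lambda>k i \<omega>. W (uniform_grid t k (Suc i)) \<omega> - W (uniform_grid t k i) \<omega>"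
  let ?d = "\<lambda>k. t / real (Suc k)"
  let ?b = "\<lambda>k i \<omega>. 3 * C\<^sup>2 * (?d k ^ 4 + (?d k)\<^sup>2 * (?D k i \<omega>)\<^sup>2 + ?D k i \<omega> ^ 6)"
  have grid: "0 \<le> uniform_grid t k i" "uniform_grid t k i < uniform_grid t k (Suc i)" for k i
    using uniform_grid_nonneg[of t k i] uniform_grid_strict[OF t, of k i] t by auto
  note mom = increment_second_fourth_sixth_moment[OF grid]
  have b_int: "integrable M (?b k i)" for k i
    using mom(4,6) by (intro integrable_mult_right Bochner_Integration.integrable_add) auto
  have r_sq: "(r k i \<omega>)\<^sup>2 \<le> ?b k i \<omega>" if "\<omega> \<in> space M" for k i \<omega>
  proof -
    have "(r k i \<omega>)\<^sup>2 \<le> (C * ((?d k)\<^sup>2 + ?d k * \<bar>?D k i \<omega>\<bar> + \<bar>?D k i \<omega>\<bar> ^ 3))\<^sup>2"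
      using power_mono[OF bound[OF that, of k i], of 2] by simp
    also have "\<dots> \<le> C\<^sup>2 * (3 * (((?d k)\<^sup>2)\<^sup>2 + (?d k * \<bar>?D k i \<omega>\<bar>)\<^sup>2 + (\<bar>?D k i \<omega>\<bar> ^ 3)\<^sup>2))"
      unfolding power_mult_distrib[of C] by (intro mult_left_mono sum3_squared_le) simp
    also have "\<dots> = ?b k i \<omega>"
      unfolding power_mult_distrib by (simp add: power_mult[symmetric] power_even_abs del: of_nat_Suc)
    finally show ?thesis .
  qed
  have sum_sq: "(\<Sum>i<Suc k. r k i \<omega>)\<^sup>2 \<le> real (Suc k) * (\<Sum>i<Suc k. ?b k i \<omega>)" if "\<omega> \<in> space M" for k \<omega>
    by (rule order_trans[OF sum_squared_le]) (intro mult_left_mono sum_mono r_sq[OF that], simp)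
  have dom: "integrable M (\<lambda>\<omega>. real (Suc k) * (\<Sum>i<Suc k. ?b k i \<omega>))" for k
    by (intro integrable_mult_right Bochner_Integration.integrable_sum b_int)
  show int: "integrable M (\<lambda>\<omega>. (\<Sum>i<Suc k. r k i \<omega>)\<^sup>2)" for k
  proof (rule Bochner_Integration.integrable_bound[OF dom])
    show "AE \<omega> in M. norm ((\<Sum>i<Suc k. r k i \<omega>)\<^sup>2) \<le> norm (real (Suc k) * (\<Sum>i<Suc k. ?b k i \<omega>))"
    proof (rule AE_I2)
      fix \<omega> assume "\<omega> \<in> space M"
      from sum_sq[OF this, of k]
      show "norm ((\<Sum>i<Suc k. r k i \<omega>)\<^sup>2) \<le> norm (real (Suc k) * (\<Sum>i<Suc k. ?b k i \<omega>))"
        unfolding real_norm_def abs_power2 by (rule order_trans[OF _ abs_ge_self])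
    qed
  qed measurable
  have b_val: "(\<integral>\<omega>. ?b k i \<omega> \<partial>M) = 3 * C\<^sup>2 * (?d k ^ 4 + 16 * ?d k ^ 3)" for k i
  proof -
    have "(\<integral>\<omega>. ?b k i \<omega> \<partial>M) = 3 * C\<^sup>2 * (?d k ^ 4 + (?d k)\<^sup>2 * (\<integral>\<omega>. (?D k i \<omega>)\<^sup>2 \<partial>M) + (\<integral>\<omega>. ?D k i \<omega> ^ 6 \<partial>M))"
      using mom(4,6)[of k i] by (simp add: prob_space del: of_nat_Suc)
    also have "\<dots> = 3 * C\<^sup>2 * (?d k ^ 4 + 16 * ?d k ^ 3)"
      unfolding mom uniform_grid_step by (simp add: power2_eq_square power3_eq_cube mult.assoc del: of_nat_Suc)
    finally show ?thesis .
  qed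
  have bound': "(\<integral>\<omega>. (\<Sum>i<Suc k. r k i \<omega>)\<^sup>2 \<partial>M) \<le> 3 * C\<^sup>2 * (t ^ 4 + 16 * t ^ 3) / real (Suc k)" for k
  proof -
    have n: "0 < real (Suc k)" "1 \<le> real (Suc k)" by auto
    have "(\<integral>\<omega>. (\<Sum>i<Suc k. r k i \<omega>)\<^sup>2 \<partial>M) \<le> (\<integral>\<omega>. real (Suc k) * (\<Sum>i<Suc k. ?b k i \<omega>) \<partial>M)"
      by (intro integral_mono int dom sum_sq)
    also have "\<dots> = real (Suc k) * (\<Sum>i<Suc k. \<integral>\<omega>. ?b k i \<omega> \<partial>M)"
      by (subst integral_mult_right_zero, subst Bochner_Integration.integral_sum[OF b_int]) (rule refl)
    also have "\<dots> = 3 * C\<^sup>2 * ((real (Suc k))\<^sup>2 * (?d k ^ 4 + 16 * ?d k ^ 3))"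
      unfolding b_val by (simp add: power2_eq_square del: of_nat_Suc)
    also have "(real (Suc k))\<^sup>2 * (?d k ^ 4 + 16 * ?d k ^ 3) = t ^ 4 / (real (Suc k))\<^sup>2 + 16 * t ^ 3 / real (Suc k)"
      using n(1) by (simp add: field_simps power_divide eval_nat_numeral del: of_nat_Suc)
    also have "t ^ 4 / (real (Suc k))\<^sup>2 \<le> t ^ 4 / real (Suc k)"
      using n by (intro divide_left_mono) (auto simp: power2_eq_square simp del: of_nat_Suc)
    finally show ?thesis
      by (simp add: mult_left_mono add_divide_distrib[symmetric] del: of_nat_Suc)
  qed
  show "(\<lambda>k. \<integral>\<omega>. (\<Sum>i<Suc k. r k i \<omega>)\<^sup>2 \<partial>M) \<longlonglongrightarrow> 0"
  proof (rule Lim_null_comparison)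
    show "\<forall>\<^sub>F k in sequentially. norm (\<integral>\<omega>. (\<Sum>i<Suc k. r k i \<omega>)\<^sup>2 \<partial>M)
        \<le> 3 * C\<^sup>2 * (t ^ 4 + 16 * t ^ 3) / real (Suc k)"
      using bound' by (auto simp del: of_nat_Suc sum.lessThan_Suc)
    show "(\<lambda>k. 3 * C\<^sup>2 * (t ^ 4 + 16 * t ^ 3) / real (Suc k)) \<longlonglongrightarrow> 0"
      by (rule LIMSEQ_Suc[OF lim_const_over_n])
  qed
qed

section \<open>Ito's formula\<close>

lemma adapted_process_regular:
  assumes U: "regular_process M U" and adapted: "\<And>s. 0 \<le> s \<Longrightarrow> s \<le> t \<Longrightarrow> U s \<in> borel_measurable (F s)"
  shows "adapted_process M F t U"
  unfolding adapted_process_def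
proof (intro conjI ballI)
  show "(\<lambda>(s, \<omega>). indicator {0..t} s * U s \<omega>) \<in> borel_measurable (borel \<Otimes>\<^sub>M M)"
    using regular_processD(1)[OF U] unfolding split_beta'
    by (intro borel_measurable_times) measurable
qed (use adapted in auto)

lemma regular_process_square_integrable:
  assumes U: "regular_process M U" and t: "0 \<le> t"
  shows "(\<integral>\<^sup>+\<omega>. (\<integral>\<^sup>+s. ennreal (indicator {0..t} s * (U s \<omega>)\<^sup>2) \<partial>lborel) \<partial>M) < \<infinity>"
proof -
  obtain C where C: "\<And>s \<omega>. \<omega> \<in> space M \<Longrightarrow> \<bar>U s \<omega>\<bar> \<le> C"
    using regular_process_bound[OF U] by metis
  have "(\<integral>\<^sup>+\<omega>. (\<integral>\<^sup>+s. ennreal (indicator {0..t} s * (U s \<omega>)\<^sup>2) \<partial>lborel) \<partial>M)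
      \<le> (\<integral>\<^sup>+\<omega>. (\<integral>\<^sup>+s. ennreal (C\<^sup>2) * indicator {0..t} s \<partial>lborel) \<partial>M)"
  proof (intro nn_integral_mono)
    fix s \<omega> assume "\<omega> \<in> space M"
    then have "(U s \<omega>)\<^sup>2 \<le> C\<^sup>2"
      using C[of \<omega> s] by (metis abs_ge_zero power2_abs power_mono)
    then show "ennreal (indicator {0..t} s * (U s \<omega>)\<^sup>2) \<le> ennreal (C\<^sup>2) * indicator {0..t} s"
      by (auto simp: indicator_def intro: ennreal_leI)
  qed
  also have "\<dots> = ennreal (C\<^sup>2 * t)"
    using t by (simp add: nn_integral_cmult_indicator ennreal_mult' emeasure_space_1)
  finally show ?thesis by (rule le_less_trans) simp
qed

text \<open>The left-endpoint samples of a regular process approximate it in \<open>L\<^sup>2(ds \<times> M)\<close> in any case, so an integral is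
  identified by the convergence of the left-endpoint sums alone.\<close>

lemma has_ito_integral_regularI:
  assumes U: "regular_process M U" and adapted: "\<And>s. 0 \<le> s \<Longrightarrow> s \<le> t \<Longrightarrow> U s \<in> borel_measurable (F s)"
    and t: "0 < t" and J: "J \<in> borel_measurable M"
    and lim: "(\<lambda>k. \<integral>\<^sup>+\<omega>. ennreal ((J \<omega> - (\<Sum>i<Suc k. U (uniform_grid t k i) \<omega> *
        (W (uniform_grid t k (Suc i)) \<omega> - W (uniform_grid t k i) \<omega>)))\<^sup>2) \<partial>M) \<longlonglongrightarrow> 0"
  shows "has_ito_integral M F W U t J"
proof -
  obtain C where C: "\<And>s \<omega>. \<omega> \<in> space M \<Longrightarrow> \<bar>U s \<omega>\<bar> \<le> C"
    using regular_process_bound[OF U] by metis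
  have le_t: "uniform_grid t k i \<le> t" if "i < Suc k" for k i
    using monoD[OF uniform_grid_mono, of t i "Suc k" k] that t by simp
  have "elementary_process F t (Suc k) (uniform_grid t k) (\<lambda>i. U (uniform_grid t k i))" for k
    unfolding elementary_process_def space_F
  proof (intro conjI allI impI)
    fix i assume i: "i < Suc k"
    show "uniform_grid t k i \<le> uniform_grid t k (Suc i)"
      using uniform_grid_strict[OF t, of k i] by simp
    show "U (uniform_grid t k i) \<in> borel_measurable (F (uniform_grid t k i))"
      using le_t[OF i] t uniform_grid_nonneg[of t k i] by (intro adapted) auto
    show "bounded (U (uniform_grid t k i) ` space M)"
      using C by (intro boundedI[where B = C]) auto
  qed (use t in auto)
  then show ?thesis
    unfolding has_ito_integral_def
    using adapted_process_regular[OF U adapted] regular_process_square_integrable[OF U] t J lim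
      regular_process_elementary_approximation[OF U t]
    unfolding elementary_integral_def[abs_def]
    by (intro conjI exI[of _ "\<lambda>k. Suc k"] exI[of _ "\<lambda>k. uniform_grid t k"]
        exI[of _ "\<lambda>k i. U (uniform_grid t k i)"]) auto
qed

text \<open>Separate from the case \<open>0 < t\<close> because the increments over the cells of a degenerate grid have no normal
  density.\<close>

lemma has_ito_integral_at_0:
  assumes "adapted_process M F 0 U"
  shows "has_ito_integral M F W U 0 (\<lambda>_. 0)"
proof -
  have zero: "(\<integral>\<^sup>+s. ennreal (indicator {0..0} s * f s) \<partial>lborel) = 0" for f :: "real \<Rightarrow> real"
  proof -
    have "AE s in lborel. ennreal (indicator {0..0} s * f s) = 0"
      using AE_lborel_singleton[of 0] by eventually_elim auto
    then show ?thesis by (subst nn_integral_cong_AE[where v = "\<lambda>_. 0"]) auto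
  qed
  show ?thesis
    unfolding has_ito_integral_def zero
    using assms
    by (intro conjI exI[of _ "\<lambda>_. 0"] exI[of _ "\<lambda>_ _. 0"] exI[of _ "\<lambda>_ _ _. 0"])
      (auto simp: elementary_process_def elementary_integral_def)
qed

lemma adapted_process_cong:
  assumes eq: "\<And>s \<omega>. s \<in> {0..t} \<Longrightarrow> \<omega> \<in> space M \<Longrightarrow> U s \<omega> = V s \<omega>" and U: "adapted_process M F t U"
  shows "adapted_process M F t V"
  unfolding adapted_process_def
proof (intro conjI ballI)
  have "(\<lambda>(s, \<omega>). indicator {0..t} s * U s \<omega>) \<in> borel_measurable (borel \<Otimes>\<^sub>M M)"
    using U by (simp add: adapted_process_def)
  then show "(\<lambda>(s, \<omega>). indicator {0..t} s * V s \<omega>) \<in> borel_measurable (borel \<Otimes>\<^sub>M M)"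
    by (rule measurable_cong[THEN iffD1, rotated]) (auto simp: indicator_def space_pair_measure eq)
  show "V s \<in> borel_measurable (F s)" if "s \<in> {0..t}" for s
  proof -
    have "U s \<in> borel_measurable (F s)"
      using U that by (simp add: adapted_process_def)
    then show ?thesis
      by (rule measurable_cong[THEN iffD1, rotated]) (simp add: space_F eq[OF that])
  qed
qed

lemma has_ito_integral_cong:
  assumes eq: "\<And>s \<omega>. s \<in> {0..t} \<Longrightarrow> \<omega> \<in> space M \<Longrightarrow> U s \<omega> = V s \<omega>"
    and U: "has_ito_integral M F W U t J"
  shows "has_ito_integral M F W V t J"
proof -
  have "(\<integral>\<^sup>+\<omega>. (\<integral>\<^sup>+s. ennreal (indicator {0..t} s * (U s \<omega> - e s \<omega>)\<^sup>2) \<partial>lborel) \<partial>M)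
      = (\<integral>\<^sup>+\<omega>. (\<integral>\<^sup>+s. ennreal (indicator {0..t} s * (V s \<omega> - e s \<omega>)\<^sup>2) \<partial>lborel) \<partial>M)" for e
    by (intro nn_integral_cong) (auto simp: indicator_def eq)
  from this[of "\<lambda>s \<omega>. 0"] this
  show ?thesis
    using U adapted_process_cong[of t U V, OF eq] unfolding has_ito_integral_def by simp
qed

text \<open>The increment of \<open>g\<close> over each cell is expanded to first order in time and second order in space. Replacing
  \<open>(\<Delta>W)\<^sup>2\<close> by the length of the cell costs a quadratic fluctuation, the drift terms add up to a Riemann sum, and
  what remains is a sum of small increments. The identity \<open>g s y = y\<close> is an instance and gives the
  integral of the constant \<open>1\<close>.\<close>

theorem ito_formula:
  fixes g g0 g1 g2 :: "real \<Rightarrow> real \<Rightarrow> real"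
  assumes ds: "\<And>s y. ((\<lambda>s. g s y) has_real_derivative g0 s y) (at s)"
    and dy: "\<And>s y. ((\<lambda>y. g s y) has_real_derivative g1 s y) (at y)"
    and dyy: "\<And>s y. ((\<lambda>y. g1 s y) has_real_derivative g2 s y) (at y)"
    and g0: "bounded_lipschitz g0" and g1: "bounded_lipschitz g1" and g2: "bounded_lipschitz g2"
    and t: "0 \<le> t"
  shows "has_ito_integral M F W (\<lambda>s \<omega>. g1 s (Y s \<omega>)) t
    (\<lambda>\<omega>. g t (Y t \<omega>) - g 0 0 -
      (LBINT s:{0..t}. g0 s (Y s \<omega>) + \<eta> \<omega> * g1 s (Y s \<omega>) + 1 / 2 * g2 s (Y s \<omega>)))"
proof (cases "t = 0")
  case True
  have "has_ito_integral M F W (\<lambda>s \<omega>. g1 s (Y s \<omega>)) 0 (\<lambda>_. 0)"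
    by (intro has_ito_integral_at_0 adapted_process_regular regular_process_along_Y Y_adapted g1) auto
  moreover have "(LBINT s:{0..0}. f s) = 0" for f :: "real \<Rightarrow> real"
  proof -
    have "AE s in lborel. indicator {0..0} s *\<^sub>R f s = 0"
      using AE_lborel_singleton[of 0] by eventually_elim auto
    then show ?thesis
      unfolding set_lebesgue_integral_def by (rule integral_eq_zero_AE)
  qed
  ultimately show ?thesis
    unfolding True using Y_0 by (auto simp: has_ito_integral_def cong: measurable_cong nn_integral_cong)
next
  case False
  then have t: "0 < t" using t by simp
  define U where "U s \<omega> = g1 s (Y s \<omega>)" for s \<omega>
  define b where "b s \<omega> = g0 s (Y s \<omega>) + \<eta> \<omega> * g1 s (Y s \<omega>) + 1 / 2 * g2 s (Y s \<omega>)" for s \<omega>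
  define J where "J \<omega> = g t (Y t \<omega>) - g 0 0 - (LBINT s:{0..t}. b s \<omega>)" for \<omega>
  define u where "u s y = 1 / 2 * g2 s y" for s y
  let ?\<tau> = uniform_grid
  let ?d = "\<lambda>k. t / real (Suc k)"
  let ?D = "\<lambda>k i \<omega>. W (?\<tau> t k (Suc i)) \<omega> - W (?\<tau> t k i) \<omega>"
  let ?I = "\<lambda>k \<omega>. \<Sum>i<Suc k. U (?\<tau> t k i) \<omega> * ?D k i \<omega>"
  have u: "bounded_lipschitz u"
    unfolding u_def[abs_def] by (intro bounded_lipschitz_intros g2)
  have U: "regular_process M U"
    unfolding U_def[abs_def] by (rule regular_process_along_Y[OF g1])
  have b: "regular_process M b"
    unfolding b_def[abs_def]
    by (intro regular_process_add regular_process_mult regular_process_along_Y g0 g1 g2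
        regular_process_random_variable[of "\<lambda>_. 1 / 2" M "1 / 2"]
        regular_process_random_variable[OF \<eta>_measurable \<eta>_bound]) auto
  have g_cont: "continuous_on UNIV (g s)" for s
    by (rule continuous_at_imp_continuous_on) (use dy in \<open>auto intro: DERIV_isCont\<close>)
  have g_meas: "(\<lambda>\<omega>. g s (Y s \<omega>)) \<in> borel_measurable M" for s
    by (rule measurable_compose[OF Y_measurable borel_measurable_continuous_onI[OF g_cont]])
  have J_meas: "J \<in> borel_measurable M"
    unfolding J_def[abs_def]
    by (intro borel_measurable_diff g_meas regular_process_riemann_sum(3)[OF b t]) auto
  obtain C where C: "0 \<le> C"
    "\<And>s z s' z'. \<bar>g0 s z - g0 s' z'\<bar> \<le> C * (\<bar>s - s'\<bar> + \<bar>z - z'\<bar>)"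
    "\<And>s z. \<bar>g2 s z\<bar> \<le> C"
    "\<And>s z s' z'. \<bar>g2 s z - g2 s' z'\<bar> \<le> C * (\<bar>s - s'\<bar> + \<bar>z - z'\<bar>)"
  proof -
    obtain C0 where C0: "0 \<le> C0" "\<And>s z s' z'. \<bar>g0 s z - g0 s' z'\<bar> \<le> C0 * (\<bar>s - s'\<bar> + \<bar>z - z'\<bar>)"
      using bounded_lipschitzE[OF g0] by metis
    obtain C2 where C2: "0 \<le> C2" "\<And>s z. \<bar>g2 s z\<bar> \<le> C2"
      "\<And>s z s' z'. \<bar>g2 s z - g2 s' z'\<bar> \<le> C2 * (\<bar>s - s'\<bar> + \<bar>z - z'\<bar>)"
      using bounded_lipschitzE[OF g2] by metis
    show ?thesis
    proof (rule that[of "C0 + C2"])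
      show "\<bar>g0 s z - g0 s' z'\<bar> \<le> (C0 + C2) * (\<bar>s - s'\<bar> + \<bar>z - z'\<bar>)" for s z s' z'
        by (rule order_trans[OF C0(2) mult_right_mono]) (use C2(1) in auto)
      show "\<bar>g2 s z - g2 s' z'\<bar> \<le> (C0 + C2) * (\<bar>s - s'\<bar> + \<bar>z - z'\<bar>)" for s z s' z'
        by (rule order_trans[OF C2(3) mult_right_mono]) (use C0(1) in auto)
      show "\<bar>g2 s z\<bar> \<le> C0 + C2" for s z
        using C2(2)[of s z] C0(1) by linarith
    qed (use C0 C2 in auto)
  qed
  \<comment> \<open>the increment of \<open>g\<close> over a cell, minus its stochastic, quadratic and drift parts\<close>
  define r where "r k i \<omega> = g (?\<tau> t k (Suc i)) (Y (?\<tau> t k (Suc i)) \<omega>) - g (?\<tau> t k i) (Y (?\<tau> t k i) \<omega>)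
      - U (?\<tau> t k i) \<omega> * ?D k i \<omega> - quadratic_fluctuation u (?\<tau> t k) i \<omega> - b (?\<tau> t k i) \<omega> * ?d k" for k i \<omega>
  \<comment> \<open>one constant dominating the coefficients of the three monomials in \<open>?d k\<close> and \<open>\<bar>?D k i\<bar>\<close> found in \<open>r_bound\<close>\<close>
  let ?C' = "C * (5 + \<bar>K\<bar> + \<bar>K\<bar>\<^sup>2 + 4 * \<bar>K\<bar> ^ 3 * t)"
  have \<tau>_nonneg: "0 \<le> ?\<tau> t k i" for k i
    using uniform_grid_nonneg[of t k i] t by simp
  have r_meas: "r k i \<in> borel_measurable M" for k i
    unfolding r_def[abs_def]
    using regular_processD(2)[OF U] regular_processD(2)[OF b] \<tau>_nonneg uniform_grid_strict[OF t]
    by (intro borel_measurable_diff borel_measurable_times g_meas W_measurable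
        quadratic_fluctuation_measurable u borel_measurable_const) auto
  have r_bound: "\<bar>r k i \<omega>\<bar> \<le> ?C' * ((?d k)\<^sup>2 + ?d k * \<bar>?D k i \<omega>\<bar> + \<bar>?D k i \<omega>\<bar> ^ 3)"
    if \<omega>: "\<omega> \<in> space M" for k i \<omega>
  proof -
    define s where "s = ?\<tau> t k i"
    define s' where "s' = ?\<tau> t k (Suc i)"
    define d where "d = ?d k"
    define D where "D = ?D k i \<omega>"
    define y where "y = Y s \<omega>"
    define y' where "y' = Y s' \<omega>"
    have sd: "s' - s = d"
      unfolding s'_def s_def d_def by (rule uniform_grid_step)
    have d: "0 \<le> d" "d \<le> t"
      unfolding d_def using t by (auto simp: divide_le_eq)
    have dy': "y' - y = \<eta> \<omega> * d + D"
      using \<tau>_nonneg[of k i] \<tau>_nonneg[of k "Suc i"] sd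
      unfolding y'_def y_def D_def Y_def s_def[symmetric] s'_def[symmetric]
      by (simp add: max_absorb2 algebra_simps flip: sd)
    have D': "W s' \<omega> - W s \<omega> = D"
      by (simp add: D_def s_def s'_def)
    have K: "\<bar>\<eta> \<omega>\<bar> \<le> \<bar>K\<bar>" using \<eta>_bound[OF \<omega>] by linarith
    have \<delta>: "\<bar>y' - y\<bar> \<le> \<bar>K\<bar> * d + \<bar>D\<bar>"
    proof -
      have "\<bar>\<eta> \<omega> * d\<bar> \<le> \<bar>K\<bar> * d"
        unfolding abs_mult using K d by (intro mult_mono) auto
      then show ?thesis unfolding dy' by linarith
    qed
    \<comment> \<open>the Taylor expansion has the square of the increment of \<open>Y\<close>, the quadratic part that of \<open>W\<close>\<close>
    let ?rem = "g s' y' - g s y - g0 s y * (s' - s) - g1 s y * (y' - y) - g2 s y / 2 * (y' - y)\<^sup>2"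
    have "r k i \<omega> = ?rem + g2 s y / 2 * ((y' - y)\<^sup>2 - D\<^sup>2)"
      unfolding r_def quadratic_fluctuation_def u_def b_def U_def uniform_grid_step
        s_def[symmetric] s'_def[symmetric] d_def[symmetric] D' y_def[symmetric] y'_def[symmetric]
      unfolding sd dy' by (simp add: field_simps)
    also have "(y' - y)\<^sup>2 - D\<^sup>2 = (\<eta> \<omega> * d)\<^sup>2 + 2 * (\<eta> \<omega> * d * D)"
      unfolding dy' by (simp add: power2_eq_square algebra_simps)
    finally have eq: "r k i \<omega> = ?rem + g2 s y / 2 * ((\<eta> \<omega> * d)\<^sup>2 + 2 * (\<eta> \<omega> * d * D))" .
    have 1: "\<bar>?rem\<bar> \<le> C * (d\<^sup>2 + d * (\<bar>K\<bar> * d + \<bar>D\<bar>) + 4 * (\<bar>K\<bar> ^ 3 * t * d\<^sup>2 + \<bar>D\<bar> ^ 3))"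
    proof -
      have "\<bar>?rem\<bar> \<le> C * (\<bar>s' - s\<bar>\<^sup>2 + \<bar>s' - s\<bar> * \<bar>y' - y\<bar> + \<bar>y' - y\<bar> ^ 3)"
        by (rule taylor_increment_bound[OF ds dy dyy C(2,4,1)])
      also have "\<dots> = C * (d\<^sup>2 + d * \<bar>y' - y\<bar> + \<bar>y' - y\<bar> ^ 3)"
        using d unfolding sd by simp
      also have "\<dots> \<le> C * (d\<^sup>2 + d * (\<bar>K\<bar> * d + \<bar>D\<bar>) + 4 * (\<bar>K\<bar> ^ 3 * t * d\<^sup>2 + \<bar>D\<bar> ^ 3))"
      proof (intro mult_left_mono add_mono order_refl C \<delta> d)
        have "\<bar>y' - y\<bar> ^ 3 \<le> (\<bar>K\<bar> * d + \<bar>D\<bar>) ^ 3"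
          by (intro power_mono \<delta>) simp
        also have "\<dots> \<le> 4 * ((\<bar>K\<bar> * d) ^ 3 + \<bar>D\<bar> ^ 3)"
          using d by (intro cube_sum_le) auto
        also have "(\<bar>K\<bar> * d) ^ 3 = \<bar>K\<bar> ^ 3 * d * d\<^sup>2"
          by (simp add: power3_eq_cube power2_eq_square)
        also have "\<dots> \<le> \<bar>K\<bar> ^ 3 * t * d\<^sup>2"
          using d by (intro mult_right_mono mult_left_mono) auto
        finally show "\<bar>y' - y\<bar> ^ 3 \<le> 4 * (\<bar>K\<bar> ^ 3 * t * d\<^sup>2 + \<bar>D\<bar> ^ 3)" by simp
      qed
      finally show ?thesis .
    qed
    have double_bound: "\<bar>a\<bar> \<le> A \<Longrightarrow> \<bar>b\<bar> \<le> B \<Longrightarrow> 0 \<le> A \<Longrightarrow> \<bar>a + 2 * b\<bar> \<le> 2 * (A + B)"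
      for a b A B :: real
      unfolding abs_le_iff by auto
    have 2: "\<bar>g2 s y / 2 * ((\<eta> \<omega> * d)\<^sup>2 + 2 * (\<eta> \<omega> * d * D))\<bar> \<le> C * (\<bar>K\<bar>\<^sup>2 * d\<^sup>2 + \<bar>K\<bar> * (d * \<bar>D\<bar>))"
    proof -
      have "\<bar>(\<eta> \<omega> * d)\<^sup>2\<bar> \<le> \<bar>K\<bar>\<^sup>2 * d\<^sup>2"
        using power_mono[OF K, of 2] by (simp add: power_mult_distrib mult_right_mono)
      moreover have "\<bar>\<eta> \<omega> * d * D\<bar> \<le> \<bar>K\<bar> * (d * \<bar>D\<bar>)"
        unfolding abs_mult using K d by (simp add: mult.assoc mult_right_mono)
      moreover have "0 \<le> \<bar>K\<bar>\<^sup>2 * d\<^sup>2" by simp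
      ultimately have "\<bar>(\<eta> \<omega> * d)\<^sup>2 + 2 * (\<eta> \<omega> * d * D)\<bar> \<le> 2 * (\<bar>K\<bar>\<^sup>2 * d\<^sup>2 + \<bar>K\<bar> * (d * \<bar>D\<bar>))"
        by (rule double_bound)
      moreover have "\<bar>g2 s y / 2\<bar> \<le> C / 2" using C(3)[of s y] by simp
      ultimately have "\<bar>g2 s y / 2 * ((\<eta> \<omega> * d)\<^sup>2 + 2 * (\<eta> \<omega> * d * D))\<bar>
          \<le> C / 2 * (2 * (\<bar>K\<bar>\<^sup>2 * d\<^sup>2 + \<bar>K\<bar> * (d * \<bar>D\<bar>)))"
        unfolding abs_mult[of "g2 s y / 2"] using C(1) by (intro mult_mono) auto
      moreover have "C / 2 * (2 * x) = C * x" for x by simp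
      ultimately show ?thesis by (simp only:)
    qed
    have "\<bar>r k i \<omega>\<bar> \<le> C * (d\<^sup>2 + d * (\<bar>K\<bar> * d + \<bar>D\<bar>) + 4 * (\<bar>K\<bar> ^ 3 * t * d\<^sup>2 + \<bar>D\<bar> ^ 3)
        + (\<bar>K\<bar>\<^sup>2 * d\<^sup>2 + \<bar>K\<bar> * (d * \<bar>D\<bar>)))"
      unfolding eq distrib_left[of C _ "\<bar>K\<bar>\<^sup>2 * d\<^sup>2 + \<bar>K\<bar> * (d * \<bar>D\<bar>)"]
      by (rule order_trans[OF abs_triangle_ineq add_mono[OF 1 2]])
    also have "\<dots> \<le> C * ((5 + \<bar>K\<bar> + \<bar>K\<bar>\<^sup>2 + 4 * \<bar>K\<bar> ^ 3 * t) * (d\<^sup>2 + d * \<bar>D\<bar> + \<bar>D\<bar> ^ 3))"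
    proof (rule mult_left_mono[OF _ C(1)])
      let ?E = "5 + \<bar>K\<bar> + \<bar>K\<bar>\<^sup>2 + 4 * \<bar>K\<bar> ^ 3 * t"
      have pos: "0 \<le> \<bar>K\<bar>" "0 \<le> \<bar>K\<bar>\<^sup>2" "0 \<le> \<bar>K\<bar> ^ 3 * t" using t by auto
      have "(1 + \<bar>K\<bar> + 4 * \<bar>K\<bar> ^ 3 * t + \<bar>K\<bar>\<^sup>2) * d\<^sup>2 \<le> ?E * d\<^sup>2"
        by (intro mult_right_mono) (use pos in linarith, simp)
      moreover have "(1 + \<bar>K\<bar>) * (d * \<bar>D\<bar>) \<le> ?E * (d * \<bar>D\<bar>)"
        by (intro mult_right_mono) (use pos in linarith, use d in simp)
      moreover have "4 * \<bar>D\<bar> ^ 3 \<le> ?E * \<bar>D\<bar> ^ 3"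
        by (intro mult_right_mono) (use pos in linarith, simp)
      ultimately have "(1 + \<bar>K\<bar> + 4 * \<bar>K\<bar> ^ 3 * t + \<bar>K\<bar>\<^sup>2) * d\<^sup>2 + (1 + \<bar>K\<bar>) * (d * \<bar>D\<bar>) + 4 * \<bar>D\<bar> ^ 3
          \<le> ?E * (d\<^sup>2 + d * \<bar>D\<bar> + \<bar>D\<bar> ^ 3)"
        unfolding distrib_left[of ?E] by linarith
      moreover have "d\<^sup>2 + d * (\<bar>K\<bar> * d + \<bar>D\<bar>) + 4 * (\<bar>K\<bar> ^ 3 * t * d\<^sup>2 + \<bar>D\<bar> ^ 3)
        + (\<bar>K\<bar>\<^sup>2 * d\<^sup>2 + \<bar>K\<bar> * (d * \<bar>D\<bar>))
        = (1 + \<bar>K\<bar> + 4 * \<bar>K\<bar> ^ 3 * t + \<bar>K\<bar>\<^sup>2) * d\<^sup>2 + (1 + \<bar>K\<bar>) * (d * \<bar>D\<bar>) + 4 * \<bar>D\<bar> ^ 3"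
        by (simp add: algebra_simps power2_eq_square)
      ultimately show "d\<^sup>2 + d * (\<bar>K\<bar> * d + \<bar>D\<bar>) + 4 * (\<bar>K\<bar> ^ 3 * t * d\<^sup>2 + \<bar>D\<bar> ^ 3)
        + (\<bar>K\<bar>\<^sup>2 * d\<^sup>2 + \<bar>K\<bar> * (d * \<bar>D\<bar>)) \<le> ?E * (d\<^sup>2 + d * \<bar>D\<bar> + \<bar>D\<bar> ^ 3)"
        by simp
    qed
    finally show ?thesis
      unfolding d_def D_def by (simp only: mult.assoc)
  qed
  have C'_nonneg: "0 \<le> ?C'"
    using C(1) t by (intro mult_nonneg_nonneg add_nonneg_nonneg) auto
  let ?A1 = "\<lambda>k \<omega>. \<Sum>i<Suc k. quadratic_fluctuation u (?\<tau> t k) i \<omega>"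
  let ?A2 = "\<lambda>k \<omega>. \<Sum>i<Suc k. r k i \<omega>"
  let ?A3 = "\<lambda>k \<omega>. (\<Sum>i<Suc k. b (?\<tau> t k i) \<omega> * ?d k) - (LBINT s:{0..t}. b s \<omega>)"
  note A1 = quadratic_variation_converges[OF u t]
  note A2 = small_increments_vanish[OF t C'_nonneg r_meas r_bound]
  note A3 = regular_process_riemann_sum(1,2)[OF b t]
  have error: "J \<omega> - ?I k \<omega> = ?A1 k \<omega> + ?A2 k \<omega> + ?A3 k \<omega>" if \<omega>: "\<omega> \<in> space M" for k \<omega>
  proof -
    have "(\<Sum>i<Suc k. g (?\<tau> t k (Suc i)) (Y (?\<tau> t k (Suc i)) \<omega>) - g (?\<tau> t k i) (Y (?\<tau> t k i) \<omega>))
        = g t (Y t \<omega>) - g 0 0"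
      using sum_lessThan_telescope[of "\<lambda>i. g (?\<tau> t k i) (Y (?\<tau> t k i) \<omega>)" "Suc k"] Y_0[OF \<omega>]
      by (simp del: sum.lessThan_Suc)
    moreover have "?A2 k \<omega> = (\<Sum>i<Suc k. g (?\<tau> t k (Suc i)) (Y (?\<tau> t k (Suc i)) \<omega>) - g (?\<tau> t k i) (Y (?\<tau> t k i) \<omega>))
        - ?I k \<omega> - ?A1 k \<omega> - (\<Sum>i<Suc k. b (?\<tau> t k i) \<omega> * ?d k)"
      unfolding r_def sum_subtractf ..
    ultimately show ?thesis
      unfolding J_def by simp
  qed
  let ?E = "\<lambda>k. 3 * ((\<integral>\<omega>. (?A1 k \<omega>)\<^sup>2 \<partial>M) + (\<integral>\<omega>. (?A2 k \<omega>)\<^sup>2 \<partial>M) + (\<integral>\<omega>. (?A3 k \<omega>)\<^sup>2 \<partial>M))"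
  have le: "(\<integral>\<^sup>+\<omega>. ennreal ((J \<omega> - ?I k \<omega>)\<^sup>2) \<partial>M) \<le> ennreal (?E k)" for k
  proof -
    have "(\<integral>\<^sup>+\<omega>. ennreal ((J \<omega> - ?I k \<omega>)\<^sup>2) \<partial>M)
        \<le> (\<integral>\<^sup>+\<omega>. ennreal (3 * ((?A1 k \<omega>)\<^sup>2 + (?A2 k \<omega>)\<^sup>2 + (?A3 k \<omega>)\<^sup>2)) \<partial>M)"
    proof (intro nn_integral_mono ennreal_leI)
      fix \<omega> assume \<omega>: "\<omega> \<in> space M"
      show "(J \<omega> - ?I k \<omega>)\<^sup>2 \<le> 3 * ((?A1 k \<omega>)\<^sup>2 + (?A2 k \<omega>)\<^sup>2 + (?A3 k \<omega>)\<^sup>2)"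
        unfolding error[OF \<omega>] by (rule sum3_squared_le)
    qed
    also have "\<dots> = ennreal (\<integral>\<omega>. 3 * ((?A1 k \<omega>)\<^sup>2 + (?A2 k \<omega>)\<^sup>2 + (?A3 k \<omega>)\<^sup>2) \<partial>M)"
    proof (rule nn_integral_eq_integral)
      show "integrable M (\<lambda>\<omega>. 3 * ((?A1 k \<omega>)\<^sup>2 + (?A2 k \<omega>)\<^sup>2 + (?A3 k \<omega>)\<^sup>2))"
        by (intro integrable_mult_right Bochner_Integration.integrable_add A1(1) A2(1) A3(1))
    qed (intro AE_I2 mult_nonneg_nonneg add_nonneg_nonneg zero_le_power2, simp)
    also have "(\<integral>\<omega>. 3 * ((?A1 k \<omega>)\<^sup>2 + (?A2 k \<omega>)\<^sup>2 + (?A3 k \<omega>)\<^sup>2) \<partial>M) = ?E k"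
    proof -
      note int = A1(1)[of k] A2(1)[of k] A3(1)[of k]
      have "(\<integral>\<omega>. 3 * (p \<omega> + q \<omega> + v \<omega>) \<partial>M) = 3 * (integral\<^sup>L M p + integral\<^sup>L M q + integral\<^sup>L M v)"
        if "integrable M p" "integrable M q" "integrable M v" for p q v :: "'w \<Rightarrow> real"
        using that by simp
      from this[OF int] show ?thesis .
    qed
    finally show ?thesis .
  qed
  have "?E \<longlonglongrightarrow> 3 * (0 + 0 + 0)"
    by (intro tendsto_intros A1(2) A2(2) A3(2))
  then have "(\<lambda>k. ennreal (?E k)) \<longlonglongrightarrow> ennreal 0"
    by (intro tendsto_ennrealI) simp
  then have E_lim: "(\<lambda>k. ennreal (?E k)) \<longlonglongrightarrow> 0" by simp
  have "(\<lambda>k. \<integral>\<^sup>+\<omega>. ennreal ((J \<omega> - ?I k \<omega>)\<^sup>2) \<partial>M) \<longlonglongrightarrow> 0"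
    by (rule tendsto_sandwich[OF _ _ tendsto_const E_lim]) (intro always_eventually allI le zero_le)+
  moreover have "U s \<in> borel_measurable (F s)" if "0 \<le> s" "s \<le> t" for s
    unfolding U_def[abs_def] using that by (intro Y_adapted g1) auto
  ultimately have "has_ito_integral M F W U t J"
    by (intro has_ito_integral_regularI U t J_meas)
  then show ?thesis
    unfolding U_def[abs_def] J_def[abs_def] b_def .
qed

end

section \<open>The filter equation\<close>

lemma test_function_bounded:
  fixes f :: "'a::euclidean_space \<Rightarrow> real"
  assumes "test_function f"
  obtains C where "\<And>x. \<bar>f x\<bar> \<le> C"
proof -
  let ?S = "closure {x. f x \<noteq> 0}"
  have "compact (f ` ?S)"
    using assms unfolding test_function_def
    by (intro compact_continuous_image) (blast intro: continuous_on_subset)+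
  then obtain C where "\<forall>y\<in>f ` ?S. norm y \<le> C"
    using compact_imp_bounded[of "f ` ?S"] unfolding bounded_iff by blast
  then have C: "\<bar>f x\<bar> \<le> C" if "x \<in> ?S" for x
    using that by auto
  have "\<bar>f x\<bar> \<le> max C 0" for x
  proof (cases "f x = 0")
    case False
    then have "x \<in> ?S" using closure_subset[of "{x. f x \<noteq> 0}"] by auto
    then show ?thesis using C[of x] by simp
  qed simp
  then show ?thesis by (rule that)
qed

locale filtering_model = filtering_problem h p0 B + drifted_wiener M W \<eta> B F
  for h p0 :: "'a::euclidean_space \<Rightarrow> real" and B :: real
    and M :: "'w measure" and W \<eta> F
begin

lemma posterior_centered:
  assumes f: "prior.observable f"
  shows "prior.posterior (\<lambda>x. (h x - c) * f x) s z = prior.posterior (\<lambda>x. f x * h x) s z - c * prior.posterior f s z"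
proof -
  have "prior.unnormalized (\<lambda>x. (h x - c) * f x) s z
      = (\<integral>x. f x * h x * prior.likelihood s z x - c * (f x * prior.likelihood s z x) \<partial>density lborel p0)"
    unfolding prior.unnormalized_def by (intro Bochner_Integration.integral_cong) (auto simp: algebra_simps)
  also have "\<dots> = prior.unnormalized (\<lambda>x. f x * h x) s z - c * prior.unnormalized f s z"
    unfolding prior.unnormalized_def
    using prior.integrable_observable_likelihood[OF prior.observable_mult[OF f prior.observable_h], of s z]
      prior.integrable_observable_likelihood[OF f, of s z]
    by simp
  finally show ?thesis
    by (simp add: prior.posterior_def diff_divide_distrib)
qed

lemma set_integrable_regular:
  assumes "regular_process M U" "\<omega> \<in> space M"
  shows "set_integrable lborel {0..t} (\<lambda>s. U s \<omega>)"
  by (rule borel_integrable_atLeastAtMost')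
    (rule continuous_on_subset[OF regular_processD(3)[OF assms]], simp)

text \<open>The innovation \<open>dZ - m h ds\<close> is an Ito process with this drift and unit diffusion.\<close>

definition innovation_drift :: "real \<Rightarrow> 'w \<Rightarrow> real" where
  "innovation_drift s \<omega> = \<eta> \<omega> - prior.posterior h s (Y s \<omega>)"

lemma regular_process_innovation_drift: "regular_process M innovation_drift"
proof -
  have "regular_process M (\<lambda>s \<omega>. \<eta> \<omega> + (-1) * prior.posterior h s (Y s \<omega>))"
    by (intro regular_process_add regular_process_mult regular_process_along_Y
        prior.bounded_lipschitz_posterior prior.observable_h
        regular_process_random_variable[of "\<lambda>_. -1" M 1]
        regular_process_random_variable[OF \<eta>_measurable \<eta>_bound]) auto
  then show ?thesis by (simp add: innovation_drift_def[abs_def])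
qed

lemma adapted_innovation_drift: "adapted_process M F t innovation_drift"
proof (rule adapted_process_regular[OF regular_process_innovation_drift])
  fix s :: real assume "0 \<le> s" "s \<le> t"
  then show "innovation_drift s \<in> borel_measurable (F s)"
    unfolding innovation_drift_def[abs_def]
    by (intro borel_measurable_diff \<eta>_adapted Y_adapted prior.bounded_lipschitz_posterior prior.observable_h) auto
qed

text \<open>The martingale part is \<open>W\<close>, obtained from Ito's formula for the identity; \<open>V\<close> is only pinned down up to its
  initial value because the initial observation is arbitrary.\<close>

lemma ito_process_innovation:
  assumes V: "\<And>s \<omega>. s \<in> {0..t} \<Longrightarrow> \<omega> \<in> space M \<Longrightarrow>
      V s \<omega> = V 0 \<omega> + Y s \<omega> - (LBINT u:{0..s}. prior.posterior h u (Y u \<omega>))"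
  shows "ito_process M F W t innovation_drift (\<lambda>s \<omega>. 1) V"
  unfolding ito_process_def
proof (intro conjI)
  show "adapted_process M F t innovation_drift" by (rule adapted_innovation_drift)
  show "AE \<omega> in M. set_integrable lborel {0..t} (\<lambda>s. innovation_drift s \<omega>)"
    by (intro AE_I2 set_integrable_regular regular_process_innovation_drift)
  let ?K = "\<lambda>s \<omega>. Y s \<omega> - 0 - (LBINT u:{0..s}. 0 + \<eta> \<omega> * 1 + 1 / 2 * 0)"
  have "has_ito_integral M F W (\<lambda>s \<omega>. 1) s (?K s)" if "s \<in> {0..t}" for s
    using that
    by (intro ito_formula[of "\<lambda>s y. y" "\<lambda>s y. 0" "\<lambda>s y. 1" "\<lambda>s y. 0"] bounded_lipschitz_const) auto
  moreover have "V s \<omega> = V 0 \<omega> + (LBINT u:{0..s}. innovation_drift u \<omega>) + ?K s \<omega>"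
    if s: "s \<in> {0..t}" and \<omega>: "\<omega> \<in> space M" for s \<omega>
  proof -
    have "set_integrable lborel {0..s} (\<lambda>u. prior.posterior h u (Y u \<omega>))"
      by (rule set_integrable_regular[OF regular_process_along_Y \<omega>])
        (intro prior.bounded_lipschitz_posterior prior.observable_h)
    moreover have "set_integrable lborel {0..s} (\<lambda>u. \<eta> \<omega>)"
      by (intro borel_integrable_atLeastAtMost' continuous_intros)
    ultimately have "(LBINT u:{0..s}. innovation_drift u \<omega>)
        = (LBINT u:{0..s}. \<eta> \<omega>) - (LBINT u:{0..s}. prior.posterior h u (Y u \<omega>))"
      unfolding innovation_drift_def by (intro set_integral_diff)
    then show ?thesis using V[OF s \<omega>] by simp
  qed
  ultimately show "\<exists>K. \<forall>s\<in>{0..t}. has_ito_integral M F W (\<lambda>s \<omega>. 1) s (K s) \<and>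
      (AE \<omega> in M. V s \<omega> = V 0 \<omega> + (LBINT u:{0..s}. innovation_drift u \<omega>) + K s \<omega>)"
    by (intro exI[of _ ?K] ballI conjI AE_I2)
qed

text \<open>Ito's formula for the posterior expectation of \<open>f\<close>, whose drift is rewritten by \<open>posterior_backward_equation\<close> as the
  integrand times the drift of the innovation.\<close>

theorem posterior_filter_equation:
  assumes f: "prior.observable f" and t: "0 \<le> t"
    and V: "\<And>s \<omega>. s \<in> {0..t} \<Longrightarrow> \<omega> \<in> space M \<Longrightarrow>
      V s \<omega> = V 0 \<omega> + Y s \<omega> - (LBINT u:{0..s}. prior.posterior h u (Y u \<omega>))"
    and \<phi>: "\<And>s \<omega>. s \<in> {0..t} \<Longrightarrow> \<omega> \<in> space M \<Longrightarrow> \<phi> s \<omega> = prior.covariance f h s (Y s \<omega>)"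
  shows "has_stochastic_integral M F W V \<phi> t (\<lambda>\<omega>. prior.posterior f t (Y t \<omega>) - prior.posterior f 0 0)"
proof -
  let ?cov = "prior.covariance f h"
  let ?g0 = "\<lambda>s z. - prior.covariance f (\<lambda>x. h x * h x) s z / 2"
  let ?J = "\<lambda>\<omega>. prior.posterior f t (Y t \<omega>) - prior.posterior f 0 0"
  have cov: "bounded_lipschitz ?cov"
    by (intro prior.bounded_lipschitz_covariance f prior.observable_h)
  have "bounded_lipschitz (\<lambda>s z. (- 1 / 2) * prior.covariance f (\<lambda>x. h x * h x) s z)"
    by (intro bounded_lipschitz_intros prior.bounded_lipschitz_covariance f prior.observable_mult prior.observable_h)
  then have g0: "bounded_lipschitz ?g0" by simp
  let ?K = "\<lambda>\<omega>. prior.posterior f t (Y t \<omega>) - prior.posterior f 0 0 -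
      (LBINT s:{0..t}. ?g0 s (Y s \<omega>) + \<eta> \<omega> * ?cov s (Y s \<omega>) + 1 / 2 * prior.third_cumulant f s (Y s \<omega>))"
  have K: "has_ito_integral M F W (\<lambda>s \<omega>. ?cov s (Y s \<omega>)) t ?K"
    by (intro ito_formula prior.posterior_deriv_s prior.posterior_deriv_z prior.covariance_deriv_z
        g0 cov prior.bounded_lipschitz_third_cumulant f t)
  have drift: "?g0 s y + e * ?cov s y + 1 / 2 * prior.third_cumulant f s y = ?cov s y * (e - prior.posterior h s y)"
    for s y e
    using prior.posterior_backward_equation[of f s y] by (simp add: algebra_simps)
  have \<phi>_drift: "(LBINT s:{0..t}. \<phi> s \<omega> * innovation_drift s \<omega>)
      = (LBINT s:{0..t}. ?g0 s (Y s \<omega>) + \<eta> \<omega> * ?cov s (Y s \<omega>) + 1 / 2 * prior.third_cumulant f s (Y s \<omega>))"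
    if "\<omega> \<in> space M" for \<omega>
    unfolding drift innovation_drift_def using \<phi> that by (intro set_lebesgue_integral_cong) auto
  have reg: "regular_process M (\<lambda>s \<omega>. ?cov s (Y s \<omega>) * innovation_drift s \<omega>)"
    by (intro regular_process_mult regular_process_along_Y cov regular_process_innovation_drift)
  show ?thesis
    unfolding has_stochastic_integral_def
  proof (intro conjI; (rule exI[of _ innovation_drift], rule exI[of _ "\<lambda>s \<omega>. 1"],
        rule exI[of _ ?K], intro conjI)?)
    show "?J \<in> borel_measurable M"
      using regular_processD(2)[OF regular_process_along_Y[OF prior.bounded_lipschitz_posterior[OF f]], of t]
      by simp
    show "adapted_process M F t \<phi>"
      by (rule adapted_process_cong[OF _ adapted_process_regular[OF regular_process_along_Y[OF cov]]])
        (auto simp: \<phi> intro: Y_adapted[OF cov])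
    show "ito_process M F W t innovation_drift (\<lambda>s \<omega>. 1) V"
      by (rule ito_process_innovation[OF V])
    show "AE \<omega> in M. set_integrable lborel {0..t} (\<lambda>s. \<phi> s \<omega> * innovation_drift s \<omega>)"
    proof (rule AE_I2)
      fix \<omega> assume \<omega>: "\<omega> \<in> space M"
      have "set_integrable lborel {0..t} (\<lambda>s. ?cov s (Y s \<omega>) * innovation_drift s \<omega>)"
        by (rule set_integrable_regular[OF reg \<omega>])
      then show "set_integrable lborel {0..t} (\<lambda>s. \<phi> s \<omega> * innovation_drift s \<omega>)"
        by (rule set_integrable_cong[THEN iffD1, rotated -1]) (auto simp: \<phi> \<omega>)
    qed
    show "has_ito_integral M F W (\<lambda>s \<omega>. \<phi> s \<omega> * 1) t ?K"
      by (rule has_ito_integral_cong[OF _ K]) (simp add: \<phi>)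
    show "AE \<omega> in M. ?J \<omega> = (LBINT s:{0..t}. \<phi> s \<omega> * innovation_drift s \<omega>) + ?K \<omega>"
      using \<phi>_drift by (intro AE_I2) simp
  qed
qed

end

lemma filtering_problemI:
  fixes h p0 :: "'a::euclidean_space \<Rightarrow> real"
  assumes "assumption_A1 p0" "assumption_A2 h"
  obtains B where "filtering_problem h p0 B"
proof -
  have cont: "continuous_on UNIV u" if "is_C2 u Du D2u" for u :: "'a \<Rightarrow> real" and Du D2u
    using that unfolding is_C2_def gderiv_def
    by (intro continuous_at_imp_continuous_on ballI has_derivative_continuous) blast
  obtain G DG D2G where G: "\<And>x. p0 x = exp (- G x)" "is_C2 G DG D2G" and p0: "p0 \<in> densities2"
    using assms(1) unfolding assumption_A1_def by blast
  obtain Dh D2h where h: "is_C2 h Dh D2h" "bounded (range h)"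
    using assms(2) unfolding assumption_A2_def by blast
  obtain B where B: "\<And>x. \<bar>h x\<bar> \<le> B"
    using h(2) unfolding bounded_iff by auto
  have "filtering_problem h p0 B"
  proof
    show "continuous_on UNIV h" by (rule cont[OF h(1)])
    show "continuous_on UNIV p0"
      unfolding G(1)[abs_def] by (intro continuous_intros cont[OF G(2)])
  qed (use B p0 G(1) in auto)
  then show ?thesis by (rule that)
qed

text \<open>Independence and measurability pass from \<open>X\<^sub>0\<close> to its image \<open>h (X\<^sub>0)\<close>.\<close>

lemma drifted_wiener_observation_model:
  fixes h p0 :: "'a::euclidean_space \<Rightarrow> real"
  assumes model: "observation_model M p0 h X W Z"
    and h: "continuous_on UNIV h" "\<And>x. \<bar>h x\<bar> \<le> B"
  shows "drifted_wiener M W (\<lambda>\<omega>. h (X 0 \<omega>)) B (model_filtration M X W)"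
proof -
  interpret prob_space M using model by (simp add: observation_model_def)
  have h_meas: "h \<in> borel_measurable borel"
    by (rule borel_measurable_continuous_onI[OF h(1)])
  have X0: "X 0 \<in> borel_measurable M"
    using model unfolding observation_model_def distributed_def by auto
  have gen: "{X 0 -` A \<inter> space M | A. A \<in> sets borel} \<union>
      {W s -` A \<inter> space M | s A. 0 \<le> s \<and> s \<le> t \<and> A \<in> sets borel} \<subseteq> Pow (space M)" for t
    by auto
  have space: "space (model_filtration M X W t) = space M" for t
    by (simp add: model_filtration_def space_measure_of_conv)
  have X0_F: "X 0 \<in> borel_measurable (model_filtration M X W t)" for t
  proof (rule measurableI)
    fix A :: "'a set" assume "A \<in> sets borel"
    then show "X 0 -` A \<inter> space (model_filtration M X W t) \<in> sets (model_filtration M X W t)"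
      unfolding space unfolding model_filtration_def sets_measure_of[OF gen] by (intro sigma_sets.Basic) blast
  qed simp
  have indep: "indep_set {X 0 -` A \<inter> space M | A. A \<in> sets borel}
       (sigma_sets (space M) {W t -` A \<inter> space M | t A. 0 \<le> t \<and> A \<in> sets borel})"
    using model by (simp add: observation_model_def)
  have sub: "{(\<lambda>\<omega>. h (X 0 \<omega>)) -` A \<inter> space M | A. A \<in> sets borel} \<subseteq> {X 0 -` A \<inter> space M | A. A \<in> sets borel}"
  proof safe
    fix A :: "real set" assume "A \<in> sets borel"
    then have "h -` A \<in> sets borel"
      using measurable_sets[OF h_meas] by simp
    then show "\<exists>A'. (\<lambda>\<omega>. h (X 0 \<omega>)) -` A \<inter> space M = X 0 -` A' \<inter> space M \<and> A' \<in> sets borel"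
      by (intro exI[of _ "h -` A"]) auto
  qed
  show ?thesis
  proof
    show "standard_wiener M W" using model by (simp add: observation_model_def)
    show "(\<lambda>\<omega>. h (X 0 \<omega>)) \<in> borel_measurable M"
      by (rule measurable_compose[OF X0 h_meas])
    show "\<bar>h (X 0 \<omega>)\<bar> \<le> B" for \<omega> by (rule h(2))
    show "indep_set {(\<lambda>\<omega>. h (X 0 \<omega>)) -` A \<inter> space M | A. A \<in> sets borel}
       (sigma_sets (space M) {W t -` A \<inter> space M | t A. 0 \<le> t \<and> A \<in> sets borel})"
    proof (rule indep_setI)
      show "{(\<lambda>\<omega>. h (X 0 \<omega>)) -` A \<inter> space M | A. A \<in> sets borel} \<subseteq> events"
        by (rule order_trans[OF sub indep_setD_ev1[OF indep]])
    qed (rule indep_setD_ev2[OF indep], rule indep_setD[OF indep subsetD[OF sub]])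
    show "space (model_filtration M X W t) = space M" for t by (rule space)
    show "(\<lambda>\<omega>. h (X 0 \<omega>)) \<in> borel_measurable (model_filtration M X W t)" for t
      by (rule measurable_compose[OF X0_F h_meas])
    show "W s \<in> borel_measurable (model_filtration M X W t)" if "0 \<le> s" "s \<le> t" for s t
    proof (rule measurableI)
      fix A :: "real set" assume "A \<in> sets borel"
      then show "W s -` A \<inter> space (model_filtration M X W t) \<in> sets (model_filtration M X W t)"
        using that unfolding space unfolding model_filtration_def sets_measure_of[OF gen]
        by (intro sigma_sets.Basic) blast
    qed simp
  qed
qed

theorem theorem3p2:
  fixes M :: "'w measure"
    and X :: "real \<Rightarrow> 'w \<Rightarrow> 'a::euclidean_space"
    and W Z :: "real \<Rightarrow> 'w \<Rightarrow> real"
    and p0 h :: "'a \<Rightarrow> real"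
    and T :: real
    and c :: "real \<Rightarrow> 'w \<Rightarrow> real"
    and \<rho> :: "real \<Rightarrow> 'w \<Rightarrow> 'a \<Rightarrow> real"
  assumes "T > 0"
    and "assumption_A1 p0"
    and "assumption_A2 h"
    and "observation_model M p0 h X W Z"
    and "\<And>t \<omega> x. t \<in> {0..T} \<Longrightarrow> \<omega> \<in> space M \<Longrightarrow>
           \<rho> t \<omega> x = c t \<omega> * exp (h x * (Z t \<omega> - Z 0 \<omega>) - 1 / 2 * \<bar>h x\<bar>\<^sup>2 * t) * p0 x"
    and "\<And>t \<omega>. t \<in> {0..T} \<Longrightarrow> \<omega> \<in> space M \<Longrightarrow> (\<integral>x. \<rho> t \<omega> x \<partial>lborel) = 1"
  shows "(\<forall>\<omega>\<in>space M. time_stepping_limit h p0 T (\<lambda>t. Z t \<omega>) (\<lambda>t. \<rho> t \<omega>)) \<and>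
         weak_filter_solution M (model_filtration M X W) W Z h p0 T \<rho>"
proof -
  note T = assms(1) and model = assms(4) and \<rho>_formula = assms(5) and \<rho>_mass = assms(6)
  obtain B where "filtering_problem h p0 B"
    using filtering_problemI[OF assms(2,3)] .
  then interpret filtering_problem h p0 B .
  interpret drifted_wiener M W "\<lambda>\<omega>. h (X 0 \<omega>)" B "model_filtration M X W"
    by (rule drifted_wiener_observation_model[OF model h_continuous h_bounded])
  interpret filtering_model h p0 B M W "\<lambda>\<omega>. h (X 0 \<omega>)" "model_filtration M X W" ..
  have h_meas: "h \<in> borel_measurable borel"
    by (rule borel_measurable_continuous_onI[OF h_continuous])
  have Z: "Z t \<omega> - Z 0 \<omega> = Y t \<omega>" if t: "0 \<le> t" and \<omega>: "\<omega> \<in> space M" for t \<omega>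
  proof -
    have X: "X s \<omega> = X 0 \<omega>" if "0 \<le> s" for s
      using model that \<omega> unfolding observation_model_def by blast
    have "(LBINT s:{0..t}. h (X s \<omega>)) = (LBINT s:{0..t}. h (X 0 \<omega>))"
      by (intro set_lebesgue_integral_cong) (auto intro!: arg_cong[where f = h] X)
    also have "\<dots> = h (X 0 \<omega>) * t"
      using t by (simp add: set_lebesgue_integral_def ac_simps)
    finally have drift: "(LBINT s:{0..t}. h (X s \<omega>)) = h (X 0 \<omega>) * t" .
    have "Z t \<omega> = Z 0 \<omega> + (LBINT s:{0..t}. h (X s \<omega>)) + (W t \<omega> - W 0 \<omega>)"
      using model t \<omega> unfolding observation_model_def by blast
    then show ?thesis
      using t by (simp add: drift Y_def W_0[OF \<omega>] max_absorb2)
  qed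
  have \<rho>: "\<rho> t \<omega> = posterior_density t (Z t \<omega> - Z 0 \<omega>)" if t: "t \<in> {0..T}" and \<omega>: "\<omega> \<in> space M" for t \<omega>
  proof
    fix x
    let ?z = "Z t \<omega> - Z 0 \<omega>"
    have eq: "\<rho> t \<omega> x = c t \<omega> * (1 * (prior.likelihood t ?z x * p0 x))" for x
      unfolding \<rho>_formula[OF t \<omega>] prior.likelihood_def by simp
    have "1 = c t \<omega> * prior.unnormalized (\<lambda>_. 1) t ?z"
      using \<rho>_mass[OF t \<omega>] unfolding eq integral_mult_right_zero
      by (simp add: unnormalized_eq_lborel)
    then have "c t \<omega> = 1 / prior.unnormalized (\<lambda>_. 1) t ?z"
      using prior.normalizer_pos[of t ?z] by (simp add: field_simps)
    then show "\<rho> t \<omega> x = posterior_density t ?z x"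
      unfolding eq posterior_density_def by simp
  qed
  then have \<rho>_Y: "\<rho> t \<omega> = posterior_density t (Y t \<omega>)" if "t \<in> {0..T}" "\<omega> \<in> space M" for t \<omega>
    using that Z by simp
  have limit: "time_stepping_limit h p0 T (\<lambda>t. Z t \<omega>) (\<lambda>t. \<rho> t \<omega>)" if \<omega>: "\<omega> \<in> space M" for \<omega>
  proof (rule time_stepping_limit_posterior[OF T])
    have "continuous_on {0..T} (\<lambda>t. Z 0 \<omega> + Y t \<omega>)"
      unfolding Y_def
      by (intro continuous_intros continuous_on_subset[OF W_continuous[OF \<omega>] subset_UNIV])
    then show "continuous_on {0..T} (\<lambda>t. Z t \<omega>)"
      by (rule continuous_on_cong[THEN iffD1, rotated -1]) (auto simp: \<omega> simp flip: Z)
  qed (rule \<rho>[OF _ \<omega>])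
  have hat: "h_hat h \<rho> s \<omega> = prior.posterior h s (Y s \<omega>)" if "s \<in> {0..T}" "\<omega> \<in> space M" for s \<omega>
    using pairing_posterior_density[OF h_meas] \<rho>_Y[OF that] by (simp add: h_hat_def)
  have "weak_filter_solution M (model_filtration M X W) W Z h p0 T \<rho>"
    unfolding weak_filter_solution_def
  proof (intro conjI ballI allI impI)
    show "\<rho> 0 \<omega> = p0" if "\<omega> \<in> space M" for \<omega>
      using \<rho>[of 0 \<omega>] that T by (simp add: posterior_density_0)
  next
    fix f :: "'a \<Rightarrow> real" assume f: "test_function f"
    have f_meas: "f \<in> borel_measurable borel"
      using f by (auto simp: test_function_def intro: borel_measurable_continuous_onI)
    have f_obs: "prior.observable f"
      using test_function_bounded[OF f] f_meas unfolding prior.observable_def by auto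
    define J where "J t \<omega> = prior.posterior f t (Y t \<omega>) - prior.posterior f 0 0" for t \<omega>
    let ?V = "\<lambda>s \<omega>. Z s \<omega> - (LBINT u:{0..s}. h_hat h \<rho> u \<omega>)"
    let ?\<phi> = "\<lambda>s \<omega>. pairing (\<lambda>x. (h x - h_hat h \<rho> s \<omega>) * f x) (\<rho> s \<omega>)"
    have \<phi>: "?\<phi> s \<omega> = prior.covariance f h s (Y s \<omega>)" if "s \<in> {0..T}" "\<omega> \<in> space M" for s \<omega>
    proof -
      have "(\<lambda>x. (h x - h_hat h \<rho> s \<omega>) * f x) \<in> borel_measurable borel"
        using h_meas f_meas by simp
      then have "?\<phi> s \<omega> = prior.posterior (\<lambda>x. (h x - h_hat h \<rho> s \<omega>) * f x) s (Y s \<omega>)"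
        unfolding \<rho>_Y[OF that] by (rule pairing_posterior_density)
      then show ?thesis
        by (simp add: posterior_centered[OF f_obs] prior.covariance_def hat[OF that])
    qed
    have V: "?V s \<omega> = ?V 0 \<omega> + Y s \<omega> - (LBINT u:{0..s}. prior.posterior h u (Y u \<omega>))"
      if s: "s \<in> {0..T}" and \<omega>: "\<omega> \<in> space M" for s \<omega>
    proof -
      have hat_integral: "(LBINT u:{0..r}. h_hat h \<rho> u \<omega>) = (LBINT u:{0..r}. prior.posterior h u (Y u \<omega>))"
        if "r \<in> {0..T}" for r
        using that \<omega> by (intro set_lebesgue_integral_cong) (auto simp: hat)
      have "(LBINT u:{0..0}. prior.posterior h u (Y u \<omega>)) = 0"
      proof -
        have "AE u in lborel. indicator {0..0} u *\<^sub>R prior.posterior h u (Y u \<omega>) = 0"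
          using AE_lborel_singleton[of 0] by eventually_elim auto
        then show ?thesis
          unfolding set_lebesgue_integral_def by (rule integral_eq_zero_AE)
      qed
      then show ?thesis
        using Z[of s \<omega>] s \<omega> T hat_integral[of 0] hat_integral[OF s] by simp
    qed
    show "\<exists>J. (\<forall>t\<in>{0..T}. has_stochastic_integral M (model_filtration M X W) W ?V ?\<phi> t (J t)) \<and>
        (AE \<omega> in M. continuous_on {0..T} (\<lambda>t. J t \<omega>)) \<and>
        (AE \<omega> in M. \<forall>t\<in>{0..T}. pairing f (\<rho> t \<omega>) = pairing f (\<rho> 0 \<omega>) + J t \<omega>)"
    proof (intro exI[of _ J] conjI ballI AE_I2)
      fix t assume t: "t \<in> {0..T}"
      then have sub: "s \<in> {0..T}" if "s \<in> {0..t}" for s using that by auto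
      show "has_stochastic_integral M (model_filtration M X W) W ?V ?\<phi> t (J t)"
        unfolding J_def[abs_def]
        by (rule posterior_filter_equation[OF f_obs]) (use t V[OF sub] \<phi>[OF sub] in auto)
    next
      fix \<omega> assume \<omega>: "\<omega> \<in> space M"
      have "continuous_on UNIV (\<lambda>t. prior.posterior f t (Y t \<omega>))"
        using regular_processD(3)[OF regular_process_along_Y[OF prior.bounded_lipschitz_posterior[OF f_obs]] \<omega>] .
      then show "continuous_on {0..T} (\<lambda>t. J t \<omega>)"
        unfolding J_def by (intro continuous_intros) (rule continuous_on_subset, auto)
    next
      fix \<omega> t assume \<omega>: "\<omega> \<in> space M" and t: "t \<in> {0..T}"
      have "pairing f (\<rho> s \<omega>) = prior.posterior f s (Y s \<omega>)" if "s \<in> {0..T}" for s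
        unfolding \<rho>_Y[OF that \<omega>] by (rule pairing_posterior_density[OF f_meas])
      then show "pairing f (\<rho> t \<omega>) = pairing f (\<rho> 0 \<omega>) + J t \<omega>"
        using t T Y_0[OF \<omega>] by (simp add: J_def)
    qed
  qed
  then show ?thesis using limit by blast
qed

end
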